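(* Let $b_1<0<b_2$, $B=\operatorname{diag}(b_1,b_2)$, let $Q=\begin{pmatrix}0&Q_{12}\\ Q_{21}&0\end{pmatrix}\in L^1[0,1]\otimes\mathbb{C}^{2\times2}$, let the boundary conditions $$U_j(y)=a_{j1}y_1(0)+a_{j2}y_2(0)+a_{j3}y_1(1)+a_{j4}y_2(1)=0,\qquad j\in\{1,2\},$$ be regular, and let $\Delta(\cdot)$ be the corresponding characteristic determinant of the problem consisting of $-iB^{-1}y'+Q(x)y=\lambda y$, $x\in[0,1]$, and these boundary conditions. Let $\Lambda_0=\{\lambda_n^0\}_{n\in\mathbb{Z}}$ be the sequence of zeros (counting multiplicity) of the characteristic determinant $\Delta_0(\cdot)$ corresponding to $Q=0$, ordered so that $\operatorname{Re}\lambda_n^0\le\operatorname{Re}\lambda_{n+1}^0$, $n\in\mathbb{Z}$. Then the sequence $\Lambda=\{\lambda_n\}_{n\in\mathbb{Z}}$ of zeros of $\Delta(\cdot)$ (counting multiplicity) can be ordered in such a way that $$\lambda_n=\lambda_n^0+o(1)\quad\text{as } n\to\infty,\ n\in\mathbb{Z}\quad(\text{i.e. as }|n|\to\infty).$$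
   Context: Let $\Phi(\cdot,\lambda)=(\Phi_1(\cdot,\lambda)\ \Phi_2(\cdot,\lambda))$ be the fundamental matrix solution of $-iB^{-1}y'+Q(x)y=\lambda y$ with $\Phi(0,\lambda)=I_2$ and columns $\Phi_1,\Phi_2$. The characteristic determinant is $\Delta(\lambda)=\det\bigl(U_j(\Phi_k(\cdot,\lambda))\bigr)_{j,k=1}^2$. Put $J_{jk}=\det\begin{pmatrix}a_{1j}&a_{1k}\\ a_{2j}&a_{2k}\end{pmatrix}$, $j,k\in\{1,\dots,4\}$, where $a_{jk}\in\mathbb{C}$. For $Q=0$ one has $$\Delta_0(\lambda)=J_{12}+J_{34}e^{i(b_1+b_2)\lambda}+J_{32}e^{ib_1\lambda}+J_{14}e^{ib_2\lambda}.$$ The boundary conditions are called regular if $J_{14}J_{32}\neq0$. *)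

theory Defs
  imports "HOL-Complex_Analysis.Complex_Analysis"
begin

text \<open>Classical epsilon-delta absolute continuity of a function on an interval \<open>S\<close>; the finite
  families of non-overlapping compact subintervals are the divisions of their own unions.\<close>

definition abs_continuous_on :: "real set \<Rightarrow> (real \<Rightarrow> 'a::real_normed_vector) \<Rightarrow> bool" where
  "abs_continuous_on S f \<longleftrightarrow>
    (\<forall>\<epsilon>>0. \<exists>\<delta>>0. \<forall>D. D division_of \<Union>D \<and> \<Union>D \<subseteq> S \<and> (\<Sum>K\<in>D. Sup K - Inf K) < \<delta>
      \<longrightarrow> (\<Sum>K\<in>D. norm (f (Sup K) - f (Inf K))) < \<epsilon>)"

definition diag2 :: "complex \<Rightarrow> complex \<Rightarrow> complex^2^2" where
  "diag2 p q = vector [vector [p, 0], vector [0, q]]"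

definition offdiag2 :: "complex \<Rightarrow> complex \<Rightarrow> complex^2^2" where
  "offdiag2 p q = vector [vector [0, p], vector [q, 0]]"

text \<open>Solutions of \<open>- i B\<^sup>-\<^sup>1 y' + Q(x) y = \<mu> y\<close> on \<open>[0,1]\<close> in the Caratheodory sense, as is usual
  for summable \<open>Q\<close>: \<open>y\<close> is absolutely continuous and the equation holds almost everywhere.\<close>

definition dirac_solution ::
  "complex^2^2 \<Rightarrow> (real \<Rightarrow> complex^2^2) \<Rightarrow> complex \<Rightarrow> (real \<Rightarrow> complex^2) \<Rightarrow> bool" where
  "dirac_solution B Q \<mu> y \<longleftrightarrow>
    abs_continuous_on {0..1} y \<and>
    (AE x in lebesgue. x \<in> {0..1} \<longrightarrow>
      (\<exists>y'. (y has_vector_derivative y') (at x within {0..1}) \<and>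
        (- \<i>) *s (matrix_inv B *v y') + Q x *v y x = \<mu> *s y x))"

definition fundamental_matrix ::
  "complex^2^2 \<Rightarrow> (real \<Rightarrow> complex^2^2) \<Rightarrow> (real \<Rightarrow> complex \<Rightarrow> complex^2^2) \<Rightarrow> bool" where
  "fundamental_matrix B Q \<Phi> \<longleftrightarrow>
    (\<forall>\<mu>. \<Phi> 0 \<mu> = mat 1 \<and> (\<forall>k. dirac_solution B Q \<mu> (\<lambda>x. column k (\<Phi> x \<mu>))))"

text \<open>The coefficient matrix \<open>a\<close> has 2 rows and 4 columns; its entry \<open>a\<^sub>j\<^sub>k\<close> is \<open>a $ j $ k\<close>.\<close>

definition boundary_form :: "complex^4^2 \<Rightarrow> 2 \<Rightarrow> (real \<Rightarrow> complex^2) \<Rightarrow> complex" where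
  "boundary_form a j y =
    a $ j $ 1 * y 0 $ 1 + a $ j $ 2 * y 0 $ 2 + a $ j $ 3 * y 1 $ 1 + a $ j $ 4 * y 1 $ 2"

definition char_det :: "complex^4^2 \<Rightarrow> (real \<Rightarrow> complex \<Rightarrow> complex^2^2) \<Rightarrow> complex \<Rightarrow> complex" where
  "char_det a \<Phi> \<mu> = det (\<chi> j k. boundary_form a j (\<lambda>x. column k (\<Phi> x \<mu>)))"

definition bc_minor :: "complex^4^2 \<Rightarrow> 4 \<Rightarrow> 4 \<Rightarrow> complex" where
  "bc_minor a j k = det (vector [vector [a $ 1 $ j, a $ 1 $ k],
                                 vector [a $ 2 $ j, a $ 2 $ k]] :: complex^2^2)"

definition regular_bc :: "complex^4^2 \<Rightarrow> bool" where
  "regular_bc a \<longleftrightarrow> bc_minor a 1 4 * bc_minor a 3 2 \<noteq> 0"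

text \<open>\<open>s\<close> lists, over index set \<open>\<int>\<close>, all zeros of the entire function \<open>f\<close>, each repeated according
  to its multiplicity. The finiteness clause is needed because \<open>card\<close> of an infinite set is \<open>0\<close>.\<close>

definition zero_sequence :: "(complex \<Rightarrow> complex) \<Rightarrow> (int \<Rightarrow> complex) \<Rightarrow> bool" where
  "zero_sequence f s \<longleftrightarrow>
    (\<forall>z. finite {n. s n = z} \<and>
         card {n. s n = z} = (if f z = 0 then nat (zorder f z) else 0))"

end

theory Submission
  imports Defs
begin

text \<open>Write \<open>\<Delta> = \<Delta>\<^sub>0 + g\<close> and \<open>w(\<mu>) = exp(- b\<^sub>1 Im \<mu>) + exp(- b\<^sub>2 Im \<mu>)\<close>. A Riemann-Lebesgue argument
  for the integral equations equivalent to the system gives \<open>g = o(w)\<close> in the whole plane, while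
  regularity makes \<open>\<Delta>\<^sub>0\<close> at least a constant multiple of \<open>w\<close> off a horizontal strip, and on some
  small circle around each point of the strip. Consider the open set
  \<open>V = {\<mu>. |\<Delta>\<^sub>0(\<mu>)| < |g(\<mu>)| + w(\<mu>) / (1 + |\<mu>|)}\<close>. It contains all zeros of \<open>\<Delta>\<^sub>0\<close> and of \<open>\<Delta>\<close>; its
  components are bounded, since such circles enclose them, and their diameters tend to \<open>0\<close> far out;
  and \<open>|g| < |\<Delta>\<^sub>0|\<close> on their boundaries. By Rouche's theorem \<open>\<Delta>\<^sub>0\<close> and \<open>\<Delta>\<close> have equally many zeros in
  each component, and matching the zeros component by component gives the required ordering.\<close>

unbundle no Formal_Power_Series.fps_syntax

subsection \<open>Zeros of entire functions under perturbation\<close>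

text \<open>Since b1 < 0 < b2, exp(i b1 \<mu>) dominates the other terms of the free determinant
  high in the upper half-plane and exp(i b2 \<mu>) does so far down in the lower one; regularity
  says that their coefficients J32 and J14 do not vanish. The same two exponentials bound the growth
  of all solutions, so one weight measures both the perturbation and the lower bound. The potential
  has zero diagonal: the determinant of \<Phi>(1,\<mu>) is therefore the one for Q = 0, the J12 and
  J34 terms cancel in g, and only single entries of \<Phi>(1,\<mu>) need estimates. In V the summand
  w / (1 + |\<mu>|) makes the inclusion of the zeros and the inequality on the boundary strict;
  being o(w), it is harmless far out. A separate obstacle is that \<Phi> is given for each \<mu> on
  its own, so that its analyticity in \<mu> has to be proved. Wronskians with a solution for a
  frozen parameter achieve this, because the potential drops out of them.\<close>

definition zero_count :: "(complex \<Rightarrow> complex) \<Rightarrow> complex set \<Rightarrow> nat" where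
  "zero_count f U = (\<Sum>z | z \<in> U \<and> f z = 0. nat (zorder f z))"

text \<open>Infinitely many zeros in the compact closure would accumulate and force f to vanish
  identically, which \<open>f w \<noteq> 0\<close> excludes. This finiteness gives
  \<open>zero_count\<close> its meaning, since a sum over an infinite set is 0 by default.\<close>

lemma finite_zeros_bounded:
  assumes "f holomorphic_on UNIV" "f w \<noteq> 0" "bounded U"
  shows "finite {z. z \<in> U \<and> f z = 0}"
proof -
  have "finite {z \<in> closure U. f z = 0}"
  proof (cases "f constant_on UNIV")
    case True
    then have "f z \<noteq> 0" for z using assms(2) by (auto simp: constant_on_def)
    then show ?thesis by simp
  next
    case False
    with assms show ?thesis
      by (intro holomorphic_compact_finite_zeros) (auto simp: compact_closure)
  qed
  then show ?thesis
    by (rule rev_finite_subset) (use closure_subset in auto)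
qed

lemma zorder_pos_at_zero:
  assumes "f holomorphic_on UNIV" "f w \<noteq> 0" "f z = 0"
  shows "zorder f z > 0"
  using zorder_exist_zero[of f UNIV z] assms by auto

section \<open>Rouche's theorem, from discs to bounded open sets\<close>

text \<open>The library form of Rouche's theorem weights zeros by winding numbers; for a circle
  these are 1 inside and 0 outside. The ball of radius \<open>r + 1\<close> is merely an open
  connected neighbourhood of the closed disc.\<close>

lemma zero_count_ball_winding:
  assumes f: "f holomorphic_on UNIV" and r: "0 < r" and nz: "\<And>z. dist c z = r \<Longrightarrow> f z \<noteq> 0"
  shows "(\<Sum>p | p \<in> ball c (r+1) \<and> f p = 0. winding_number (circlepath c r) p * zorder f p)
    = of_nat (zero_count f (ball c r))"
proof -
  have "dist c (c + of_real r) = r" using r by (simp add: dist_norm)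
  then have w: "f (c + of_real r) \<noteq> 0" using nz by blast
  have fin: "finite {p. p \<in> ball c (r+1) \<and> f p = 0}"
    using finite_zeros_bounded[OF f w bounded_ball] by blast
  have "(\<Sum>p | p \<in> ball c (r+1) \<and> f p = 0. winding_number (circlepath c r) p * zorder f p)
    = (\<Sum>p | p \<in> ball c r \<and> f p = 0. winding_number (circlepath c r) p * zorder f p)"
  proof (rule sum.mono_neutral_right[OF fin])
    show "{p. p \<in> ball c r \<and> f p = 0} \<subseteq> {p. p \<in> ball c (r + 1) \<and> f p = 0}" by auto
    show "\<forall>p\<in>{p. p \<in> ball c (r + 1) \<and> f p = 0} - {p. p \<in> ball c r \<and> f p = 0}.
       winding_number (circlepath c r) p * zorder f p = 0"
    proof
      fix p assume p: "p \<in> {p. p \<in> ball c (r + 1) \<and> f p = 0} - {p. p \<in> ball c r \<and> f p = 0}"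
      then have "dist c p \<noteq> r" using nz by blast
      with p have out: "p \<notin> cball c r" by auto
      have "winding_number (circlepath c r) p = 0"
        by (rule winding_number_zero_outside[of _ "cball c r"]) (use out r in auto)
      then show "winding_number (circlepath c r) p * zorder f p = 0" by simp
    qed
  qed
  also have "\<dots> = (\<Sum>p | p \<in> ball c r \<and> f p = 0. of_nat (nat (zorder f p)))"
  proof (rule sum.cong[OF refl])
    fix p assume p: "p \<in> {p. p \<in> ball c r \<and> f p = 0}"
    have "winding_number (circlepath c r) p = 1"
      by (rule winding_number_circlepath) (use p in \<open>auto simp: dist_norm norm_minus_commute\<close>)
    moreover have "zorder f p > 0" using zorder_pos_at_zero[OF f w] p by auto
    ultimately show "winding_number (circlepath c r) p * zorder f p = of_nat (nat (zorder f p))"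
      by simp
  qed
  finally show ?thesis by (simp add: zero_count_def)
qed

lemma Rouche_ball:
  assumes f: "f holomorphic_on UNIV" and g: "g holomorphic_on UNIV" and r: "0 < r"
    and less: "\<And>z. dist c z = r \<Longrightarrow> norm (g z) < norm (f z)"
  shows "zero_count (\<lambda>z. f z + g z) (ball c r) = zero_count f (ball c r)"
proof -
  have nzf: "f z \<noteq> 0" if "dist c z = r" for z using less[OF that] by auto
  have nzfg: "f z + g z \<noteq> 0" if "dist c z = r" for z
    using less[OF that] by (metis add_eq_0_iff norm_minus_cancel less_irrefl)
  have hol: "(\<lambda>z. f z + g z) holomorphic_on UNIV" using f g by (intro holomorphic_intros)
  have d: "dist c (c + of_real r) = r" using r by (simp add: dist_norm)
  have fin1: "finite {p. p \<in> ball c (r+1) \<and> f p = 0}"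
    using finite_zeros_bounded[OF f nzf[OF d] bounded_ball] by blast
  have fin2: "finite {p. p \<in> ball c (r+1) \<and> f p + g p = 0}"
    using finite_zeros_bounded[OF hol nzfg[OF d] bounded_ball] by blast
  have "(\<Sum>p | p \<in> ball c (r+1) \<and> f p + g p = 0. winding_number (circlepath c r) p * zorder (\<lambda>z. f z + g z) p)
     = (\<Sum>p | p \<in> ball c (r+1) \<and> f p = 0. winding_number (circlepath c r) p * zorder f p)"
  proof (rule Rouche_theorem)
    show "\<forall>z. z \<notin> ball c (r + 1) \<longrightarrow> winding_number (circlepath c r) z = 0"
    proof (intro allI impI)
      fix z assume z: "z \<notin> ball c (r+1)"
      show "winding_number (circlepath c r) z = 0"
        by (rule winding_number_zero_outside[of _ "cball c r"]) (use z r in auto)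
    qed
    show "\<forall>z\<in>path_image (circlepath c r). cmod (g z) < cmod (f z)"
      using less r by auto
    show "path_image (circlepath c r) \<subseteq> ball c (r + 1)" using r by auto
  qed (use fin1 fin2 holomorphic_on_subset[OF f] holomorphic_on_subset[OF g] in auto)
  then have "(of_nat (zero_count (\<lambda>z. f z + g z) (ball c r)) :: complex) = of_nat (zero_count f (ball c r))"
    using zero_count_ball_winding[OF f r nzf] zero_count_ball_winding[OF hol r nzfg] by simp
  then show ?thesis by simp
qed

lemma zero_count_decompose:
  assumes "finite Z" and fin: "finite {z. z \<in> U \<and> f z = 0}"
    and disj: "\<And>x y. x \<in> Z \<Longrightarrow> y \<in> Z \<Longrightarrow> x \<noteq> y \<Longrightarrow> ball x r \<inter> ball y r = {}"
    and sub: "\<And>x. x \<in> Z \<Longrightarrow> ball x r \<subseteq> U"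
    and cov: "\<And>z. z \<in> U \<Longrightarrow> f z = 0 \<Longrightarrow> \<exists>x\<in>Z. z \<in> ball x r"
  shows "zero_count f U = (\<Sum>x\<in>Z. zero_count f (ball x r))"
proof -
  have eq: "{z. z \<in> U \<and> f z = 0} = (\<Union>x\<in>Z. {z. z \<in> ball x r \<and> f z = 0})"
    using sub cov by blast
  have fin': "\<forall>x\<in>Z. finite {z. z \<in> ball x r \<and> f z = 0}"
    using sub by (intro ballI finite_subset[OF _ fin]) blast
  have d: "\<forall>x\<in>Z. \<forall>y\<in>Z. x \<noteq> y \<longrightarrow>
    {z. z \<in> ball x r \<and> f z = 0} \<inter> {z. z \<in> ball y r \<and> f z = 0} = {}"
    using disj by blast
  show ?thesis unfolding zero_count_def eq
    using sum.UNION_disjoint[OF \<open>finite Z\<close> fin' d] by simp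
qed

text \<open>Each zero of f gets a small disc. Off the discs |f| has a positive lower bound, so a
  small multiple of g creates no zeros there, and inside each disc Rouche's theorem for circles
  preserves the count.\<close>

lemma zero_count_stable:
  assumes f: "f holomorphic_on UNIV" and g: "g holomorphic_on UNIV"
    and U: "open U" "bounded U" "U \<noteq> {}" and nz: "\<And>z. z \<in> frontier U \<Longrightarrow> f z \<noteq> 0"
  shows "\<exists>d>0. \<forall>s. norm s < d \<longrightarrow> zero_count (\<lambda>z. f z + s * g z) U = zero_count f U"
proof -
  \<comment> \<open>A nonempty bounded set is not the whole plane and so has a boundary point; f
    does not vanish there, which makes the zeros in U finite in number.\<close>
  obtain w where w: "w \<in> frontier U" 
    using U frontier_not_empty[of U] not_bounded_UNIV by fastforce
  define Z where "Z = {z. z \<in> U \<and> f z = 0}"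
  have finZ: "finite Z" unfolding Z_def using finite_zeros_bounded[OF f nz[OF w]] U by auto
  have "\<forall>x\<in>Z. \<exists>r>0. ball x r \<subseteq> U" using U by (auto simp: Z_def open_contains_ball)
  then obtain r1 where r1: "\<And>x. x \<in> Z \<Longrightarrow> r1 x > 0 \<and> ball x (r1 x) \<subseteq> U" by metis
  have "\<exists>r>0. \<forall>x\<in>Z. \<forall>y\<in>Z. x \<noteq> y \<longrightarrow> r \<le> dist x y"
  proof (cases "{(x,y). x \<in> Z \<and> y \<in> Z \<and> x \<noteq> y} = {}")
    case False
    let ?P = "{(x,y). x \<in> Z \<and> y \<in> Z \<and> x \<noteq> y}"
    have fP: "finite ?P" by (rule finite_subset[of _ "Z \<times> Z"]) (use finZ in auto)
    let ?D = "(\<lambda>(x,y). dist x y) ` ?P"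
    have "Min ?D \<in> ?D" using fP False by (intro Min_in) auto
    then have "Min ?D > 0" by auto
    moreover have "Min ?D \<le> dist x y" if "x \<in> Z" "y \<in> Z" "x \<noteq> y" for x y
      using fP that by (intro Min_le) auto
    ultimately show ?thesis by blast
  qed (auto intro: exI[of _ 1])
  then obtain r2 where r2: "r2 > 0" "\<And>x y. x \<in> Z \<Longrightarrow> y \<in> Z \<Longrightarrow> x \<noteq> y \<Longrightarrow> r2 \<le> dist x y" by blast
  \<comment> \<open>Half the least distance keeps the discs disjoint, the radii \<open>r1\<close>
    keep them inside U. The inserted element also covers the case without zeros.\<close>
  define r where "r = Min (insert (r2/2) (r1 ` Z))"
  have r0: "r > 0" unfolding r_def using finZ r1 r2 by (subst Min_gr_iff) auto
  have rr1: "ball x r \<subseteq> U" if "x \<in> Z" for x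
  proof -
    have "r \<le> r1 x" unfolding r_def using finZ that by (intro Min_le) auto
    then have "ball x r \<subseteq> ball x (r1 x)" by (rule subset_ball)
    then show ?thesis using r1[OF that] by blast
  qed
  have rr2: "r \<le> r2/2" unfolding r_def using finZ by (intro Min_le) auto
  have disj: "ball x r \<inter> ball y r = {}" if "x \<in> Z" "y \<in> Z" "x \<noteq> y" for x y
  proof -
    have "r2 \<le> dist x y" using r2 that by auto
    then have "r + r \<le> dist x y" using rr2 by linarith
    then show ?thesis by (intro disjoint_ballI) auto
  qed
  \<comment> \<open>K is compact and contains the frontier of U as well as the circles bounding the
    discs, so one lower bound for |f| on K serves both outside the discs and on the circles.\<close>
  define K where "K = closure U - (\<Union>x\<in>Z. ball x r)"
  have cK: "compact K" unfolding K_def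
    using U by (intro compact_diff) (auto simp: compact_closure)
  have nzK: "f z \<noteq> 0" if "z \<in> K" for z
  proof
    assume "f z = 0"
    then have "z \<notin> frontier U" using nz by auto
    then have "z \<in> U" using that U by (auto simp: K_def frontier_def interior_open)
    then show False using that \<open>f z = 0\<close> r0 by (auto simp: K_def Z_def)
  qed
  have "\<exists>m>0. \<forall>z\<in>K. m \<le> norm (f z)"
  proof (cases "K = {}")
    case False
    have "continuous_on K (\<lambda>z. norm (f z))"
      by (intro continuous_on_norm holomorphic_on_imp_continuous_on holomorphic_on_subset[OF f]) simp
    from continuous_attains_inf[OF cK False this] obtain x where "x \<in> K" "\<And>y. y \<in> K \<Longrightarrow> norm (f x) \<le> norm (f y)" by auto
    then show ?thesis using nzK by (intro exI[of _ "norm (f x)"]) auto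
  qed (auto intro: exI[of _ 1])
  then obtain m where m: "m > 0" "\<And>z. z \<in> K \<Longrightarrow> m \<le> norm (f z)" by auto
  have "bounded (g ` closure U)"
    using U by (intro compact_imp_bounded compact_continuous_image
        holomorphic_on_imp_continuous_on holomorphic_on_subset[OF g]) (auto simp: compact_closure)
  then obtain M where M: "M > 0" "\<And>z. z \<in> closure U \<Longrightarrow> norm (g z) \<le> M" 
    by (auto simp: bounded_pos)
  show ?thesis
  proof (intro exI[of _ "m / M"] conjI allI impI)
    show "m / M > 0" using m M by simp
    fix s :: complex assume s: "norm s < m / M"
    have small: "norm (s * g z) < norm (f z)" if "z \<in> K" for z
    proof -
      have "norm (s * g z) \<le> norm s * M"
        using M(2)[of z] that by (auto simp: norm_mult K_def intro!: mult_left_mono)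
      also have "\<dots> < m" using s M by (simp add: field_simps)
      finally show ?thesis using m(2)[OF that] by simp
    qed
    have hol: "(\<lambda>z. f z + s * g z) holomorphic_on UNIV" using f g by (intro holomorphic_intros)
    have wK: "w \<in> K"
    proof -
      have "w \<notin> U" "w \<in> closure U" using w U by (auto simp: frontier_def interior_open)
      then show ?thesis using rr1 unfolding K_def by blast
    qed
    have ne: "f z + s * g z \<noteq> 0" if "z \<in> K" for z
      using small[OF that] by (metis add_eq_0_iff norm_minus_cancel less_irrefl)
    have fin: "finite {z. z \<in> U \<and> f z + s * g z = 0}"
      using finite_zeros_bounded[OF hol ne[OF wK]] U by auto
    have "zero_count (\<lambda>z. f z + s * g z) U = (\<Sum>x\<in>Z. zero_count (\<lambda>z. f z + s * g z) (ball x r))"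
    proof (rule zero_count_decompose[OF finZ fin disj rr1])
      fix z assume z: "z \<in> U" "f z + s * g z = 0"
      then have "z \<notin> K" using ne by blast
      then show "\<exists>x\<in>Z. z \<in> ball x r" using z closure_subset by (auto simp: K_def)
    qed
    also have "\<dots> = (\<Sum>x\<in>Z. zero_count f (ball x r))"
    proof (rule sum.cong[OF refl])
      fix x assume x: "x \<in> Z"
      show "zero_count (\<lambda>z. f z + s * g z) (ball x r) = zero_count f (ball x r)"
      proof (rule Rouche_ball[OF f _ r0])
        show "(\<lambda>z. s * g z) holomorphic_on UNIV" using g by (intro holomorphic_intros)
        fix z assume z: "dist x z = r"
        have "z \<in> closure (ball x r)" using z r0 by (simp add: closure_ball)
        then have zc: "z \<in> closure U" using rr1[OF x] closure_mono by blast
        have "z \<notin> ball y r" if "y \<in> Z" for y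
        proof (cases "y = x")
          case False
          have "ball y r \<inter> closure (ball x r) = {}"
            using disj[OF that x False] open_Int_closure_eq_empty[of "ball y r" "ball x r"] by simp
          then show ?thesis using \<open>z \<in> closure (ball x r)\<close> by blast
        qed (use z in auto)
        then have "z \<in> K" using zc by (auto simp: K_def)
        then show "norm (s * g z) < norm (f z)" by (rule small)
      qed
    qed
    also have "\<dots> = zero_count f U"
    proof (rule zero_count_decompose[symmetric, OF finZ _ disj rr1])
      show "finite {z. z \<in> U \<and> f z = 0}" using finZ by (simp add: Z_def)
      fix z assume "z \<in> U" "f z = 0"
      then show "\<exists>x\<in>Z. z \<in> ball x r" using r0 by (intro bexI[of _ z]) (auto simp: Z_def)
    qed
    finally show "zero_count (\<lambda>z. f z + s * g z) U = zero_count f U" .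
  qed
qed

text \<open>The library version of Rouche's theorem needs a closed path around the zeros; the boundary of
  an arbitrary bounded open set is not one, so we deform \<open>f\<close> to \<open>f + g\<close> instead.\<close>

theorem Rouche_bounded_open:
  assumes f: "f holomorphic_on UNIV" and g: "g holomorphic_on UNIV"
    and U: "open U" "bounded U" and less: "\<And>z. z \<in> frontier U \<Longrightarrow> norm (g z) < norm (f z)"
  shows "zero_count (\<lambda>z. f z + g z) U = zero_count f U"
proof (cases "U = {}")
  case False
  define h where "h = (\<lambda>t::real. \<lambda>z. f z + of_real t * g z)"
  have hol: "h t holomorphic_on UNIV" for t unfolding h_def using f g by (intro holomorphic_intros)
  have loc: "\<exists>d>0. \<forall>t. dist t t0 < d \<longrightarrow> zero_count (h t) U = zero_count (h t0) U" 
    if t0: "t0 \<in> {0..1}" for t0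
  proof -
    have "h t0 z \<noteq> 0" if "z \<in> frontier U" for z
    proof
      assume "h t0 z = 0"
      then have "f z = - (of_real t0 * g z)" unfolding h_def by (simp add: add_eq_0_iff2)
      then have "norm (f z) = norm (of_real t0 * g z)" by simp
      also have "\<dots> \<le> 1 * norm (g z)" using t0 unfolding norm_mult by (intro mult_right_mono) auto
      finally show False using less[OF that] by simp
    qed
    from zero_count_stable[OF hol[of t0] g U False this] obtain d where d: "d > 0"
      "\<And>s. norm s < d \<Longrightarrow> zero_count (\<lambda>z. h t0 z + s * g z) U = zero_count (h t0) U" by blast
    have "zero_count (h t) U = zero_count (h t0) U" if "dist t t0 < d" for t
    proof -
      have "h t = (\<lambda>z. h t0 z + of_real (t - t0) * g z)" by (auto simp: h_def algebra_simps)
      moreover have "norm (of_real (t - t0) :: complex) < d" using that 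
        unfolding norm_of_real by (simp add: dist_real_def)
      ultimately show ?thesis using d(2) by metis
    qed
    then show ?thesis using d(1) by blast
  qed
  \<comment> \<open>The count is locally constant in the deformation parameter, hence constant on
    the connected interval.\<close>
  have "(\<lambda>t. zero_count (h t) U) constant_on {0..1}"
  proof (rule locally_constant_imp_constant)
    fix a :: real assume "a \<in> {0..1}"
    from loc[OF this] obtain d where d: "d > 0"
      "\<forall>t. dist t a < d \<longrightarrow> zero_count (h t) U = zero_count (h a) U"
      by (elim exE conjE)
    show "\<exists>T. openin (top_of_set {0..1}) T \<and> a \<in> T \<and> (\<forall>x\<in>T. zero_count (h x) U = zero_count (h a) U)"
    proof (intro exI[of _ "{0..1} \<inter> ball a d"] conjI ballI)
      fix x assume "x \<in> {0..1} \<inter> ball a d"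
      then have "dist x a < d" by (simp add: dist_commute)
      then show "zero_count (h x) U = zero_count (h a) U" using d(2) by metis
    qed (use \<open>a \<in> {0..1}\<close> \<open>d > 0\<close> in \<open>auto simp: openin_open_Int\<close>)
  qed auto
  then have "zero_count (h 1) U = zero_count (h 0) U" by (auto simp: constant_on_def)
  then show ?thesis by (simp add: h_def)
qed (simp add: zero_count_def)

section \<open>Pairing the zeros of an entire function with those of its perturbation\<close>

lemma zero_sequence_zero:
  assumes "zero_sequence f s"
  shows "f (s n) = 0"
proof (rule ccontr)
  assume "f (s n) \<noteq> 0"
  then have "card {m. s m = s n} = 0" "finite {m. s m = s n}" using assms by (auto simp: zero_sequence_def)
  then show False by auto
qed

text \<open>By Rouche's theorem the indices n with \<open>s n\<close> in a given component are as
  many as the zeros of f + g in it, repeated by multiplicity. Bijections chosen in each component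
  are glued to one on all integers, and t is its first coordinate.\<close>

lemma zeros_matching:
  assumes f: "f holomorphic_on UNIV" and g: "g holomorphic_on UNIV" and V: "open V"
    and zf: "\<And>z. f z = 0 \<Longrightarrow> z \<in> V" and zfg: "\<And>z. f z + g z = 0 \<Longrightarrow> z \<in> V"
    and out: "\<And>z. z \<notin> V \<Longrightarrow> norm (g z) < norm (f z)"
    and bdd: "\<And>C. C \<in> components V \<Longrightarrow> bounded C"
    and s: "zero_sequence f s"
  shows "\<exists>t. zero_sequence (\<lambda>z. f z + g z) t \<and> (\<forall>n. \<exists>C\<in>components V. s n \<in> C \<and> t n \<in> C)"
proof -
  define h where "h = (\<lambda>z. f z + g z)"
  have hol: "h holomorphic_on UNIV" unfolding h_def using f g by (intro holomorphic_intros)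
  \<comment> \<open>Otherwise the connected plane would be an unbounded component. A point outside V
    is a zero of neither function.\<close>
  have "V \<noteq> UNIV"
    using bdd[of UNIV] by (auto simp: components_eq_sing_iff)
  then obtain w where w: "w \<notin> V" by blast
  have fw: "f w \<noteq> 0" and hw: "h w \<noteq> 0" using zf zfg w by (auto simp: h_def)
  define comp where "comp = (\<lambda>z. connected_component_set V z)"
  have comp: "comp z \<in> components V" "z \<in> comp z" if "z \<in> V" for z
    using that by (auto simp: comp_def components_def)
  have comp_eq: "comp z = C" if "C \<in> components V" "z \<in> C" for z C
  proof -
    from that(1) obtain x where "C = connected_component_set V x" by (auto simp: components_def)
    with that(2) show ?thesis unfolding comp_def using connected_component_eq by metis
  qed
  have count: "zero_count h C = zero_count f C" if C: "C \<in> components V" for C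
    unfolding h_def
  proof (rule Rouche_bounded_open[OF f g open_components[OF V C] bdd[OF C]])
    fix z assume "z \<in> frontier C"
    \<comment> \<open>The component of a frontier point z in V would be an open neighbourhood of z,
      so it would meet C and equal C; but the open set C contains no point of its frontier.\<close>
    have "z \<notin> V"
    proof
      assume zV: "z \<in> V"
      have "open (comp z)" using open_components[OF V comp(1)[OF zV]] .
      moreover have "z \<in> comp z" using comp(2)[OF zV] .
      moreover have "z \<in> closure C" using \<open>z \<in> frontier C\<close> by (simp add: frontier_def)
      ultimately obtain y where y: "y \<in> comp z" "y \<in> C"
        by (meson closure_iff_nhds_not_empty subset_refl disjoint_iff)
      then have "comp z = C" using comp_eq[OF C] comp_eq[OF comp(1)[OF zV]] by metis
      then have "z \<in> C" using comp(2)[OF zV] by simp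
      then show False using \<open>z \<in> frontier C\<close> open_components[OF V C] by (simp add: frontier_def interior_open)
    qed
    then show "norm (g z) < norm (f z)" by (rule out)
  qed
  define I where "I = (\<lambda>C. {n. s n \<in> C})"
  \<comment> \<open>The second coordinate numbers the copies of a multiple zero, so that
    \<open>card\<close> counts with multiplicity.\<close>
  define J where "J = (\<lambda>C. SIGMA z:{z. z \<in> C \<and> h z = 0}. {..<nat (zorder h z)})"
  note snz = zero_sequence_zero[OF s]
  have bij: "\<exists>\<beta>. bij_betw \<beta> (I C) (J C)" if C: "C \<in> components V" for C
  proof (rule finite_same_card_bij)
    have fin: "finite {z. z \<in> C \<and> f z = 0}" "finite {z. z \<in> C \<and> h z = 0}"
      using finite_zeros_bounded[OF f fw bdd[OF C]] finite_zeros_bounded[OF hol hw bdd[OF C]] by auto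
    have Ieq: "I C = (\<Union>z\<in>{z. z \<in> C \<and> f z = 0}. {n. s n = z})" using snz by (auto simp: I_def)
    have fs: "finite {n. s n = z}" for z using s by (auto simp: zero_sequence_def)
    show "finite (I C)" unfolding Ieq using fin fs by auto
    show "finite (J C)" unfolding J_def using fin by auto
    have "card (I C) = (\<Sum>z | z \<in> C \<and> f z = 0. card {n. s n = z})"
      unfolding Ieq using fin fs by (intro card_UN_disjoint) auto
    also have "\<dots> = zero_count f C" using s unfolding zero_count_def zero_sequence_def
      by (intro sum.cong) auto
    also have "\<dots> = zero_count h C" using count[OF C] by simp
    also have "\<dots> = card (J C)" unfolding J_def zero_count_def using fin by simp
    finally show "card (I C) = card (J C)" .
  qed
  then obtain b where b: "\<And>C. C \<in> components V \<Longrightarrow> bij_betw (b C) (I C) (J C)" by metis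
  define \<beta> where "\<beta> = (\<lambda>n. b (comp (s n)) n)"
  have sV: "s n \<in> V" for n using zf snz by auto
  have \<beta>J: "\<beta> n \<in> J (comp (s n))" for n
  proof -
    have "n \<in> I (comp (s n))" using comp(2)[OF sV] by (simp add: I_def)
    then show ?thesis using b[OF comp(1)[OF sV]] bij_betwE unfolding \<beta>_def by blast
  qed
  have fst_comp: "fst (\<beta> n) \<in> comp (s n)" for n using \<beta>J[of n] by (auto simp: J_def)
  \<comment> \<open>The first coordinate of \<open>\<beta> n\<close> determines the component of
    \<open>s n\<close>, and within one component the chosen map is injective.\<close>
  have "inj \<beta>"
  proof (rule injI)
    fix m n assume eq: "\<beta> m = \<beta> n"
    have "comp (s m) = comp (s n)"
      using fst_comp[of m] fst_comp[of n] comp_eq[OF comp(1)[OF sV]] unfolding eq by metis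
    moreover have "m \<in> I (comp (s m))" "n \<in> I (comp (s n))" using comp(2)[OF sV] by (auto simp: I_def)
    ultimately show "m = n" using eq b[OF comp(1)[OF sV, of m]] 
      unfolding \<beta>_def bij_betw_def inj_on_def by metis
  qed
  have ran: "z \<in> V \<Longrightarrow> h z = 0 \<Longrightarrow> i < nat (zorder h z) \<Longrightarrow> \<exists>n. \<beta> n = (z, i)" for z i
  proof -
    assume z: "z \<in> V" "h z = 0" "i < nat (zorder h z)"
    then have "(z,i) \<in> J (comp z)" using comp(2) by (auto simp: J_def)
    then obtain n where n: "n \<in> I (comp z)" "b (comp z) n = (z,i)"
      using b[OF comp(1)[OF z(1)]] by (metis bij_betw_imp_surj_on imageE)
    then have "comp (s n) = comp z" using comp_eq[OF comp(1)[OF z(1)]] by (simp add: I_def)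
    then show ?thesis using n by (intro exI[of _ n]) (simp add: \<beta>_def)
  qed
  define t where "t = (\<lambda>n. fst (\<beta> n))"
  have "finite {n. t n = z} \<and> card {n. t n = z} = (if h z = 0 then nat (zorder h z) else 0)" for z
  proof (cases "h z = 0")
    case False
    have "t n \<noteq> z" for n using \<beta>J[of n] False by (auto simp: t_def J_def)
    then show ?thesis using False by simp
  next
    case True
    have "bij_betw \<beta> {n. t n = z} ({z} \<times> {..<nat (zorder h z)})"
      unfolding bij_betw_def
    proof
      show "inj_on \<beta> {n. t n = z}" using \<open>inj \<beta>\<close> by (rule inj_on_subset) simp
      show "\<beta> ` {n. t n = z} = {z} \<times> {..<nat (zorder h z)}"
      proof (intro equalityI subsetI)
        fix p assume "p \<in> \<beta> ` {n. t n = z}"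
        then obtain n where n: "p = \<beta> n" "fst p = z" by (auto simp: t_def)
        then have "p \<in> J (comp (s n))" using \<beta>J by simp
        then show "p \<in> {z} \<times> {..<nat (zorder h z)}" using n(2) by (auto simp: J_def)
      next
        fix p assume "p \<in> {z} \<times> {..<nat (zorder h z)}"
        then obtain i where p: "p = (z,i)" "i < nat (zorder h z)" by auto
        obtain n where "\<beta> n = (z,i)" using ran[OF _ True p(2)] zfg True by (auto simp: h_def)
        then show "p \<in> \<beta> ` {n. t n = z}" using p by (intro image_eqI[of _ _ n]) (auto simp: t_def)
      qed
    qed
    then show ?thesis using True bij_betw_finite bij_betw_same_card by fastforce
  qed
  then have "zero_sequence h t" by (simp add: zero_sequence_def)
  moreover have "\<exists>C\<in>components V. s n \<in> C \<and> t n \<in> C" for n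
    using comp[OF sV[of n]] fst_comp[of n] by (auto simp: t_def)
  ultimately show ?thesis unfolding h_def by blast
qed

lemma eventually_notin_finite_int:
  fixes F :: "int set"
  assumes "finite F"
  shows "eventually (\<lambda>n. n \<notin> F) at_top" "eventually (\<lambda>n. n \<notin> F) at_bot"
proof -
  have "n \<notin> F" if "Max (insert 0 F) < n" for n using Max_ge[of "insert 0 F" n] assms that by auto
  then show "eventually (\<lambda>n. n \<notin> F) at_top"
    by (rule eventually_mono[OF eventually_gt_at_top])
  have "n \<notin> F" if "n \<le> Min (insert 0 F) - 1" for n using Min_le[of "insert 0 F" n] assms that by auto
  then show "eventually (\<lambda>n. n \<notin> F) at_bot"
    by (rule eventually_mono[OF eventually_le_at_bot])
qed

text \<open>The set \<open>V\<close> in the proof shrinks towards the zeros of \<open>f\<close> far out, yet Rouche's theorem applies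
  to each of its components, so that no choice of contours is needed.\<close>

theorem zeros_asymptotic:
  fixes W :: "complex \<Rightarrow> real"
  assumes f: "f holomorphic_on UNIV" and g: "g holomorphic_on UNIV"
    and W: "continuous_on UNIV W" "\<And>z. W z > 0"
    and small: "\<And>\<epsilon>. \<epsilon> > 0 \<Longrightarrow> \<exists>R. \<forall>z. norm z \<ge> R \<longrightarrow> norm (g z) \<le> \<epsilon> * W z"
    and circ: "\<And>\<eta>. \<eta> > 0 \<Longrightarrow> \<exists>c>0. \<forall>x. norm (f x) < c * W x \<longrightarrow>
        (\<exists>r>0. r < \<eta> \<and> (\<forall>z. dist x z = r \<longrightarrow> c * W z \<le> norm (f z)))"
    and s: "zero_sequence f s"
  shows "\<exists>t. zero_sequence (\<lambda>z. f z + g z) t \<and>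
    ((\<lambda>n. t n - s n) \<longlongrightarrow> 0) at_top \<and> ((\<lambda>n. t n - s n) \<longlongrightarrow> 0) at_bot"
proof -
  define V where "V = {z. norm (f z) < norm (g z) + W z / (1 + norm z)}"
  have pos: "W z / (1 + norm z) > 0" for z using W(2)[of z] by (simp add: add_pos_nonneg)
  have cf: "continuous_on UNIV f" "continuous_on UNIV g"
    using f g by (auto intro: holomorphic_on_imp_continuous_on)
  have one: "1 + norm (z::complex) \<noteq> 0" for z using norm_ge_zero[of z] by linarith
  have V: "open V" unfolding V_def
    by (intro open_Collect_less continuous_intros cf W(1)) (use one in auto)
  have diam: "\<exists>R. \<forall>C\<in>components V. \<forall>x\<in>C. R \<le> norm x \<longrightarrow> C \<subseteq> ball x \<eta>" if eta: "\<eta> > 0" for \<eta>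
  proof -
    obtain c where c: "c > 0" "\<And>x. norm (f x) < c * W x \<Longrightarrow>
        \<exists>r>0. r < \<eta> \<and> (\<forall>z. dist x z = r \<longrightarrow> c * W z \<le> norm (f z))"
      using circ[OF eta] by blast
    obtain R where R: "\<And>z. norm z \<ge> R \<Longrightarrow> norm (g z) \<le> c/2 * W z"
      using small[of "c/2"] c(1) by auto
    \<comment> \<open>For |z| \<ge> 2/c the slack W / (1 + |z|) is at most half of c W, and for |z|
      \<ge> R so is |g|. Hence V lies far out in the region where \<open>circ\<close> supplies
      circles.\<close>
    have Vsmall: "norm (f z) < c * W z" if "z \<in> V" "norm z \<ge> R" "norm z \<ge> 2/c" for z
    proof -
      have "1 \<le> norm z * c / 2" using that c(1) by (simp add: field_simps)
      then have "1 \<le> (1 + norm z) * c / 2" using c(1) by (simp add: field_simps)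
      then have "W z * 1 \<le> W z * ((1 + norm z) * c / 2)" using W(2)[of z] by (intro mult_left_mono) auto
      then have "W z / (1 + norm z) \<le> c / 2 * W z"
        by (simp add: divide_le_eq add_pos_nonneg mult_ac)
      moreover have "norm (f z) < norm (g z) + W z / (1 + norm z)" using that(1) by (simp add: V_def)
      ultimately show ?thesis using R[OF that(2)] by linarith
    qed
    show ?thesis
    \<comment> \<open>The added \<eta> keeps the whole circle around x, whose radius is below
      \<eta>, beyond both thresholds.\<close>
    proof (intro exI[of _ "max R (2/c) + \<eta>"] ballI impI)
      fix C x assume C: "C \<in> components V" "x \<in> C" "max R (2/c) + \<eta> \<le> norm x"
      have CV: "C \<subseteq> V" using C(1) by (rule in_components_subset)
      have "norm (f x) < c * W x" using C CV eta by (intro Vsmall) auto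
      then obtain r where r: "r > 0" "r < \<eta>" "\<And>z. dist x z = r \<Longrightarrow> c * W z \<le> norm (f z)"
        using c(2) by blast
      \<comment> \<open>On the circle |f| \<ge> c W, while on this part of V |f| < c W. The
        connected set C thus misses the circle around its point x and stays inside.\<close>
      have "C \<inter> frontier (ball x r) = {}"
      proof (rule ccontr)
        assume "C \<inter> frontier (ball x r) \<noteq> {}"
        then obtain z where "z \<in> C" "z \<in> sphere x r" using r(1) by (auto simp: frontier_ball simp del: mem_sphere)
        then have z: "z \<in> C" "dist x z = r" by auto
        have "norm x \<le> norm z + dist x z"
          by (metis dist_norm norm_triangle_sub)
        then have "norm z \<ge> max R (2/c)" using z C r by linarith
        then have "norm (f z) < c * W z" using z CV by (intro Vsmall) auto
        then show False using r(3)[OF z(2)] by simp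
      qed
      then have "C \<subseteq> ball x r"
        using connected_Int_frontier[of C "ball x r"] in_components_connected[OF C(1)] C(2) r(1)
        by (metis Diff_eq_empty_iff centre_in_ball disjoint_iff)
      then show "C \<subseteq> ball x \<eta>" using r(2) by auto
    qed
  qed
  have "\<exists>t. zero_sequence (\<lambda>z. f z + g z) t \<and> (\<forall>n. \<exists>C\<in>components V. s n \<in> C \<and> t n \<in> C)"
  proof (rule zeros_matching[OF f g V _ _ _ _ s])
    show "z \<in> V" if "f z = 0" for z using that pos[of z] by (auto simp: V_def add_nonneg_pos)
    show "z \<in> V" if "f z + g z = 0" for z
    proof -
      have "norm (f z) = norm (g z)" using that by (metis add_eq_0_iff norm_minus_cancel)
      then show ?thesis using pos[of z] by (simp add: V_def)
    qed
    show "norm (g z) < norm (f z)" if "z \<notin> V" for z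
      using that pos[of z] by (simp add: V_def)
    fix C assume C: "C \<in> components V"
    obtain R where R: "\<forall>C\<in>components V. \<forall>x\<in>C. R \<le> norm x \<longrightarrow> C \<subseteq> ball x 1" using diam[of 1] by auto
    show "bounded C"
    proof (cases "C \<subseteq> cball 0 R")
      case False
      then obtain x where "x \<in> C" "R \<le> norm x" by (auto simp: subset_iff)
      then show ?thesis using R C bounded_ball bounded_subset by metis
    qed (auto intro: bounded_subset)
  qed
  then obtain t where t: "zero_sequence (\<lambda>z. f z + g z) t"
    "\<And>n. \<exists>C\<in>components V. s n \<in> C \<and> t n \<in> C" by auto
  have "V \<noteq> UNIV"
  proof
    assume "V = UNIV"
    then have C: "UNIV \<in> components V" by (simp add: components_eq_sing_iff)
    obtain R where R: "\<forall>C\<in>components V. \<forall>x\<in>C. R \<le> norm x \<longrightarrow> C \<subseteq> ball x 1" using diam[of 1] by auto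
    have "(UNIV :: complex set) \<subseteq> ball (of_real R) 1" using R C by auto
    then show False using not_bounded_UNIV bounded_ball bounded_subset by blast
  qed
  then obtain w where "w \<notin> V" by blast
  then have "norm (g w) + W w / (1 + norm w) \<le> norm (f w)" by (simp add: V_def)
  then have "norm (f w) > 0" using pos[of w] norm_ge_zero[of "g w"] by linarith
  then have fw: "f w \<noteq> 0" by simp
  \<comment> \<open>Only finitely many indices have \<open>s n\<close> in a given disc, so an
    estimate off a finite set of integers yields the limits at both ends.\<close>
  have ev: "\<exists>F. finite F \<and> (\<forall>n. n \<notin> F \<longrightarrow> dist (t n - s n) 0 < \<eta>)" if eta: "\<eta> > 0" for \<eta>
  proof -
    obtain R where R: "\<forall>C\<in>components V. \<forall>x\<in>C. R \<le> norm x \<longrightarrow> C \<subseteq> ball x \<eta>" using diam[OF eta] by auto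
    have "{n. s n \<in> ball 0 R} \<subseteq> (\<Union>z\<in>{z. z \<in> ball 0 R \<and> f z = 0}. {n. s n = z})"
    proof
      fix n assume n: "n \<in> {n. s n \<in> ball 0 R}"
      show "n \<in> (\<Union>z\<in>{z. z \<in> ball 0 R \<and> f z = 0}. {n. s n = z})"
        using n zero_sequence_zero[OF s] by auto
    qed
    moreover have "finite (\<Union>z\<in>{z. z \<in> ball 0 R \<and> f z = 0}. {n. s n = z})"
      using finite_zeros_bounded[OF f fw bounded_ball[of 0 R]] s
      by (intro finite_UN_I) (auto simp: zero_sequence_def)
    ultimately have "finite {n. s n \<in> ball 0 R}" by (rule finite_subset)
    moreover have "dist (t n - s n) 0 < \<eta>" if n: "n \<notin> {n. s n \<in> ball 0 R}" for n
    proof -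
      obtain C where C: "C \<in> components V" "s n \<in> C" "t n \<in> C" using t(2) by blast
      then have "t n \<in> ball (s n) \<eta>" using R[rule_format, OF C(1,2)] n by auto
      then show ?thesis by (simp add: dist_norm norm_minus_commute)
    qed
    ultimately show ?thesis by blast
  qed
  have "((\<lambda>n. t n - s n) \<longlongrightarrow> 0) at_top" "((\<lambda>n. t n - s n) \<longlongrightarrow> 0) at_bot"
    using ev eventually_notin_finite_int unfolding tendsto_iff by (metis (mono_tags, lifting) eventually_mono)+
  then show ?thesis using t(1) by blast
qed

subsection \<open>Lower bounds for the unperturbed determinant\<close>

text \<open>For \<open>u = v = 1\<close> this is the determinant for \<open>Q = 0\<close>; the unimodular factors \<open>u\<close> and \<open>v\<close> describe its
  horizontal translates.\<close>

definition quad_exp :: "complex \<Rightarrow> complex \<Rightarrow> complex \<Rightarrow> complex \<Rightarrow> real \<Rightarrow> real \<Rightarrow>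
    complex \<Rightarrow> complex \<Rightarrow> complex \<Rightarrow> complex" where
  "quad_exp p q r s b1 b2 u v z = p + q * u * v * exp (\<i> * of_real (b1 + b2) * z)
     + r * u * exp (\<i> * of_real b1 * z) + s * v * exp (\<i> * of_real b2 * z)"

text \<open>The summands are the moduli of exp(i b1 z) and exp(i b2 z), each dominant in one
  half-plane; adding them gives a single weight for the whole plane.\<close>

definition exp_weight :: "real \<Rightarrow> real \<Rightarrow> complex \<Rightarrow> real" where
  "exp_weight b1 b2 z = exp (- b1 * Im z) + exp (- b2 * Im z)"

lemma norm_exp_ib: "norm (exp (\<i> * of_real b * z)) = exp (- b * Im z)"
  by (simp add: norm_exp_eq_Re)

text \<open>The exponent \<open>- a * y\<close> exceeds 0, \<open>- (a + b) * y\<close> and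
  \<open>- b * y\<close> by at least d y with d = min (-a) b, and exp (d y) outgrows every
  constant.\<close>

lemma exp_dominates:
  fixes a b K R :: real
  assumes "a < 0" "0 < b" "K \<ge> 0" "R > 0"
  shows "\<exists>h>0. \<forall>y\<ge>h. K * (1 + exp (- (a + b) * y) + exp (- b * y)) \<le> R * exp (- a * y)"
proof -
  define d where "d = min (-a) b"
  have d: "d > 0" "d \<le> -a" "d \<le> b" using assms by (auto simp: d_def)
  show ?thesis
  \<comment> \<open>Beyond this point 3 K \<le> R d y \<le> R exp (d y), the 3 counting the
    dominated terms; the 1 keeps the threshold positive when K = 0.\<close>
  proof (intro exI[of _ "3 * K / (R * d) + 1"] conjI allI impI)
    show "3 * K / (R * d) + 1 > 0" using assms d by (simp add: add_nonneg_pos)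
    fix y assume y: "3 * K / (R * d) + 1 \<le> y"
    have y0: "y \<ge> 0" using y assms d by (smt (verit) divide_nonneg_pos mult_pos_pos)
    have "3 * K / (R * d) \<le> y" using y by simp
    then have "3 * K \<le> R * (d * y)" using assms d by (simp add: field_simps)
    also have "d * y \<le> exp (d * y)" using exp_ge_add_one_self[of "d*y"] by linarith
    then have "R * (d * y) \<le> R * exp (d * y)" using assms by (intro mult_left_mono) auto
    finally have 3: "3 * K \<le> R * exp (d * y)" .
    have e: "exp x \<le> exp (- d * y + - a * y)" if "x \<le> (- a - d) * y" for x
      using that by (simp add: algebra_simps)
    have "(0::real) \<le> (- a - d) * y" using d y0 by (intro mult_nonneg_nonneg) auto
    then have e1: "exp 0 \<le> exp (- d * y + - a * y)" by (rule e)
    have "- (a + b) * y \<le> (- a - d) * y" using d y0 by (intro mult_right_mono) auto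
    then have e2: "exp (- (a + b) * y) \<le> exp (- d * y + - a * y)" by (rule e)
    have "- b * y \<le> (- a - d) * y" using d y0 assms by (intro mult_right_mono) auto
    then have e3: "exp (- b * y) \<le> exp (- d * y + - a * y)" by (rule e)
    have "K * (1 + exp (- (a + b) * y) + exp (- b * y)) \<le> K * (3 * exp (- d * y + - a * y))"
      using add_mono[OF add_mono[OF e1 e2] e3] assms(3) by (intro mult_left_mono) simp_all
    also have "\<dots> = 3 * K * (exp (- d * y) * exp (- a * y))" by (simp add: exp_add[symmetric])
    also have "\<dots> \<le> R * exp (d * y) * (exp (- d * y) * exp (- a * y))"
      using 3 by (intro mult_right_mono) auto
    also have "\<dots> = R * exp (- a * y)" by (simp add: exp_add[symmetric] exp_minus)
    finally show "K * (1 + exp (- (a + b) * y) + exp (- b * y)) \<le> R * exp (- a * y)" .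
  qed
qed

lemma norm_dominant_term:
  fixes x1 x2 x3 x4 :: complex
  shows "norm x1 - norm x2 - norm x3 - norm x4 \<le> norm (x2 + x3 + x1 + x4)"
proof -
  have "norm x1 = norm ((x2 + x3 + x1 + x4) - x2 - x3 - x4)" by (simp add: algebra_simps)
  also have "\<dots> \<le> norm (x2 + x3 + x1 + x4) + norm x2 + norm x3 + norm x4"
    by (smt (verit) norm_triangle_ineq4)
  finally show ?thesis by simp
qed

text \<open>High up the r term outweighs the other three, far down the s term does. All unimodular u
  and v are covered, since limits of horizontal translates have this form, and such factors change
  no modulus.\<close>

lemma quad_exp_lower_off_strip:
  assumes b: "b1 < 0" "0 < b2" and rs: "r \<noteq> 0" "s \<noteq> 0"
  shows "\<exists>h>0. \<exists>c>0. \<forall>u v z. norm u = 1 \<longrightarrow> norm v = 1 \<longrightarrow> h \<le> \<bar>Im z\<bar> \<longrightarrow>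
    c * exp_weight b1 b2 z \<le> norm (quad_exp p q r s b1 b2 u v z)"
proof -
  define K where "K = norm p + norm q + norm r + norm s"
  have K: "K \<ge> 0" "norm p \<le> K" "norm q \<le> K" "norm r \<le> K" "norm s \<le> K" by (auto simp: K_def)
  obtain h1 where h1: "h1 > 0" "\<And>y. y \<ge> h1 \<Longrightarrow>
      K * (1 + exp (- (b1 + b2) * y) + exp (- b2 * y)) \<le> norm r / 2 * exp (- b1 * y)"
    using exp_dominates[OF b K(1), of "norm r / 2"] rs by auto
  \<comment> \<open>Reflection: the pair -b2, -b1 together with -Im z carries the estimate over to
    the lower half-plane.\<close>
  obtain h2 where h2: "h2 > 0" "\<And>y. y \<ge> h2 \<Longrightarrow>
      K * (1 + exp (- (- b2 + - b1) * y) + exp (- (- b1) * y)) \<le> norm s / 2 * exp (- (- b2) * y)"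
    using exp_dominates[of "- b2" "- b1" K "norm s / 2"] b K(1) rs by auto
  \<comment> \<open>One half of the dominant coefficient is lost to the other three terms, and
    another factor 2 because the weight is at most twice the dominant exponential.\<close>
  define c where "c = min (norm r) (norm s) / 4"
  have c: "c > 0" "4 * c \<le> norm r" "4 * c \<le> norm s" using rs by (auto simp: c_def)
  have "c * exp_weight b1 b2 z \<le> norm (quad_exp p q r s b1 b2 u v z)"
    if uv: "norm u = 1" "norm v = 1" and z: "max h1 h2 \<le> \<bar>Im z\<bar>" for u v z
  proof -
    define E0 E1 E2 where "E0 = exp (- (b1 + b2) * Im z)" and "E1 = exp (- b1 * Im z)" and "E2 = exp (- b2 * Im z)"
    have pos: "E0 > 0" "E1 > 0" "E2 > 0" by (auto simp: E0_def E1_def E2_def)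
    have n: "norm (q * u * v * exp (\<i> * of_real (b1 + b2) * z)) = norm q * E0"
      "norm (r * u * exp (\<i> * of_real b1 * z)) = norm r * E1"
      "norm (s * v * exp (\<i> * of_real b2 * z)) = norm s * E2"
      unfolding norm_mult norm_exp_ib E0_def E1_def E2_def using uv by simp_all
    have p: "norm p \<le> K * 1" "norm q * E0 \<le> K * E0" "norm r * E1 \<le> K * E1" "norm s * E2 \<le> K * E2"
      using K pos by (auto intro: mult_right_mono)
    have W: "exp_weight b1 b2 z = E1 + E2" by (simp add: exp_weight_def E1_def E2_def)
    show ?thesis
    proof (cases "Im z \<ge> 0")
      case True
      then have "K * (1 + E0 + E2) \<le> norm r / 2 * E1"
        using h1(2)[of "Im z"] z by (simp add: E0_def E1_def E2_def)
      then have "norm r / 2 * E1 \<le> norm r * E1 - norm p - norm q * E0 - norm s * E2"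
        using p by (simp add: algebra_simps)
      also have "\<dots> \<le> norm (quad_exp p q r s b1 b2 u v z)"
        using norm_dominant_term[of "r * u * exp (\<i> * of_real b1 * z)" p
          "q * u * v * exp (\<i> * of_real (b1 + b2) * z)" "s * v * exp (\<i> * of_real b2 * z)"]
        unfolding quad_exp_def n by simp
      finally have 1: "norm r / 2 * E1 \<le> norm (quad_exp p q r s b1 b2 u v z)" .
      have "b1 * Im z \<le> b2 * Im z" using True b by (intro mult_right_mono) auto
      then have "E2 \<le> E1" by (simp add: E1_def E2_def)
      then have "c * (E1 + E2) \<le> c * (2 * E1)" using c by (intro mult_left_mono) auto
      also have "\<dots> = 4 * c * (E1 / 2)" by simp
      also have "\<dots> \<le> norm r * (E1 / 2)" using c pos by (intro mult_right_mono) auto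
      finally show ?thesis using 1 unfolding W by simp
    next
      case False
      then have "K * (1 + E0 + E1) \<le> norm s / 2 * E2"
        using h2(2)[of "- Im z"] z by (simp add: E0_def E1_def E2_def algebra_simps)
      then have "norm s / 2 * E2 \<le> norm s * E2 - norm p - norm q * E0 - norm r * E1"
        using p by (simp add: algebra_simps)
      also have "\<dots> \<le> norm (quad_exp p q r s b1 b2 u v z)"
        using norm_dominant_term[of "s * v * exp (\<i> * of_real b2 * z)" p
          "q * u * v * exp (\<i> * of_real (b1 + b2) * z)" "r * u * exp (\<i> * of_real b1 * z)"]
        unfolding quad_exp_def n by (simp add: add_ac)
      finally have 1: "norm s / 2 * E2 \<le> norm (quad_exp p q r s b1 b2 u v z)" .
      have "b2 * Im z \<le> b1 * Im z" using False b by (intro mult_right_mono_neg) auto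
      then have "E1 \<le> E2" by (simp add: E1_def E2_def)
      then have "c * (E1 + E2) \<le> c * (2 * E2)" using c by (intro mult_left_mono) auto
      also have "\<dots> = 4 * c * (E2 / 2)" by simp
      also have "\<dots> \<le> norm s * (E2 / 2)" using c pos by (intro mult_right_mono) auto
      finally show ?thesis using 1 unfolding W by simp
    qed
  qed
  then show ?thesis using h1(1) c(1) by (intro exI[of _ "max h1 h2"] conjI exI[of _ c]) auto
qed

lemma quad_exp_shift:
  "quad_exp p q r s b1 b2 u v (z + of_real t)
    = quad_exp p q r s b1 b2 (u * exp (\<i> * of_real (b1 * t))) (v * exp (\<i> * of_real (b2 * t))) z"
  by (simp add: quad_exp_def algebra_simps exp_add)

lemma quad_exp_holomorphic: "quad_exp p q r s b1 b2 u v holomorphic_on UNIV"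
  unfolding quad_exp_def[abs_def] by (intro holomorphic_intros)

text \<open>An entire function that is not identically zero has finitely many zeros in the closed
  disc of radius \<eta>, and these exclude only finitely many radii.\<close>

lemma holomorphic_nonzero_on_circle:
  assumes f: "f holomorphic_on UNIV" and "f w \<noteq> 0" "\<eta> > 0"
  shows "\<exists>r>0. r < \<eta> \<and> (\<forall>z. dist x z = r \<longrightarrow> f z \<noteq> 0)"
proof -
  have "finite {z \<in> cball x \<eta>. f z = 0}"
    by (rule finite_zeros_bounded[OF assms(1,2) bounded_cball])
  then have "finite (dist x ` {z \<in> cball x \<eta>. f z = 0})" by (rule finite_imageI)
  moreover have "infinite {0<..<\<eta>}" using \<open>\<eta> > 0\<close> by (simp add: infinite_Ioo)
  ultimately have "infinite ({0<..<\<eta>} - dist x ` {z \<in> cball x \<eta>. f z = 0})" by (rule Diff_infinite_finite)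
  then obtain r where "r \<in> {0<..<\<eta>} - dist x ` {z \<in> cball x \<eta>. f z = 0}" 
    using infinite_imp_nonempty by blast
  then show ?thesis by (intro exI[of _ r]) auto
qed

text \<open>Horizontal translates of the exponential sum stay in a compact family, none of whose members
  vanishes identically; hence the bound is uniform in the centre of the circle.\<close>

lemma quad_exp_lower_on_circles:
  assumes b: "b1 < 0" "0 < b2" and rs: "r \<noteq> 0" "s \<noteq> 0" and \<eta>: "\<eta> > 0"
  shows "\<exists>c>0. \<forall>x. \<bar>Im x\<bar> \<le> H \<longrightarrow>
    (\<exists>\<rho>>0. \<rho> < \<eta> \<and> (\<forall>z. dist x z = \<rho> \<longrightarrow> c \<le> norm (quad_exp p q r s b1 b2 1 1 z)))"
proof (rule ccontr)
  let ?F = "quad_exp p q r s b1 b2"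
  assume neg: "\<not> ?thesis"
  \<comment> \<open>The negated claim, with the constants 1 / (n + 1), gives bad centres: every
    admissible circle around them carries a point where the sum is small.\<close>
  have "\<exists>x. \<bar>Im x\<bar> \<le> H \<and> (\<forall>\<rho>>0. \<rho> < \<eta> \<longrightarrow> (\<exists>z. dist x z = \<rho> \<and> norm (?F 1 1 z) < inverse (real (Suc n))))" for n
  proof (rule ccontr)
    assume n: "\<not> ?thesis"
    have "\<exists>c>0. \<forall>x. \<bar>Im x\<bar> \<le> H \<longrightarrow>
      (\<exists>\<rho>>0. \<rho> < \<eta> \<and> (\<forall>z. dist x z = \<rho> \<longrightarrow> c \<le> norm (?F 1 1 z)))"
      by (rule exI[of _ "inverse (real (Suc n))"]) (use n in \<open>auto simp: not_less simp del: of_nat_Suc\<close>)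
    then show False using neg by blast
  qed
  then obtain x where x: "\<And>n. \<bar>Im (x n)\<bar> \<le> H"
    "\<And>n \<rho>. 0 < \<rho> \<Longrightarrow> \<rho> < \<eta> \<Longrightarrow> \<exists>z. dist (x n) z = \<rho> \<and> norm (?F 1 1 z) < inverse (real (Suc n))" by metis
  \<comment> \<open>The two phases produced by the translation by Re (x n), together with the height
    Im (x n), determine the translated function and centre.\<close>
  define T where "T = (\<lambda>n. (exp (\<i> * of_real (b1 * Re (x n))), exp (\<i> * of_real (b2 * Re (x n))), Im (x n)))"
  have "compact (sphere (0::complex) 1 \<times> sphere (0::complex) 1 \<times> {-H..H})"
    by (intro compact_Times) auto
  moreover have "T n \<in> sphere (0::complex) 1 \<times> sphere (0::complex) 1 \<times> {-H..H}" for n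
    using x(1)[of n] by (auto simp: T_def abs_le_iff norm_exp_eq_Re)
  ultimately obtain l \<phi> where l: "l \<in> sphere (0::complex) 1 \<times> sphere (0::complex) 1 \<times> {-H..H}"
    "strict_mono \<phi>" "(T \<circ> \<phi>) \<longlonglongrightarrow> l" unfolding compact_def by meson
  obtain u v \<sigma> where uv: "l = (u, v, \<sigma>)" by (cases l)
  have un: "norm u = 1" "norm v = 1" using l uv by auto
  have lim: "(\<lambda>n. exp (\<i> * of_real (b1 * Re (x (\<phi> n))))) \<longlonglongrightarrow> u"
    "(\<lambda>n. exp (\<i> * of_real (b2 * Re (x (\<phi> n))))) \<longlonglongrightarrow> v" "(\<lambda>n. Im (x (\<phi> n))) \<longlonglongrightarrow> \<sigma>"
    using l(3) tendsto_fst[OF l(3)] tendsto_fst[OF tendsto_snd[OF l(3)]] tendsto_snd[OF tendsto_snd[OF l(3)]]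
    by (auto simp: uv T_def o_def)
  obtain h c where hc: "h > 0" "c > 0" "\<And>z. h \<le> \<bar>Im z\<bar> \<Longrightarrow> c * exp_weight b1 b2 z \<le> norm (?F u v z)"
    using quad_exp_lower_off_strip[OF b rs] un by metis
  \<comment> \<open>A value at height h shows that the limit function does not vanish
    identically.\<close>
  have "c * exp_weight b1 b2 (\<i> * of_real h) > 0" using hc by (simp add: exp_weight_def add_pos_pos)
  also have "\<dots> \<le> norm (?F u v (\<i> * of_real h))" using hc by (intro hc) auto
  finally have "?F u v (\<i> * of_real h) \<noteq> 0" by auto
  \<comment> \<open>The radius is chosen for the limit function and then used for all the bad
    centres.\<close>
  then obtain \<rho> where \<rho>: "\<rho> > 0" "\<rho> < \<eta>" "\<And>z. dist (\<i> * of_real \<sigma>) z = \<rho> \<Longrightarrow> ?F u v z \<noteq> 0"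
    using holomorphic_nonzero_on_circle[OF quad_exp_holomorphic _ \<eta>] by meson
  obtain z where z: "\<And>n. dist (x n) (z n) = \<rho>" "\<And>n. norm (?F 1 1 (z n)) < inverse (real (Suc n))"
    using x(2)[OF \<rho>(1,2)] by metis
  \<comment> \<open>The bad points, moved by -Re (x n), lie on circles of radius \<rho> around
    points of the imaginary axis in the strip, so they stay bounded and have a limit point.\<close>
  define w where "w = (\<lambda>n. z n - of_real (Re (x n)))"
  have wd: "dist (\<i> * of_real (Im (x n))) (w n) = \<rho>" for n
  proof -
    have "\<i> * of_real (Im (x n)) - w n = x n - z n" by (simp add: w_def complex_eq_iff)
    then show ?thesis using z(1)[of n] by (simp add: dist_norm)
  qed
  have "norm (w n) \<le> \<bar>H\<bar> + \<rho>" for n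
  proof -
    have "norm (w n) \<le> norm (\<i> * of_real (Im (x n))) + dist (\<i> * of_real (Im (x n))) (w n)"
      by (metis dist_norm norm_triangle_sub dist_commute)
    also have "norm (\<i> * of_real (Im (x n)) :: complex) = \<bar>Im (x n)\<bar>" by (simp add: norm_mult)
    finally show ?thesis using x(1)[of n] wd[of n] by linarith
  qed
  then have "bounded (range (w \<circ> \<phi>))" by (intro boundedI[where B = "\<bar>H\<bar> + \<rho>"]) auto
  then obtain m \<psi> where m: "strict_mono \<psi>" "((w \<circ> \<phi>) \<circ> \<psi>) \<longlonglongrightarrow> m"
    using bounded_imp_convergent_subsequence by blast
  have lim': "(\<lambda>n. exp (\<i> * of_real (b1 * Re (x (\<phi> (\<psi> n)))))) \<longlonglongrightarrow> u"
    "(\<lambda>n. exp (\<i> * of_real (b2 * Re (x (\<phi> (\<psi> n)))))) \<longlonglongrightarrow> v" "(\<lambda>n. Im (x (\<phi> (\<psi> n)))) \<longlonglongrightarrow> \<sigma>"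
    "(\<lambda>n. w (\<phi> (\<psi> n))) \<longlonglongrightarrow> m"
    using lim[THEN LIMSEQ_subseq_LIMSEQ, OF m(1)] m(2) by (auto simp: o_def)
  have "(\<lambda>n. dist (\<i> * of_real (Im (x (\<phi> (\<psi> n))))) (w (\<phi> (\<psi> n)))) \<longlonglongrightarrow> dist (\<i> * of_real \<sigma>) m"
    by (intro tendsto_intros lim')
  then have "dist (\<i> * of_real \<sigma>) m = \<rho>" unfolding wd by (simp add: LIMSEQ_const_iff)
  then have nz: "?F u v m \<noteq> 0" by (rule \<rho>(3))
  have "(\<lambda>n. ?F (exp (\<i> * of_real (b1 * Re (x (\<phi> (\<psi> n)))))) (exp (\<i> * of_real (b2 * Re (x (\<phi> (\<psi> n)))))) (w (\<phi> (\<psi> n))))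
      \<longlonglongrightarrow> ?F u v m"
    unfolding quad_exp_def by (intro tendsto_intros lim')
  moreover have "?F (exp (\<i> * of_real (b1 * Re (x n)))) (exp (\<i> * of_real (b2 * Re (x n)))) (w n) = ?F 1 1 (z n)" for n
    using quad_exp_shift[of p q r s b1 b2 1 1 "w n" "Re (x n)"] by (simp add: w_def)
  ultimately have "(\<lambda>n. ?F 1 1 (z (\<phi> (\<psi> n)))) \<longlonglongrightarrow> ?F u v m" by simp
  moreover have "(\<lambda>n. ?F 1 1 (z (\<phi> (\<psi> n)))) \<longlonglongrightarrow> 0"
  proof -
    have "(\<lambda>n. ?F 1 1 (z n)) \<longlonglongrightarrow> 0"
      by (rule Lim_null_comparison[OF _ LIMSEQ_inverse_real_of_nat]) (intro always_eventually allI less_imp_le z(2))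
    then show ?thesis
      using LIMSEQ_subseq_LIMSEQ[OF LIMSEQ_subseq_LIMSEQ[OF _ l(2)] m(1)] by (auto simp: o_def)
  qed
  ultimately show False using nz LIMSEQ_unique by blast
qed

text \<open>Where the sum is small relative to the weight, the bound off the strip fails, so |Im x|
  \<le> h. Circles of radius below \<eta> around x stay in |Im z| \<le> h + \<eta>, where the weight
  is at most M, and the lower bound c1 becomes c1 / M times the weight.\<close>

lemma quad_exp_lower:
  assumes b: "b1 < 0" "0 < b2" and rs: "r \<noteq> 0" "s \<noteq> 0" and \<eta>: "\<eta> > 0"
  shows "\<exists>c>0. \<forall>x. norm (quad_exp p q r s b1 b2 1 1 x) < c * exp_weight b1 b2 x \<longrightarrow>
    (\<exists>\<rho>>0. \<rho> < \<eta> \<and> (\<forall>z. dist x z = \<rho> \<longrightarrow> c * exp_weight b1 b2 z \<le> norm (quad_exp p q r s b1 b2 1 1 z)))"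
proof -
  let ?F = "quad_exp p q r s b1 b2 1 1"
  obtain h c0 where h: "h > 0" "c0 > 0" "\<And>z. h \<le> \<bar>Im z\<bar> \<Longrightarrow> c0 * exp_weight b1 b2 z \<le> norm (?F z)"
    using quad_exp_lower_off_strip[OF b rs] by (metis norm_one)
  obtain c1 where c1: "c1 > 0" "\<And>x. \<bar>Im x\<bar> \<le> h \<Longrightarrow>
      \<exists>\<rho>>0. \<rho> < \<eta> \<and> (\<forall>z. dist x z = \<rho> \<longrightarrow> c1 \<le> norm (?F z))"
    using quad_exp_lower_on_circles[OF b rs \<eta>] by metis
  define M where "M = exp (\<bar>b1\<bar> * (h + \<eta>)) + exp (\<bar>b2\<bar> * (h + \<eta>))"
  have M: "M > 0" by (simp add: M_def add_pos_pos)
  have WM: "exp_weight b1 b2 z \<le> M" if "\<bar>Im z\<bar> \<le> h + \<eta>" for z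
  proof -
    have "- b * Im z \<le> \<bar>b\<bar> * (h + \<eta>)" for b
    proof -
      have "- b * Im z \<le> \<bar>b * Im z\<bar>" by simp
      also have "\<dots> \<le> \<bar>b\<bar> * (h + \<eta>)" unfolding abs_mult using that by (intro mult_left_mono) auto
      finally show ?thesis .
    qed
    then show ?thesis unfolding exp_weight_def M_def by (intro add_mono) (simp_all only: exp_le_cancel_iff)
  qed
  have Wpos: "exp_weight b1 b2 z > 0" for z by (simp add: exp_weight_def add_pos_pos)
  show ?thesis
  proof (rule exI[of _ "min c0 (c1 / M)"], intro conjI allI impI)
    show "0 < min c0 (c1 / M)" using h c1 M by simp
    fix x assume x: "norm (?F x) < min c0 (c1 / M) * exp_weight b1 b2 x"
    have "\<bar>Im x\<bar> \<le> h"
    proof (rule ccontr)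
      assume "\<not> \<bar>Im x\<bar> \<le> h"
      then have "c0 * exp_weight b1 b2 x \<le> norm (?F x)" by (intro h) auto
      moreover have "min c0 (c1 / M) * exp_weight b1 b2 x \<le> c0 * exp_weight b1 b2 x"
        using Wpos[of x] by (intro mult_right_mono) auto
      ultimately show False using x by linarith
    qed
    then obtain \<rho> where \<rho>: "\<rho> > 0" "\<rho> < \<eta>" "\<And>z. dist x z = \<rho> \<Longrightarrow> c1 \<le> norm (?F z)" using c1(2) by metis
    have "min c0 (c1 / M) * exp_weight b1 b2 z \<le> norm (?F z)" if z: "dist x z = \<rho>" for z
    proof -
      have "\<bar>Im x - Im z\<bar> \<le> \<rho>" using abs_Im_le_cmod[of "x - z"] z by (simp add: dist_norm)
      then have "exp_weight b1 b2 z \<le> M" using \<open>\<bar>Im x\<bar> \<le> h\<close> \<rho> by (intro WM) linarith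
      then have "min c0 (c1 / M) * exp_weight b1 b2 z \<le> (c1 / M) * M"
        using Wpos[of z] c1 M by (intro mult_mono) auto
      also have "\<dots> = c1" using M by simp
      finally show ?thesis using \<rho>(3)[OF z] by simp
    qed
    then show "\<exists>\<rho>>0. \<rho> < \<eta> \<and> (\<forall>z. dist x z = \<rho> \<longrightarrow> min c0 (c1 / M) * exp_weight b1 b2 z \<le> norm (?F z))"
      using \<rho> by blast
  qed
qed

subsection \<open>Absolutely continuous functions\<close>

text \<open>The derivative is a prescribed function, typically the right-hand side of a differential
  equation. It is the true derivative only almost everywhere, which is enough for
  integration.\<close>

definition ac_deriv :: "(real \<Rightarrow> complex) \<Rightarrow> (real \<Rightarrow> complex) \<Rightarrow> bool" where
  "ac_deriv f f' \<longleftrightarrow> abs_continuous_on {0..1} f \<and>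
    (AE x in lebesgue. x \<in> {0..1} \<longrightarrow> (f has_vector_derivative f' x) (at x within {0..1}))"

lemma abs_continuous_onE:
  assumes "abs_continuous_on S f" "\<epsilon> > 0"
  obtains \<delta> where "\<delta> > 0" "\<And>D. D division_of \<Union>D \<Longrightarrow> \<Union>D \<subseteq> S \<Longrightarrow> (\<Sum>K\<in>D. Sup K - Inf K) < \<delta>
      \<Longrightarrow> (\<Sum>K\<in>D. norm (f (Sup K) - f (Inf K))) < \<epsilon>"
proof -
  from assms(1)[unfolded abs_continuous_on_def, rule_format, OF assms(2)]
  obtain \<delta> where "\<delta> > 0" and \<delta>: "\<forall>D. D division_of \<Union>D \<and> \<Union>D \<subseteq> S \<and> (\<Sum>K\<in>D. Sup K - Inf K) < \<delta>
      \<longrightarrow> (\<Sum>K\<in>D. norm (f (Sup K) - f (Inf K))) < \<epsilon>" by (elim exE conjE)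
  show thesis
  proof (rule that[OF \<open>\<delta> > 0\<close>])
    fix D assume "D division_of \<Union>D" "\<Union>D \<subseteq> S" "(\<Sum>K\<in>D. Sup K - Inf K) < \<delta>"
    then show "(\<Sum>K\<in>D. norm (f (Sup K) - f (Inf K))) < \<epsilon>" by (intro \<delta>[rule_format] conjI)
  qed
qed

text \<open>A single interval is already an admissible division.\<close>

lemma abs_continuous_on_imp_continuous_on:
  fixes f :: "real \<Rightarrow> 'a::real_normed_vector"
  assumes f: "abs_continuous_on {a..b} f"
  shows "continuous_on {a..b} f"
  unfolding continuous_on_iff
proof (intro ballI allI impI)
  fix x e :: real assume x: "x \<in> {a..b}" and e: "e > 0"
  obtain \<delta> where \<delta>: "\<delta> > 0" "\<And>D. D division_of \<Union>D \<Longrightarrow> \<Union>D \<subseteq> {a..b} \<Longrightarrow> (\<Sum>K\<in>D. Sup K - Inf K) < \<delta>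
      \<Longrightarrow> (\<Sum>K\<in>D. norm (f (Sup K) - f (Inf K))) < e"
    by (rule abs_continuous_onE[OF f e]) blast
  have *: "norm (f v - f u) < e" if "u \<le> v" "u \<in> {a..b}" "v \<in> {a..b}" "v - u < \<delta>" for u v
  proof -
    have "{{u..v}} division_of \<Union>{{u..v}}" using division_of_self[of u v] that by simp
    from \<delta>(2)[OF this] show ?thesis using that by auto
  qed
  show "\<exists>d>0. \<forall>x'\<in>{a..b}. dist x' x < d \<longrightarrow> dist (f x') (f x) < e"
  proof (intro exI[of _ \<delta>] conjI ballI impI)
    fix y assume y: "y \<in> {a..b}" "dist y x < \<delta>"
    show "dist (f y) (f x) < e"
    proof (cases "x \<le> y")
      case True then show ?thesis using *[of x y] x y by (simp add: dist_norm)
    next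
      case False then show ?thesis using *[of y x] x y by (simp add: dist_norm norm_minus_commute)
    qed
  qed (rule \<delta>)
qed

lemma division_of_atLeastAtMost:
  fixes D :: "real set set"
  assumes "D division_of \<Union>D" "\<Union>D \<subseteq> {a..b}" "K \<in> D"
  shows "Inf K \<le> Sup K" "Inf K \<in> {a..b}" "Sup K \<in> {a..b}"
proof -
  obtain u v where K: "K = cbox u v" using assms by (meson division_ofD(4))
  have "K \<noteq> {}" using assms by (meson division_ofD(3))
  then have uv: "u \<le> v" using K by simp
  then have "u \<in> K" "v \<in> K" using K by auto
  then have "u \<in> {a..b}" "v \<in> {a..b}" using assms by auto
  then show "Inf K \<le> Sup K" "Inf K \<in> {a..b}" "Sup K \<in> {a..b}" using K uv by auto
qed

text \<open>In a sufficiently fine tagged division, the intervals tagged in the exceptional null set have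
  small total length, so absolute continuity controls their contribution.\<close>

lemma ac_deriv_has_integral:
  assumes f: "ac_deriv f f'" and ab: "0 \<le> a" "a \<le> b" "b \<le> 1"
  shows "(f' has_integral (f b - f a)) {a..b}"
proof (cases "a = b")
  case False
  then have lt: "a < b" using ab by simp
  obtain N where N: "N \<in> null_sets lebesgue"
    "\<And>x. x \<in> {0..1} \<Longrightarrow> x \<notin> N \<Longrightarrow> (f has_vector_derivative f' x) (at x within {0..1})"
  proof -
    have "AE x in lebesgue. x \<in> {0..1} \<longrightarrow> (f has_vector_derivative f' x) (at x within {0..1})"
      using f by (simp add: ac_deriv_def)
    then show ?thesis unfolding eventually_ae_filter using that by auto
  qed
  \<comment> \<open>With the value 0 on N, intervals tagged in N leave only increments of f to
    estimate.\<close>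
  define g where "g = (\<lambda>x. if x \<in> N then 0 else f' x)"
  have "(g has_integral (f b - f a)) {a..b}"
    unfolding has_integral_factor_content_real
  proof (intro allI impI)
    fix e :: real assume e: "e > 0"
    have "e / 2 * (b - a) > 0" using e lt by simp
    then obtain \<delta> where \<delta>: "\<delta> > 0" "\<And>D. D division_of \<Union>D \<Longrightarrow> \<Union>D \<subseteq> {0..1} \<Longrightarrow> (\<Sum>K\<in>D. Sup K - Inf K) < \<delta>
      \<Longrightarrow> (\<Sum>K\<in>D. norm (f (Sup K) - f (Inf K))) < e / 2 * (b - a)"
      using abs_continuous_onE[OF conjunct1[OF f[unfolded ac_deriv_def]] \<open>e / 2 * (b - a) > 0\<close>] by blast
    \<comment> \<open>\<open>\<delta>\<close> comes from absolute continuity; N is a null set, so an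
      open set around it can have measure below \<open>\<delta>\<close>.\<close>
    obtain U where U: "open U" "N \<subseteq> U" "U - N \<in> lmeasurable" "emeasure lebesgue (U - N) < ennreal \<delta>"
      using sets_lebesgue_outer_open[of N \<delta>] N(1) \<delta>(1) by blast
    have Nl: "N \<in> lmeasurable" using N(1) negligible_iff_null_sets negligible_imp_measurable by blast
    have UN: "U = (U - N) \<union> N" using U(2) by blast
    have Ul: "U \<in> lmeasurable" using U(3) Nl UN by (metis fmeasurable.Un)
    have "measure lebesgue U \<le> measure lebesgue (U - N) + measure lebesgue N"
      using measure_Un_le[of "U - N" lebesgue N] U(3) Nl UN by (metis fmeasurableD)
    also have "measure lebesgue N = 0" using N(1) by (simp add: measure_eq_0_null_sets)
    also have "measure lebesgue (U - N) < \<delta>"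
      using U(3,4) \<delta>(1) by (metis emeasure_eq_measure2 ennreal_less_iff measure_nonneg)
    finally have mU: "measure lebesgue U < \<delta>" by simp
    have "\<exists>r>0. x \<in> {0..1} \<longrightarrow> x \<notin> N \<longrightarrow> (\<forall>y\<in>{0..1}. \<bar>y - x\<bar> < r \<longrightarrow>
        norm (f y - f x - (y - x) *\<^sub>R f' x) \<le> e / 2 * \<bar>y - x\<bar>)" for x
    proof (cases "x \<in> {0..1} \<and> x \<notin> N")
      case True
      then have "(f has_derivative (\<lambda>h. h *\<^sub>R f' x)) (at x within {0..1})"
        using N(2) by (simp add: has_vector_derivative_def)
      then show ?thesis using e unfolding has_derivative_within_alt
        by (metis half_gt_zero real_norm_def)
    qed (auto intro: exI[of _ 1])
    then obtain r where r: "\<And>x. r x > 0" "\<And>x y. x \<in> {0..1} \<Longrightarrow> x \<notin> N \<Longrightarrow> y \<in> {0..1} \<Longrightarrow> \<bar>y - x\<bar> < r x \<Longrightarrow>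
        norm (f y - f x - (y - x) *\<^sub>R f' x) \<le> e / 2 * \<bar>y - x\<bar>" by metis
    \<comment> \<open>Tags in N force their intervals into U; the remaining tags in [a,b] are points
      of differentiability, with relative error e/2.\<close>
    define \<gamma> where "\<gamma> = (\<lambda>x. if x \<in> N then U else ball x (r x))"
    show "\<exists>\<gamma>. gauge \<gamma> \<and> (\<forall>p. p tagged_division_of {a..b} \<and> \<gamma> fine p \<longrightarrow>
      norm ((\<Sum>(x, K)\<in>p. measure lborel K *\<^sub>R g x) - (f b - f a)) \<le> e * measure lborel {a..b})"
    proof (intro exI[of _ \<gamma>] conjI allI impI)
      show "gauge \<gamma>" using U r(1) by (auto simp: \<gamma>_def gauge_def)
      fix p assume "p tagged_division_of {a..b} \<and> \<gamma> fine p"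
      then have p: "p tagged_division_of {a..b}" "\<gamma> fine p" by auto
      have finp: "finite p" using p(1) by (rule tagged_division_of_finite)
      have pK: "\<exists>u v. K = {u..v} \<and> u \<le> v \<and> x \<in> {u..v} \<and> {u..v} \<subseteq> {a..b}" if xK: "(x, K) \<in> p" for x K
      proof -
        obtain u v where "K = cbox u v" using tagged_division_ofD(4)[OF p(1) xK] by blast
        moreover have "x \<in> K" "K \<subseteq> {a..b}" using tagged_division_ofD(2,3)[OF p(1) xK] by auto
        ultimately show ?thesis by (intro exI[of _ u] exI[of _ v]) auto
      qed
      let ?err = "\<lambda>(x, K). measure lborel K *\<^sub>R g x - (f (Sup K) - f (Inf K))"
      define p1 p2 where "p1 = {xk \<in> p. fst xk \<notin> N}" and "p2 = {xk \<in> p. fst xk \<in> N}"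
      have p12: "p = p1 \<union> p2" "p1 \<inter> p2 = {}" "finite p1" "finite p2" using finp by (auto simp: p1_def p2_def)
      have "(\<Sum>(x, K)\<in>p. measure lborel K *\<^sub>R g x) - (f b - f a) = (\<Sum>xk\<in>p. ?err xk)"
        using additive_tagged_division_1[OF ab(2) p(1), of f]
        by (simp add: sum_subtractf case_prod_unfold)
      also have "\<dots> = (\<Sum>xk\<in>p1. ?err xk) + (\<Sum>xk\<in>p2. ?err xk)"
        using p12 by (subst p12(1)) (rule sum.union_disjoint)
      finally have split: "(\<Sum>(x, K)\<in>p. measure lborel K *\<^sub>R g x) - (f b - f a) = (\<Sum>xk\<in>p1. ?err xk) + (\<Sum>xk\<in>p2. ?err xk)" .
      have "norm (\<Sum>xk\<in>p1. ?err xk) \<le> (\<Sum>xk\<in>p1. e / 2 * measure lborel (snd xk))"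
      proof (rule sum_norm_le)
        fix xk assume xk: "xk \<in> p1"
        obtain x K where xK: "xk = (x, K)" by (cases xk)
        then have xp: "(x, K) \<in> p" "x \<notin> N" using xk by (auto simp: p1_def)
        obtain u v where uv: "K = {u..v}" "u \<le> v" "x \<in> {u..v}" "{u..v} \<subseteq> {a..b}" using pK[OF xp(1)] by blast
        have sub: "K \<subseteq> ball x (r x)" using fineD[OF p(2) xp(1)] xp(2) by (simp add: \<gamma>_def)
        have "u \<in> K" "v \<in> K" using uv by auto
        then have "u \<in> ball x (r x)" "v \<in> ball x (r x)" using sub by blast+
        then have d: "\<bar>u - x\<bar> < r x" "\<bar>v - x\<bar> < r x" by (simp_all add: dist_real_def abs_minus_commute)
        have in01: "x \<in> {0..1}" "u \<in> {0..1}" "v \<in> {0..1}" using uv ab by auto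
        \<comment> \<open>Both endpoints are compared with the tag; as it lies between them, the two
          distances add up to v - u.\<close>
        have "f v - f u - (v - u) *\<^sub>R f' x = (f v - f x - (v - x) *\<^sub>R f' x) - (f u - f x - (u - x) *\<^sub>R f' x)"
          by (simp add: algebra_simps)
        then have "norm (f v - f u - (v - u) *\<^sub>R f' x) \<le> norm (f v - f x - (v - x) *\<^sub>R f' x) + norm (f u - f x - (u - x) *\<^sub>R f' x)"
          by (metis norm_triangle_ineq4)
        also have "\<dots> \<le> e / 2 * \<bar>v - x\<bar> + e / 2 * \<bar>u - x\<bar>"
          using r(2)[OF in01(1) xp(2) in01(3) d(2)] r(2)[OF in01(1) xp(2) in01(2) d(1)] by (rule add_mono)
        also have "\<dots> = e / 2 * (\<bar>v - x\<bar> + \<bar>u - x\<bar>)" by (simp only: distrib_left)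
        also have "\<bar>v - x\<bar> + \<bar>u - x\<bar> = v - u" using uv by simp
        finally have "norm (f v - f u - (v - u) *\<^sub>R f' x) \<le> e / 2 * (v - u)" .
        then show "norm (?err xk) \<le> e / 2 * measure lborel (snd xk)"
          using xp(2) uv by (simp add: xK g_def norm_minus_commute)
      qed
      also have "\<dots> \<le> (\<Sum>xk\<in>p. e / 2 * measure lborel (snd xk))"
        using finp e by (intro sum_mono2) (auto simp: p1_def)
      also have "\<dots> = e / 2 * (b - a)"
        using additive_content_tagged_division[of p a b] p(1) ab by (simp add: sum_distrib_left[symmetric] case_prod_unfold del: times_divide_eq_left)
      finally have b1: "norm (\<Sum>xk\<in>p1. ?err xk) \<le> e / 2 * (b - a)" .
      define D where "D = snd ` p2"
      have "p2 tagged_partial_division_of {a..b}"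
        using p(1) unfolding tagged_division_of_def p2_def by (auto intro: tagged_partial_division_subset)
      then have td2: "p2 tagged_division_of \<Union>D" unfolding D_def by (rule tagged_partial_division_of_Union_self)
      then have D: "D division_of \<Union>D" unfolding D_def by (rule division_of_tagged_division)
      have D01: "\<Union>D \<subseteq> {0..1}" using pK ab by (fastforce simp: D_def p2_def)
      have DU: "\<Union>D \<subseteq> U" using fineD[OF p(2)] by (fastforce simp: D_def p2_def \<gamma>_def)
      have "(\<Sum>K\<in>D. Sup K - Inf K) = (\<Sum>K\<in>D. measure lebesgue K)"
      proof (rule sum.cong[OF refl])
        fix K assume "K \<in> D"
        then obtain x where "(x, K) \<in> p" by (auto simp: D_def p2_def)
        then obtain u v where "K = {u..v}" "u \<le> v" using pK by meson
        then show "Sup K - Inf K = measure lebesgue K" by (simp add: measure_completion)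
      qed
      also have "\<dots> = measure lebesgue (\<Union>D)" using content_division[OF D] by simp
      also have "\<dots> \<le> measure lebesgue U"
      proof (rule measure_mono_fmeasurable[OF DU _ Ul])
        show "\<Union>D \<in> sets lebesgue" using D lmeasurable_division by blast
      qed
      also note mU
      finally have "(\<Sum>K\<in>D. norm (f (Sup K) - f (Inf K))) < e / 2 * (b - a)" by (rule \<delta>(2)[OF D D01])
      \<comment> \<open>Summing over tagged intervals instead of D requires the value 0 on sets with
        empty interior. One-point intervals have Sup = Inf; for the empty set both are unspecified,
        hence the case distinction.\<close>
      also have "(\<Sum>K\<in>D. norm (f (Sup K) - f (Inf K))) = (\<Sum>K\<in>D. if K = {} then 0 else norm (f (Sup K) - f (Inf K)))"
        using division_ofD(3)[OF D] by (intro sum.cong) auto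
      also have "\<dots> = (\<Sum>(x, K)\<in>p2. if K = {} then 0 else norm (f (Sup K) - f (Inf K)))"
        unfolding D_def by (rule sum.over_tagged_division_lemma[OF td2, symmetric]) (auto simp: le_less)
      also have "\<dots> = (\<Sum>(x, K)\<in>p2. norm (f (Sup K) - f (Inf K)))"
      proof (rule sum.cong[OF refl])
        fix xk assume "xk \<in> p2"
        then have "snd xk \<noteq> {}" using pK[of "fst xk" "snd xk"] by (auto simp: p2_def)
        then show "(case xk of (x, K) \<Rightarrow> if K = {} then 0 else norm (f (Sup K) - f (Inf K)))
          = (case xk of (x, K) \<Rightarrow> norm (f (Sup K) - f (Inf K)))" by (simp add: case_prod_unfold)
      qed
      finally have s2: "(\<Sum>(x, K)\<in>p2. norm (f (Sup K) - f (Inf K))) < e / 2 * (b - a)" .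
      have "norm (\<Sum>xk\<in>p2. ?err xk) \<le> (\<Sum>(x, K)\<in>p2. norm (f (Sup K) - f (Inf K)))"
        by (rule sum_norm_le) (auto simp: p2_def g_def norm_minus_commute)
      then have "norm ((\<Sum>xk\<in>p1. ?err xk) + (\<Sum>xk\<in>p2. ?err xk)) \<le> e * (b - a)"
        using b1 s2 norm_triangle_ineq[of "\<Sum>xk\<in>p1. ?err xk" "\<Sum>xk\<in>p2. ?err xk"] by (simp add: algebra_simps)
      then show "norm ((\<Sum>(x, K)\<in>p. measure lborel K *\<^sub>R g x) - (f b - f a)) \<le> e * measure lborel {a..b}"
        unfolding split using ab by simp
    qed
  qed
  then show ?thesis
    by (rule has_integral_spike[rotated 2]) (use N(1) in \<open>auto simp: negligible_iff_null_sets g_def\<close>)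
qed (simp add: has_integral_refl(2))

lemma ac_deriv_continuous: "ac_deriv f f' \<Longrightarrow> continuous_on {0..1} f"
  by (simp add: ac_deriv_def abs_continuous_on_imp_continuous_on)

lemma ac_deriv_cong:
  assumes "ac_deriv f f'" "\<And>x. f x = g x" "\<And>x. x \<in> {0..1} \<Longrightarrow> f' x = g' x"
  shows "ac_deriv g g'"
proof -
  have fg: "f = g" using assms(2) by auto
  have "AE x in lebesgue. x \<in> {0..1} \<longrightarrow> (f has_vector_derivative f' x) (at x within {0..1})"
    using assms(1) by (simp add: ac_deriv_def)
  then have "AE x in lebesgue. x \<in> {0..1} \<longrightarrow> (f has_vector_derivative g' x) (at x within {0..1})"
    by (rule eventually_mono) (use assms(3) in simp)
  then show ?thesis using assms(1) by (simp add: ac_deriv_def fg)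
qed

lemma ac_deriv_diff:
  assumes "ac_deriv f f'" "ac_deriv g g'"
  shows "ac_deriv (\<lambda>x. f x - g x) (\<lambda>x. f' x - g' x)"
  unfolding ac_deriv_def
proof
  show "abs_continuous_on {0..1} (\<lambda>x. f x - g x)"
    unfolding abs_continuous_on_def
  proof (intro allI impI)
    fix \<epsilon> :: real assume "\<epsilon> > 0"
    then have e: "\<epsilon> / 2 > 0" by simp
    obtain \<delta>1 where d1: "\<delta>1 > 0" "\<And>D. D division_of \<Union>D \<Longrightarrow> \<Union>D \<subseteq> {0..1} \<Longrightarrow> (\<Sum>K\<in>D. Sup K - Inf K) < \<delta>1
      \<Longrightarrow> (\<Sum>K\<in>D. norm (f (Sup K) - f (Inf K))) < \<epsilon> / 2"
      using abs_continuous_onE[OF conjunct1[OF assms(1)[unfolded ac_deriv_def]] e] by blast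
    obtain \<delta>2 where d2: "\<delta>2 > 0" "\<And>D. D division_of \<Union>D \<Longrightarrow> \<Union>D \<subseteq> {0..1} \<Longrightarrow> (\<Sum>K\<in>D. Sup K - Inf K) < \<delta>2
      \<Longrightarrow> (\<Sum>K\<in>D. norm (g (Sup K) - g (Inf K))) < \<epsilon> / 2"
      using abs_continuous_onE[OF conjunct1[OF assms(2)[unfolded ac_deriv_def]] e] by blast
    show "\<exists>\<delta>>0. \<forall>D. D division_of \<Union>D \<and> \<Union>D \<subseteq> {0..1} \<and> (\<Sum>K\<in>D. Sup K - Inf K) < \<delta> \<longrightarrow>
      (\<Sum>K\<in>D. norm (f (Sup K) - g (Sup K) - (f (Inf K) - g (Inf K)))) < \<epsilon>"
    proof (intro exI[of _ "min \<delta>1 \<delta>2"] conjI allI impI)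
      fix D :: "real set set"
      assume D: "D division_of \<Union>D \<and> \<Union>D \<subseteq> {0..1} \<and> (\<Sum>K\<in>D. Sup K - Inf K) < min \<delta>1 \<delta>2"
      have "(\<Sum>K\<in>D. norm (f (Sup K) - g (Sup K) - (f (Inf K) - g (Inf K))))
        \<le> (\<Sum>K\<in>D. norm (f (Sup K) - f (Inf K)) + norm (g (Sup K) - g (Inf K)))"
      proof (rule sum_mono)
        fix K
        show "norm (f (Sup K) - g (Sup K) - (f (Inf K) - g (Inf K)))
          \<le> norm (f (Sup K) - f (Inf K)) + norm (g (Sup K) - g (Inf K))"
          using norm_triangle_ineq4[of "f (Sup K) - f (Inf K)" "g (Sup K) - g (Inf K)"] by (simp add: algebra_simps)
      qed
      also have "\<dots> < \<epsilon> / 2 + \<epsilon> / 2"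
        using d1(2)[of D] d2(2)[of D] D unfolding sum.distrib by (intro add_strict_mono) auto
      finally show "(\<Sum>K\<in>D. norm (f (Sup K) - g (Sup K) - (f (Inf K) - g (Inf K)))) < \<epsilon>" by simp
    qed (use d1 d2 in auto)
  qed
  show "AE x in lebesgue. x \<in> {0..1} \<longrightarrow> ((\<lambda>x. f x - g x) has_vector_derivative f' x - g' x) (at x within {0..1})"
    using assms(1)[unfolded ac_deriv_def, THEN conjunct2] assms(2)[unfolded ac_deriv_def, THEN conjunct2]
    by eventually_elim (blast intro: has_vector_derivative_diff)
qed

lemma continuous_on_bounded_01:
  fixes f :: "real \<Rightarrow> complex"
  assumes "continuous_on {0..1} f"
  obtains M where "M > 0" "\<And>x. x \<in> {0..1} \<Longrightarrow> norm (f x) \<le> M"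
proof -
  have "bounded (f ` {0..1})" using assms by (intro compact_imp_bounded compact_continuous_image) auto
  then show ?thesis using that by (auto simp: bounded_pos)
qed

text \<open>The increment of the product is split with g at the right end and f at the left end;
  both are bounded, being continuous on a compact interval.\<close>

lemma ac_deriv_mult:
  assumes f: "ac_deriv f f'" and g: "ac_deriv g g'"
  shows "ac_deriv (\<lambda>x. f x * g x) (\<lambda>x. f x * g' x + f' x * g x)"
  unfolding ac_deriv_def
proof
  obtain M where M: "M > 0" "\<And>x. x \<in> {0..1} \<Longrightarrow> norm (f x) \<le> M"
    using continuous_on_bounded_01[OF ac_deriv_continuous[OF f]] by blast
  obtain L where L: "L > 0" "\<And>x. x \<in> {0..1} \<Longrightarrow> norm (g x) \<le> L"
    using continuous_on_bounded_01[OF ac_deriv_continuous[OF g]] by blast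
  show "abs_continuous_on {0..1} (\<lambda>x. f x * g x)"
    unfolding abs_continuous_on_def
  proof (intro allI impI)
    fix \<epsilon> :: real assume e: "\<epsilon> > 0"
    then have e': "\<epsilon> / (2 * L) > 0" "\<epsilon> / (2 * M) > 0" using L M by auto
    obtain \<delta>1 where d1: "\<delta>1 > 0" "\<And>D. D division_of \<Union>D \<Longrightarrow> \<Union>D \<subseteq> {0..1} \<Longrightarrow> (\<Sum>K\<in>D. Sup K - Inf K) < \<delta>1
      \<Longrightarrow> (\<Sum>K\<in>D. norm (f (Sup K) - f (Inf K))) < \<epsilon> / (2 * L)"
      using abs_continuous_onE[OF conjunct1[OF f[unfolded ac_deriv_def]] e'(1)] by blast
    obtain \<delta>2 where d2: "\<delta>2 > 0" "\<And>D. D division_of \<Union>D \<Longrightarrow> \<Union>D \<subseteq> {0..1} \<Longrightarrow> (\<Sum>K\<in>D. Sup K - Inf K) < \<delta>2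
      \<Longrightarrow> (\<Sum>K\<in>D. norm (g (Sup K) - g (Inf K))) < \<epsilon> / (2 * M)"
      using abs_continuous_onE[OF conjunct1[OF g[unfolded ac_deriv_def]] e'(2)] by blast
    show "\<exists>\<delta>>0. \<forall>D. D division_of \<Union>D \<and> \<Union>D \<subseteq> {0..1} \<and> (\<Sum>K\<in>D. Sup K - Inf K) < \<delta> \<longrightarrow>
      (\<Sum>K\<in>D. norm (f (Sup K) * g (Sup K) - f (Inf K) * g (Inf K))) < \<epsilon>"
    proof (intro exI[of _ "min \<delta>1 \<delta>2"] conjI allI impI)
      fix D :: "real set set"
      assume D: "D division_of \<Union>D \<and> \<Union>D \<subseteq> {0..1} \<and> (\<Sum>K\<in>D. Sup K - Inf K) < min \<delta>1 \<delta>2"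
      have "(\<Sum>K\<in>D. norm (f (Sup K) * g (Sup K) - f (Inf K) * g (Inf K)))
        \<le> (\<Sum>K\<in>D. L * norm (f (Sup K) - f (Inf K)) + M * norm (g (Sup K) - g (Inf K)))"
      proof (rule sum_mono)
        fix K assume K: "K \<in> D"
        have in01: "Inf K \<in> {0..1}" "Sup K \<in> {0..1}" using division_of_atLeastAtMost[of D 0 1 K] D K by auto
        have "f (Sup K) * g (Sup K) - f (Inf K) * g (Inf K)
          = g (Sup K) * (f (Sup K) - f (Inf K)) + f (Inf K) * (g (Sup K) - g (Inf K))" by (simp add: algebra_simps)
        then have "norm (f (Sup K) * g (Sup K) - f (Inf K) * g (Inf K))
          \<le> norm (g (Sup K)) * norm (f (Sup K) - f (Inf K)) + norm (f (Inf K)) * norm (g (Sup K) - g (Inf K))"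
          by (metis norm_mult norm_triangle_ineq)
        also have "\<dots> \<le> L * norm (f (Sup K) - f (Inf K)) + M * norm (g (Sup K) - g (Inf K))"
          using L(2)[OF in01(2)] M(2)[OF in01(1)] by (intro add_mono mult_right_mono) auto
        finally show "norm (f (Sup K) * g (Sup K) - f (Inf K) * g (Inf K))
          \<le> L * norm (f (Sup K) - f (Inf K)) + M * norm (g (Sup K) - g (Inf K))" .
      qed
      also have "\<dots> = L * (\<Sum>K\<in>D. norm (f (Sup K) - f (Inf K))) + M * (\<Sum>K\<in>D. norm (g (Sup K) - g (Inf K)))"
        by (simp add: sum.distrib sum_distrib_left)
      also have "\<dots> < L * (\<epsilon> / (2 * L)) + M * (\<epsilon> / (2 * M))"
        using d1(2)[of D] d2(2)[of D] D L M by (intro add_strict_mono mult_strict_left_mono) auto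
      also have "\<dots> = \<epsilon>" using L M by simp
      finally show "(\<Sum>K\<in>D. norm (f (Sup K) * g (Sup K) - f (Inf K) * g (Inf K))) < \<epsilon>" .
    qed (use d1 d2 in auto)
  qed
  show "AE x in lebesgue. x \<in> {0..1} \<longrightarrow> ((\<lambda>x. f x * g x) has_vector_derivative f x * g' x + f' x * g x) (at x within {0..1})"
    using f[unfolded ac_deriv_def, THEN conjunct2] g[unfolded ac_deriv_def, THEN conjunct2]
    by eventually_elim (blast intro: has_vector_derivative_mult)
qed

text \<open>A bounded derivative makes f Lipschitz, and then \<delta> = \<epsilon> / M
  works.\<close>

lemma ac_deriv_smooth:
  assumes f: "\<And>x. x \<in> {0..1} \<Longrightarrow> (f has_vector_derivative f' x) (at x)" and f': "continuous_on {0..1} f'"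
  shows "ac_deriv f f'"
  unfolding ac_deriv_def
proof
  obtain M where M: "M > 0" "\<And>x. x \<in> {0..1} \<Longrightarrow> norm (f' x) \<le> M"
    using continuous_on_bounded_01[OF f'] by blast
  have lip: "norm (f y - f x) \<le> M * norm (y - x)" if "x \<in> {0..1}" "y \<in> {0..1}" for x y
  proof (rule differentiable_bound[of "{0..1}"])
    fix x :: real assume x: "x \<in> {0..1}"
    show "(f has_derivative (\<lambda>h. h *\<^sub>R f' x)) (at x within {0..1})"
      using has_vector_derivative_at_within[OF f[OF x]] by (simp add: has_vector_derivative_def)
    show "onorm (\<lambda>h. h *\<^sub>R f' x) \<le> M"
    proof (rule onorm_le)
      fix h :: real
      show "norm (h *\<^sub>R f' x) \<le> M * norm h"
        using mult_left_mono[OF M(2)[OF x], of "\<bar>h\<bar>"] by (simp add: mult.commute)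
    qed
  qed (use that in auto)
  show "abs_continuous_on {0..1} f" unfolding abs_continuous_on_def
  proof (intro allI impI)
    fix \<epsilon> :: real assume e: "\<epsilon> > 0"
    show "\<exists>\<delta>>0. \<forall>D. D division_of \<Union>D \<and> \<Union>D \<subseteq> {0..1} \<and> (\<Sum>K\<in>D. Sup K - Inf K) < \<delta> \<longrightarrow>
      (\<Sum>K\<in>D. norm (f (Sup K) - f (Inf K))) < \<epsilon>"
    proof (intro exI[of _ "\<epsilon> / M"] conjI allI impI)
      fix D :: "real set set"
      assume D: "D division_of \<Union>D \<and> \<Union>D \<subseteq> {0..1} \<and> (\<Sum>K\<in>D. Sup K - Inf K) < \<epsilon> / M"
      have "(\<Sum>K\<in>D. norm (f (Sup K) - f (Inf K))) \<le> (\<Sum>K\<in>D. M * (Sup K - Inf K))"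
      proof (rule sum_mono)
        fix K assume K: "K \<in> D"
        have in01: "Inf K \<le> Sup K" "Inf K \<in> {0..1}" "Sup K \<in> {0..1}"
          using division_of_atLeastAtMost[of D 0 1 K] D K by auto
        show "norm (f (Sup K) - f (Inf K)) \<le> M * (Sup K - Inf K)"
          using lip[OF in01(2,3)] in01(1) by simp
      qed
      also have "\<dots> = M * (\<Sum>K\<in>D. Sup K - Inf K)" by (simp add: sum_distrib_left)
      also have "\<dots> < \<epsilon>" using D M by (simp add: field_simps)
      finally show "(\<Sum>K\<in>D. norm (f (Sup K) - f (Inf K))) < \<epsilon>" .
    qed (use e M in auto)
  qed
  show "AE x in lebesgue. x \<in> {0..1} \<longrightarrow> (f has_vector_derivative f' x) (at x within {0..1})"
    using f by (intro always_eventually) (auto intro: has_vector_derivative_at_within)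
qed

lemma ac_deriv_const: "ac_deriv (\<lambda>x. c) (\<lambda>x. 0)"
  by (rule ac_deriv_smooth) auto

text \<open>The summand \<tau> is there for kernels exp (s (x - t)). Uses without a shift take
  \<tau> = 0, which explains the literal \<open>+ 0\<close> in several exponents.\<close>

lemma ac_deriv_exp: "ac_deriv (\<lambda>x. exp (\<sigma> * of_real x + \<tau>)) (\<lambda>x. \<sigma> * exp (\<sigma> * of_real x + \<tau>))"
proof (rule ac_deriv_smooth)
  fix x :: real
  have "((\<lambda>z. exp (\<sigma> * z + \<tau>)) has_field_derivative \<sigma> * exp (\<sigma> * of_real x + \<tau>)) (at (of_real x))"
    by (auto intro!: derivative_eq_intros)
  then show "((\<lambda>x. exp (\<sigma> * of_real x + \<tau>)) has_vector_derivative \<sigma> * exp (\<sigma> * of_real x + \<tau>)) (at x)"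
    by (rule has_vector_derivative_real_field)
qed (intro continuous_intros)

section \<open>Products with continuous functions and approximation in L1\<close>

lemma absolutely_integrable_continuous_mult:
  fixes q f :: "real \<Rightarrow> complex"
  assumes "continuous_on {0..1} f" "q absolutely_integrable_on {0..1}"
  shows "(\<lambda>t. q t * f t) absolutely_integrable_on {0..1}"
proof -
  have "(\<lambda>t. f t * q t) absolutely_integrable_on {0..1}"
  proof (rule absolutely_integrable_bounded_measurable_product[OF bilinear_times _ _ _ assms(2)])
    show "f \<in> borel_measurable (lebesgue_on {0..1})"
      using assms(1) by (intro continuous_imp_measurable_on_sets_lebesgue) auto
    show "bounded (f ` {0..1})" using assms(1) by (intro compact_imp_bounded compact_continuous_image) auto
  qed simp
  then show ?thesis by (simp add: mult.commute)
qed

lemma absolutely_integrable_continuous_mult_real: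
  fixes k w :: "real \<Rightarrow> real"
  assumes "continuous_on {0..1} w" "k absolutely_integrable_on {0..1}"
  shows "(\<lambda>t. k t * w t) absolutely_integrable_on {0..1}"
proof -
  have "(\<lambda>t. w t * k t) absolutely_integrable_on {0..1}"
    by (rule absolutely_integrable_bounded_measurable_product_real)
      (use assms in \<open>auto intro!: continuous_imp_measurable_on_sets_lebesgue compact_imp_bounded compact_continuous_image\<close>)
  then show ?thesis by (simp add: mult.commute)
qed

text \<open>Measurable functions are almost everywhere limits of continuous functions; radial truncation,
  i.e. projection to a ball, makes dominated convergence applicable.\<close>

lemma L1_approx_continuous:
  fixes f :: "real \<Rightarrow> 'a::euclidean_space"
  assumes f: "f absolutely_integrable_on {a..b}" and e: "e > 0"
  obtains g where "continuous_on UNIV g" "bounded (range g)" "integral {a..b} (\<lambda>x. norm (f x - g x)) < e"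
proof -
  \<comment> \<open>Projection to a closed ball is nonexpansive, so truncation preserves
    measurability and continuity.\<close>
  define T where "T = (\<lambda>n::nat. closest_point (cball (0::'a) (real n)))"
  have T0: "T n 0 = 0" for n unfolding T_def by (intro closest_point_self) simp
  have Tlip: "norm (T n x - T n y) \<le> norm (x - y)" for n x y
    using closest_point_lipschitz[of "cball (0::'a) (real n)" x y] by (simp add: T_def dist_norm)
  have Tcont: "continuous_on UNIV (T n)" for n unfolding T_def
    by (intro continuous_on_closest_point) auto
  have Tbd: "norm (T n x) \<le> real n" for n x
    using closest_point_in_set[of "cball (0::'a) (real n)" x] by (simp add: T_def)
  have Tle: "norm (T n x) \<le> norm x" for n x using Tlip[of n x 0] T0 by simp
  have Tid: "T n x = x" if "norm x \<le> real n" for n x unfolding T_def using that by (intro closest_point_self) simp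
  have fm: "f \<in> borel_measurable (lebesgue_on {a..b})"
    using f by (simp add: absolutely_integrable_measurable)
  then have "f measurable_on {a..b}" by (simp add: measurable_on_iff_borel_measurable)
  then obtain N h where N: "negligible N" and h: "\<And>n. continuous_on UNIV (h n)"
    "\<And>x. x \<notin> N \<Longrightarrow> (\<lambda>n. h n x) \<longlonglongrightarrow> (if x \<in> {a..b} then f x else 0)"
    unfolding measurable_on_def by blast
  have Tf: "(\<lambda>x. T n (f x)) absolutely_integrable_on {a..b}" for n
  proof (rule measurable_bounded_by_integrable_imp_absolutely_integrable)
    show "(\<lambda>x. T n (f x)) \<in> borel_measurable (lebesgue_on {a..b})"
      using fm borel_measurable_continuous_onI[OF Tcont[of n]] by (rule measurable_compose)
    show "(\<lambda>x. norm (f x)) integrable_on {a..b}" using f by (simp add: absolutely_integrable_on_def)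
  qed (use Tle in auto)
  have "(\<lambda>n. integral {a..b} (\<lambda>x. norm (f x - T n (f x)))) \<longlonglongrightarrow> integral {a..b} (\<lambda>x. 0::real)"
  proof (rule dominated_convergence(2))
    show "(\<lambda>x. norm (f x - T n (f x))) integrable_on {a..b}" for n
      using set_integral_diff(1)[OF f Tf[of n]] by (simp add: absolutely_integrable_on_def)
    show "(\<lambda>x. 2 * norm (f x)) integrable_on {a..b}"
      using f by (simp add: absolutely_integrable_on_def)
    show "norm (norm (f x - T n (f x))) \<le> 2 * norm (f x)" for n x
      using norm_triangle_ineq4[of "f x" "T n (f x)"] Tle[of n "f x"] by simp
    fix x
    have "\<forall>\<^sub>F n in sequentially. norm (f x - T n (f x)) = 0"
      using eventually_ge_at_top[of "nat \<lceil>norm (f x)\<rceil>"] by eventually_elim (simp add: Tid nat_le_iff ceiling_le_iff)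
    then show "(\<lambda>n. norm (f x - T n (f x))) \<longlonglongrightarrow> 0" by (rule tendsto_eventually)
  qed
  then have "\<forall>\<^sub>F n in sequentially. integral {a..b} (\<lambda>x. norm (f x - T n (f x))) < e / 2"
    using e by (intro order_tendstoD(2)) auto
  then obtain n where n: "integral {a..b} (\<lambda>x. norm (f x - T n (f x))) < e / 2"
    by (meson eventually_sequentially order_refl)
  have cTh: "continuous_on UNIV (\<lambda>x. T n (h m x))" for m
    using continuous_on_compose2[OF Tcont h(1)] by simp
  have aTh: "(\<lambda>x. T n (h m x)) absolutely_integrable_on {a..b}" for m
    using cTh by (intro absolutely_integrable_continuous_real continuous_on_subset[OF cTh]) auto
  have iTh: "(\<lambda>x. norm (T n (f x) - T n (h m x))) integrable_on {a..b}" for m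
    using set_integral_diff(1)[OF Tf[of n] aTh[of m]] by (simp add: absolutely_integrable_on_def)
  \<comment> \<open>On N the approximants need not converge; the value 0 there gives convergence
    everywhere and leaves the integral unchanged.\<close>
  define D where "D = (\<lambda>m x. if x \<in> N then 0 else norm (T n (f x) - T n (h m x)))"
  have "(\<lambda>m. integral {a..b} (D m)) \<longlonglongrightarrow> integral {a..b} (\<lambda>x. 0::real)"
  proof (rule dominated_convergence(2))
    show "D m integrable_on {a..b}" for m
      by (rule integrable_spike[OF iTh[of m] N]) (simp add: D_def)
    show "(\<lambda>x. 2 * real n) integrable_on {a..b}" by (intro integrable_continuous_real continuous_intros)
    show "norm (D m x) \<le> 2 * real n" for m x
      using norm_triangle_ineq4[of "T n (f x)" "T n (h m x)"] Tbd[of n "f x"] Tbd[of n "h m x"] by (simp add: D_def)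
    fix x assume x: "x \<in> {a..b}"
    show "(\<lambda>m. D m x) \<longlonglongrightarrow> 0"
    proof (cases "x \<in> N")
      case False
      then have "(\<lambda>m. h m x) \<longlonglongrightarrow> f x" using h(2)[of x] x by simp
      then have "(\<lambda>m. T n (h m x)) \<longlonglongrightarrow> T n (f x)"
        by (rule continuous_on_tendsto_compose[OF Tcont]) auto
      then have "(\<lambda>m. norm (T n (f x) - T n (h m x))) \<longlonglongrightarrow> norm (T n (f x) - T n (f x))"
        by (intro tendsto_intros)
      then show ?thesis using False by (simp add: D_def)
    qed (simp add: D_def)
  qed
  then have "\<forall>\<^sub>F m in sequentially. integral {a..b} (D m) < e / 2"
    using e by (intro order_tendstoD(2)) auto
  then obtain m where m: "integral {a..b} (D m) < e / 2"
    by (meson eventually_sequentially order_refl)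
  have "integral {a..b} (\<lambda>x. norm (T n (f x) - T n (h m x))) = integral {a..b} (D m)"
    by (rule integral_spike[OF N]) (simp add: D_def)
  then have m': "integral {a..b} (\<lambda>x. norm (T n (f x) - T n (h m x))) < e / 2" using m by simp
  show ?thesis
  proof (rule that[of "\<lambda>x. T n (h m x)"])
    show "continuous_on UNIV (\<lambda>x. T n (h m x))" by (rule cTh)
    show "bounded (range (\<lambda>x. T n (h m x)))" using Tbd by (intro boundedI[where B = "real n"]) auto
    have i1: "(\<lambda>x. norm (f x - T n (f x))) integrable_on {a..b}"
      using set_integral_diff(1)[OF f Tf[of n]] by (simp add: absolutely_integrable_on_def)
    have "integral {a..b} (\<lambda>x. norm (f x - T n (h m x)))
      \<le> integral {a..b} (\<lambda>x. norm (f x - T n (f x)) + norm (T n (f x) - T n (h m x)))"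
    proof (rule integral_le)
      show "(\<lambda>x. norm (f x - T n (h m x))) integrable_on {a..b}"
        using set_integral_diff(1)[OF f aTh[of m]] by (simp add: absolutely_integrable_on_def)
      show "norm (f x - T n (h m x)) \<le> norm (f x - T n (f x)) + norm (T n (f x) - T n (h m x))" for x
        using norm_triangle_ineq[of "f x - T n (f x)" "T n (f x) - T n (h m x)"] by simp
    qed (intro integrable_add i1 iTh)
    also have "\<dots> = integral {a..b} (\<lambda>x. norm (f x - T n (f x))) + integral {a..b} (\<lambda>x. norm (T n (f x) - T n (h m x)))"
      by (rule integral_add[OF i1 iTh])
    also have "\<dots> < e" using n m' by simp
    finally show "integral {a..b} (\<lambda>x. norm (f x - T n (h m x))) < e" .
  qed
qed

section \<open>Gronwall and Riemann-Lebesgue estimates\<close>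

lemma absolutely_integrable_initial:
  fixes f :: "real \<Rightarrow> 'a::euclidean_space"
  assumes "f absolutely_integrable_on {0..1}" "0 \<le> x" "x \<le> 1"
  shows "f absolutely_integrable_on {0..x}"
  by (rule absolutely_integrable_on_subinterval[OF assms(1)]) (use assms in auto)

text \<open>Integrating the majorant over all of [0,1] makes the bound uniform in x.\<close>

lemma norm_integral_le:
  fixes f :: "real \<Rightarrow> complex" and g :: "real \<Rightarrow> real"
  assumes "f integrable_on {0..x}" "g absolutely_integrable_on {0..1}" "0 \<le> x" "x \<le> 1"
    and le: "\<And>t. t \<in> {0..1} \<Longrightarrow> t \<le> x \<Longrightarrow> norm (f t) \<le> g t" and pos: "\<And>t. t \<in> {0..1} \<Longrightarrow> 0 \<le> g t"
  shows "norm (integral {0..x} f) \<le> integral {0..1} g"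
proof -
  have g: "g integrable_on {0..x}" "g integrable_on {0..1}"
    using absolutely_integrable_initial[OF assms(2-4)] assms(2) set_lebesgue_integral_eq_integral(1) by blast+
  have "norm (integral {0..x} f) \<le> integral {0..x} g"
    by (rule integral_norm_bound_integral[OF assms(1) g(1)]) (use assms(4) in \<open>auto intro: le\<close>)
  also have "\<dots> \<le> integral {0..1} g"
    by (rule integral_subset_le[OF _ g]) (use assms(4) pos in auto)
  finally show ?thesis .
qed

text \<open>Splitting the kernel into a bounded part and a part of small \<open>L\<^sup>1\<close> norm and using an exponentially
  weighted maximum avoids differentiating the indefinite integral of \<open>k\<close>.\<close>

lemma gronwall_L1:
  fixes k :: "real \<Rightarrow> real"
  assumes k: "k absolutely_integrable_on {0..1}" and k0: "\<And>t. 0 \<le> k t"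
  shows "\<exists>C>0. \<forall>w M. continuous_on {0..1} w \<longrightarrow> (\<forall>x\<in>{0..1}. 0 \<le> w x) \<longrightarrow>
    (\<forall>x\<in>{0..1}. w x \<le> M + integral {0..x} (\<lambda>t. k t * w t)) \<longrightarrow> (\<forall>x\<in>{0..1}. w x \<le> C * M)"
proof -
  obtain g where gc: "continuous_on UNIV g" and g2: "bounded (range g)"
    "integral {0..1} (\<lambda>x. norm (k x - g x)) < 1/4"
    using L1_approx_continuous[OF k, of "1/4"] by auto
  have "g absolutely_integrable_on {0..1}"
    by (intro absolutely_integrable_continuous_real continuous_on_subset[OF gc]) simp
  note g = this g2
  obtain N where N: "N > 0" "\<And>x. norm (g x) \<le> N" using g(2) by (auto simp: bounded_pos)
  define d where "d = (\<lambda>t. \<bar>k t - g t\<bar>)"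
  have d: "d absolutely_integrable_on {0..1}" unfolding d_def
    using absolutely_integrable_norm[OF set_integral_diff(1)[OF k g(1)]] by (simp add: o_def)
  have d4: "integral {0..1} d < 1/4" using g(3) by (simp add: d_def)
  \<comment> \<open>With this rate the bounded part of the kernel contributes at most S/4 exp
    (\<Lambda> m), and the part of L1 norm below 1/4 no more than that. Together they are half of
    the maximum and can be absorbed.\<close>
  define \<Lambda> where "\<Lambda> = 4 * N"
  have kd: "k t \<le> d t + N" for t using N(2)[of t] by (simp add: d_def)
  show ?thesis
  proof (rule exI[of _ "2 * exp \<Lambda>"], intro conjI allI impI ballI)
    fix w :: "real \<Rightarrow> real" and M x :: real
    assume w: "continuous_on {0..1} w" and w0: "\<forall>x\<in>{0..1}. 0 \<le> w x"
      and le: "\<forall>x\<in>{0..1}. w x \<le> M + integral {0..x} (\<lambda>t. k t * w t)" and x: "x \<in> {0..1}"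
    \<comment> \<open>The weighted function attains its maximum S at m; evaluating the integral
      inequality at m bounds S.\<close>
    have "continuous_on {0..1} (\<lambda>t. w t * exp (- \<Lambda> * t))" using w by (intro continuous_intros)
    then obtain m where m: "m \<in> {0..1}" "\<And>t. t \<in> {0..1} \<Longrightarrow> w t * exp (- \<Lambda> * t) \<le> w m * exp (- \<Lambda> * m)"
      using continuous_attains_sup[of "{0..1}" "\<lambda>t. w t * exp (- \<Lambda> * t)"] by auto
    define S where "S = w m * exp (- \<Lambda> * m)"
    have S0: "S \<ge> 0" using w0 m by (simp add: S_def)
    have wS: "w t \<le> S * exp (\<Lambda> * t)" if "t \<in> {0..1}" for t
    proof -
      have "w t = w t * exp (- \<Lambda> * t) * exp (\<Lambda> * t)" by (simp add: exp_minus)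
      also have "\<dots> \<le> S * exp (\<Lambda> * t)" using m(2)[OF that] by (intro mult_right_mono) (auto simp: S_def)
      finally show ?thesis .
    qed
    have int_exp: "((\<lambda>t. N * S * exp (\<Lambda> * t)) has_integral (S / 4 * exp (\<Lambda> * m) - S / 4 * exp (\<Lambda> * 0))) {0..m}"
    proof (rule fundamental_theorem_of_calculus)
      fix t assume "t \<in> {0..m}"
      have "((\<lambda>t. S / 4 * exp (\<Lambda> * t)) has_real_derivative N * S * exp (\<Lambda> * t)) (at t within {0..m})"
        by (auto intro!: derivative_eq_intros simp: \<Lambda>_def)
      then show "((\<lambda>t. S / 4 * exp (\<Lambda> * t)) has_vector_derivative N * S * exp (\<Lambda> * t)) (at t within {0..m})"
        by (simp add: has_real_derivative_iff_has_vector_derivative)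
    qed (use m in auto)
    have int_d: "d integrable_on {0..m}" 
      using absolutely_integrable_initial[OF d] m set_lebesgue_integral_eq_integral(1) by (metis atLeastAtMost_iff)
    have d01: "d integrable_on {0..1}" using d set_lebesgue_integral_eq_integral(1) by blast
    have int_dS: "(\<lambda>t. S * exp (\<Lambda> * m) * d t) integrable_on {0..m}"
      using integrable_on_cmult_left[OF int_d] by simp
    have dm: "integral {0..m} d \<le> 1/4"
      using integral_subset_le[OF _ int_d d01] d4 m by (force simp: d_def)
    have kw: "(\<lambda>t. k t * w t) absolutely_integrable_on {0..1}"
      by (rule absolutely_integrable_continuous_mult_real[OF w k])
    have int_kw: "(\<lambda>t. k t * w t) integrable_on {0..m}"
      using absolutely_integrable_initial[OF kw] m set_lebesgue_integral_eq_integral(1) by (metis atLeastAtMost_iff)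
    have "integral {0..m} (\<lambda>t. k t * w t) \<le> integral {0..m} (\<lambda>t. S * exp (\<Lambda> * m) * d t + N * S * exp (\<Lambda> * t))"
    proof (rule integral_le[OF int_kw])
      show "(\<lambda>t. S * exp (\<Lambda> * m) * d t + N * S * exp (\<Lambda> * t)) integrable_on {0..m}"
        using int_dS int_exp by (intro integrable_add) (auto simp: integrable_on_def)
      fix t assume t: "t \<in> {0..m}"
      then have t1: "t \<in> {0..1}" using m by auto
      have "k t * w t \<le> (d t + N) * (S * exp (\<Lambda> * t))"
        using kd[of t] wS[OF t1] k0[of t] w0 t1 by (intro mult_mono) (auto intro: order_trans)
      also have "\<dots> = d t * (S * exp (\<Lambda> * t)) + N * S * exp (\<Lambda> * t)" by (simp add: algebra_simps)
      also have "d t * (S * exp (\<Lambda> * t)) \<le> d t * (S * exp (\<Lambda> * m))"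
        using t S0 N(1) by (intro mult_left_mono) (auto simp: d_def \<Lambda>_def)
      finally show "k t * w t \<le> S * exp (\<Lambda> * m) * d t + N * S * exp (\<Lambda> * t)" by (simp add: mult_ac)
    qed
    also have "\<dots> = S * exp (\<Lambda> * m) * integral {0..m} d + (S / 4 * exp (\<Lambda> * m) - S / 4 * exp (\<Lambda> * 0))"
      using integral_add[OF int_dS has_integral_integrable[OF int_exp]] integral_unique[OF int_exp] by simp
    also have "\<dots> \<le> S * exp (\<Lambda> * m) * (1/4) + S / 4 * exp (\<Lambda> * m)"
      using dm S0 mult_left_mono[OF dm, of "S * exp (\<Lambda> * m)"] by simp
    finally have "integral {0..m} (\<lambda>t. k t * w t) \<le> S / 2 * exp (\<Lambda> * m)" by simp
    then have "w m \<le> M + S / 2 * exp (\<Lambda> * m)" using le m(1) by fastforce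
    then have "S \<le> (M + S / 2 * exp (\<Lambda> * m)) * exp (- \<Lambda> * m)"
      unfolding S_def by (rule mult_right_mono) simp
    also have "\<dots> = M * exp (- \<Lambda> * m) + S / 2" by (simp add: algebra_simps exp_minus)
    finally have S1: "S \<le> M * exp (- \<Lambda> * m) + S / 2" .
    have "w 0 \<le> M" using le[rule_format, of 0] by simp
    then have M0: "M \<ge> 0" using w0[rule_format, of 0] by simp
    have "M * exp (- \<Lambda> * m) \<le> M * 1" using M0 N m by (intro mult_left_mono) (auto simp: \<Lambda>_def)
    then have S2: "S \<le> 2 * M" using S1 by simp
    have "w x \<le> S * exp (\<Lambda> * x)" by (rule wS[OF x])
    also have "\<dots> \<le> (2 * M) * exp \<Lambda>" using S2 S0 M0 N x by (intro mult_mono) (auto simp: \<Lambda>_def)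
    finally show "w x \<le> 2 * exp \<Lambda> * M" by (simp add: mult_ac)
  qed simp
qed

text \<open>Replacing q by a polynomial costs \<epsilon> L; integration by parts then gains 1 /
  |\<sigma>|. K depends on q and \<epsilon> alone: v will be a component of a solution that varies
  with the spectral parameter, so only a sup bound L and an L1 bound L' for its derivative may
  enter.\<close>

lemma riemann_lebesgue:
  fixes q :: "real \<Rightarrow> complex"
  assumes q: "q absolutely_integrable_on {0..1}" and \<epsilon>: "\<epsilon> > 0"
  obtains K where "K \<ge> 0"
    and "\<And>\<sigma> \<tau> x v v' L L'. 0 \<le> x \<Longrightarrow> x \<le> 1 \<Longrightarrow> \<sigma> \<noteq> 0 \<Longrightarrow>
      (\<And>t. t \<in> {0..x} \<Longrightarrow> Re (\<sigma> * of_real t + \<tau>) \<le> 0) \<Longrightarrow>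
      ac_deriv v v' \<Longrightarrow> v' absolutely_integrable_on {0..1} \<Longrightarrow> integral {0..1} (\<lambda>t. norm (v' t)) \<le> L' \<Longrightarrow>
      (\<And>t. t \<in> {0..1} \<Longrightarrow> norm (v t) \<le> L) \<Longrightarrow>
      norm (integral {0..x} (\<lambda>t. q t * (exp (\<sigma> * of_real t + \<tau>) * v t))) \<le> \<epsilon> * L + K * (L + L') / norm \<sigma>"
proof -
  obtain g where g2: "continuous_on UNIV g" "integral {0..1} (\<lambda>x. norm (q x - g x)) < \<epsilon> / 2"
    using L1_approx_continuous[OF q, of "\<epsilon>/2"] \<epsilon> by auto
  have "g absolutely_integrable_on {0..1}"
    by (intro absolutely_integrable_continuous_real continuous_on_subset[OF g2(1)]) simp
  note g = this g2
  have "continuous_on {0..1} g" using g2(1) by (rule continuous_on_subset) simp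
  \<comment> \<open>A polynomial is taken because integration by parts differentiates the
    approximant.\<close>
  then obtain r where r: "polynomial_function r" "\<And>x. x \<in> {0..1} \<Longrightarrow> norm (g x - r x) < \<epsilon> / 2"
    using Stone_Weierstrass_polynomial_function[OF compact_Icc, of 0 1 g "\<epsilon>/2"] \<epsilon> by auto
  obtain r' where r': "polynomial_function r'" "\<And>x. (r has_vector_derivative r' x) (at x)"
    using has_vector_derivative_polynomial_function[OF r(1)] by blast
  have cr: "continuous_on {0..1} r" "continuous_on {0..1} r'"
    using r(1) r'(1) by (auto intro: continuous_on_polymonial_function)
  have acr: "ac_deriv r r'" using r'(2) cr(2) by (rule ac_deriv_smooth)
  obtain N1 where N1: "N1 > 0" "\<And>x. x \<in> {0..1} \<Longrightarrow> norm (r x) \<le> N1" using continuous_on_bounded_01[OF cr(1)] by blast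
  obtain N2 where N2: "N2 > 0" "\<And>x. x \<in> {0..1} \<Longrightarrow> norm (r' x) \<le> N2" using continuous_on_bounded_01[OF cr(2)] by blast
  define N where "N = max N1 N2"
  have N: "N > 0" "\<And>x. x \<in> {0..1} \<Longrightarrow> norm (r x) \<le> N" "\<And>x. x \<in> {0..1} \<Longrightarrow> norm (r' x) \<le> N"
    using N1 N2 by (fastforce simp: N_def)+
  have air: "r absolutely_integrable_on {0..1}"
    using cr(1) absolutely_integrable_continuous_real by blast
  have qr: "(\<lambda>t. q t - r t) absolutely_integrable_on {0..1}" by (rule set_integral_diff(1)[OF q air])
  have I: "integral {0..1} (\<lambda>t. norm (q t - r t)) \<le> \<epsilon>"
  proof -
    have i: "(\<lambda>t. norm (q t - g t)) integrable_on {0..1}" "(\<lambda>t. norm (q t - r t)) integrable_on {0..1}"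
      using set_integral_diff(1)[OF q g(1)] qr by (auto simp: absolutely_integrable_on_def)
    have "integral {0..1} (\<lambda>t. norm (q t - r t)) \<le> integral {0..1} (\<lambda>t. norm (q t - g t) + \<epsilon> / 2)"
    proof (rule integral_le[OF i(2)])
      show "(\<lambda>t. norm (q t - g t) + \<epsilon> / 2) integrable_on {0..1}" using i(1) by (intro integrable_add) auto
      fix t :: real assume t: "t \<in> {0..1}"
      have "norm (q t - r t) \<le> norm (q t - g t) + norm (g t - r t)"
        using norm_triangle_ineq[of "q t - g t" "g t - r t"] by simp
      then show "norm (q t - r t) \<le> norm (q t - g t) + \<epsilon> / 2" using r(2)[OF t] by simp
    qed
    also have "\<dots> = integral {0..1} (\<lambda>t. norm (q t - g t)) + \<epsilon> / 2"
      using i(1) by (subst integral_add) auto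
    finally show ?thesis using g(3) by simp
  qed
  show ?thesis
  \<comment> \<open>Two boundary terms and the r' part of \<open>F\<close> give 3 N L, the v' part
    of \<open>F\<close> gives N L'.\<close>
  proof (rule that[of "3 * N"])
    show "0 \<le> 3 * N" using N by simp
    fix \<sigma> \<tau> :: complex and x L L' :: real and v v' :: "real \<Rightarrow> complex"
    assume x: "0 \<le> x" "x \<le> 1" and \<sigma>: "\<sigma> \<noteq> 0" and re: "\<And>t. t \<in> {0..x} \<Longrightarrow> Re (\<sigma> * of_real t + \<tau>) \<le> 0"
      and v: "ac_deriv v v'" and v': "v' absolutely_integrable_on {0..1}"
      and L': "integral {0..1} (\<lambda>t. norm (v' t)) \<le> L'" and L: "\<And>t. t \<in> {0..1} \<Longrightarrow> norm (v t) \<le> L"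
    define E where "E = (\<lambda>t::real. exp (\<sigma> * of_real t + \<tau>))"
    have E1: "norm (E t) \<le> 1" if "0 \<le> t" "t \<le> x" for t using re that by (simp add: E_def norm_exp_eq_Re)
    have acE: "ac_deriv E (\<lambda>t. \<sigma> * E t)" unfolding E_def by (rule ac_deriv_exp)
    have cE: "continuous_on {0..1} E" by (rule ac_deriv_continuous[OF acE])
    have cv: "continuous_on {0..1} v" by (rule ac_deriv_continuous[OF v])
    have L0: "L \<ge> 0" using L[of 0] by (intro order_trans[OF norm_ge_zero]) auto
    have L'0: "L' \<ge> 0"
    proof -
      have "0 \<le> integral {0..1} (\<lambda>t. norm (v' t))" by (rule integral_nonneg) (use v' in \<open>auto simp: absolutely_integrable_on_def\<close>)
      then show ?thesis using L' by simp
    qed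
    have Ev: "norm (E t * v t) \<le> L" if "t \<in> {0..1}" "t \<le> x" for t
      using mult_mono[OF E1[of t] L[OF that(1)]] that by (simp add: norm_mult)
    define F where "F = (\<lambda>t. r' t * (E t * v t) + r t * (E t * v' t))"
    have aiF: "F absolutely_integrable_on {0..1}" unfolding F_def
    proof (rule set_integral_add(1))
      show "(\<lambda>t. r' t * (E t * v t)) absolutely_integrable_on {0..1}"
        using cr cE cv by (intro absolutely_integrable_continuous_real continuous_intros)
      have "(\<lambda>t. v' t * (r t * E t)) absolutely_integrable_on {0..1}"
        using cr cE v' by (intro absolutely_integrable_continuous_mult continuous_intros)
      then show "(\<lambda>t. r t * (E t * v' t)) absolutely_integrable_on {0..1}" by (simp add: mult_ac)
    qed
    have iF: "F integrable_on {0..x}"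
      using absolutely_integrable_initial[OF aiF x] set_lebesgue_integral_eq_integral(1) by blast
    \<comment> \<open>\<open>F\<close> collects the terms in which r or v is differentiated; the
      remaining term is \<sigma> times the wanted integrand.\<close>
    have "ac_deriv (\<lambda>t. r t * (E t * v t)) (\<lambda>t. \<sigma> * (r t * (E t * v t)) + F t)"
      by (rule ac_deriv_cong[OF ac_deriv_mult[OF acr ac_deriv_mult[OF acE v]]]) (auto simp: F_def algebra_simps)
    from ac_deriv_has_integral[OF this order_refl x]
    have hi: "((\<lambda>t. \<sigma> * (r t * (E t * v t)) + F t) has_integral r x * (E x * v x) - r 0 * (E 0 * v 0)) {0..x}" .
    from has_integral_diff[OF this integrable_integral[OF iF]]
    have "((\<lambda>t. \<sigma> * (r t * (E t * v t))) has_integral r x * (E x * v x) - r 0 * (E 0 * v 0) - integral {0..x} F) {0..x}"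
      by simp
    from has_integral_mult_right[OF this, of "1 / \<sigma>"]
    have "((\<lambda>t. r t * (E t * v t)) has_integral (r x * (E x * v x) - r 0 * (E 0 * v 0) - integral {0..x} F) / \<sigma>) {0..x}"
      using \<sigma> by simp
    then have eq: "integral {0..x} (\<lambda>t. r t * (E t * v t)) = (r x * (E x * v x) - r 0 * (E 0 * v 0) - integral {0..x} F) / \<sigma>"
      by (rule integral_unique)
    have nF: "norm (integral {0..x} F) \<le> integral {0..1} (\<lambda>t. N * L + N * norm (v' t))"
    proof (rule norm_integral_le[OF iF _ x])
      show "(\<lambda>t. N * L + N * norm (v' t)) absolutely_integrable_on {0..1}"
      proof (rule set_integral_add(1))
        show "(\<lambda>t::real. N * L) absolutely_integrable_on {0..1}"
          by (intro absolutely_integrable_continuous_real continuous_intros)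
        show "(\<lambda>t. N * norm (v' t)) absolutely_integrable_on {0..1}"
          using absolutely_integrable_norm[OF v'] by (intro set_integrable_mult_right) (simp add: o_def)
      qed
      fix t :: real assume t: "t \<in> {0..1}"
      show "0 \<le> N * L + N * norm (v' t)" using N L0 by (intro add_nonneg_nonneg mult_nonneg_nonneg) auto
      assume tx: "t \<le> x"
      have "norm (F t) \<le> norm (r' t) * norm (E t * v t) + norm (r t) * (norm (E t) * norm (v' t))"
        unfolding F_def by (metis norm_mult norm_triangle_ineq)
      also have "\<dots> \<le> N * L + N * (1 * norm (v' t))"
        using N(2,3)[OF t] Ev[OF t tx] E1[of t] t tx N(1) by (intro add_mono mult_mono) auto
      finally show "norm (F t) \<le> N * L + N * norm (v' t)" by simp
    qed
    also have "\<dots> = N * L + N * integral {0..1} (\<lambda>t. norm (v' t))"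
      using v' by (subst integral_add)
        (auto simp: absolutely_integrable_on_def intro!: integrable_on_mult_right)
    also have "\<dots> \<le> N * L + N * L'" using L' N by (intro add_left_mono mult_left_mono) auto
    finally have nF: "norm (integral {0..x} F) \<le> N * L + N * L'" .
    have bd: "norm (r t * (E t * v t)) \<le> N * L" if "t \<in> {0..1}" "t \<le> x" for t
      unfolding norm_mult[of "r t"] using N(2)[OF that(1)] Ev[OF that] N(1) by (intro mult_mono) auto
    have "norm (r x * (E x * v x) - r 0 * (E 0 * v 0) - integral {0..x} F) \<le> N * L + N * L + (N * L + N * L')"
    proof -
      have "norm (r x * (E x * v x)) \<le> N * L" "norm (r 0 * (E 0 * v 0)) \<le> N * L"
        using x by (auto intro!: bd)
      then show ?thesis using nF norm_triangle_ineq4[of "r x * (E x * v x) - r 0 * (E 0 * v 0)" "integral {0..x} F"]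
        norm_triangle_ineq4[of "r x * (E x * v x)" "r 0 * (E 0 * v 0)"] by linarith
    qed
    also have "\<dots> \<le> 3 * N * (L + L')" using N L0 L'0 by (simp add: algebra_simps)
    finally have A: "norm (integral {0..x} (\<lambda>t. r t * (E t * v t))) \<le> 3 * N * (L + L') / norm \<sigma>"
      unfolding eq norm_divide using \<sigma> by (intro divide_right_mono) auto
    have aid: "(\<lambda>t. (q t - r t) * (E t * v t)) absolutely_integrable_on {0..1}"
      using qr cE cv by (intro absolutely_integrable_continuous_mult continuous_intros)
    have air2: "(\<lambda>t. r t * (E t * v t)) absolutely_integrable_on {0..1}"
      using cr cE cv by (intro absolutely_integrable_continuous_real continuous_intros)
    have ii: "(\<lambda>t. (q t - r t) * (E t * v t)) integrable_on {0..x}" "(\<lambda>t. r t * (E t * v t)) integrable_on {0..x}"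
      using absolutely_integrable_initial[OF aid x] absolutely_integrable_initial[OF air2 x]
        set_lebesgue_integral_eq_integral(1) by blast+
    have "norm (integral {0..x} (\<lambda>t. (q t - r t) * (E t * v t))) \<le> integral {0..1} (\<lambda>t. norm (q t - r t) * L)"
    proof (rule norm_integral_le[OF ii(1) _ x])
      show "(\<lambda>t. norm (q t - r t) * L) absolutely_integrable_on {0..1}"
        using absolutely_integrable_norm[OF qr] by (intro set_integrable_mult_left) (simp add: o_def)
      fix t :: real assume t: "t \<in> {0..1}"
      show "0 \<le> norm (q t - r t) * L" using L0 by simp
      assume "t \<le> x"
      then show "norm ((q t - r t) * (E t * v t)) \<le> norm (q t - r t) * L"
        unfolding norm_mult[of "q t - r t"] using Ev[OF t] by (intro mult_left_mono) auto
    qed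
    also have "\<dots> = integral {0..1} (\<lambda>t. norm (q t - r t)) * L" by simp
    also have "\<dots> \<le> \<epsilon> * L" using I L0 by (rule mult_right_mono)
    finally have B: "norm (integral {0..x} (\<lambda>t. (q t - r t) * (E t * v t))) \<le> \<epsilon> * L" .
    have "(\<lambda>t. q t * (E t * v t)) = (\<lambda>t. (q t - r t) * (E t * v t) + r t * (E t * v t))" by (auto simp: algebra_simps)
    then have "integral {0..x} (\<lambda>t. q t * (E t * v t))
      = integral {0..x} (\<lambda>t. (q t - r t) * (E t * v t)) + integral {0..x} (\<lambda>t. r t * (E t * v t))"
      using integral_add[OF ii] by (simp only:)
    then have "norm (integral {0..x} (\<lambda>t. q t * (E t * v t))) \<le> \<epsilon> * L + 3 * N * (L + L') / norm \<sigma>"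
      using norm_triangle_mono[OF B A] by (simp only:)
    then show "norm (integral {0..x} (\<lambda>t. q t * (exp (\<sigma> * of_real t + \<tau>) * v t))) \<le> \<epsilon> * L + 3 * N * (L + L') / norm \<sigma>"
      by (simp add: E_def)
  qed
qed

subsection \<open>Asymptotics and analyticity of solutions\<close>

text \<open>Normal form of the Dirac system once both components are multiplied by exp (- i b1 \<mu>
  x): the first component loses its diagonal term, and s = i (b2 - b1) \<mu>.\<close>

definition diag_system :: "complex \<Rightarrow> (real \<Rightarrow> complex) \<Rightarrow> (real \<Rightarrow> complex) \<Rightarrow>
    (real \<Rightarrow> complex) \<Rightarrow> (real \<Rightarrow> complex) \<Rightarrow> bool" where
  "diag_system s p q v1 v2 \<longleftrightarrow>
    ac_deriv v1 (\<lambda>x. p x * v2 x) \<and> ac_deriv v2 (\<lambda>x. s * v2 x + q x * v1 x)"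

text \<open>Variation of constants: the factor exp (s (x - t)) removes the term s v2 from the
  derivative of the second component.\<close>

lemma diag_system_duhamel:
  assumes sys: "diag_system s p q v1 v2" and x: "0 \<le> x" "x \<le> 1"
  shows "((\<lambda>t. p t * v2 t) has_integral v1 x - v1 0) {0..x}"
    and "((\<lambda>t. q t * (exp (- s * of_real t + s * of_real x) * v1 t)) has_integral v2 x - exp (s * of_real x) * v2 0) {0..x}"
proof -
  have v: "ac_deriv v1 (\<lambda>x. p x * v2 x)" "ac_deriv v2 (\<lambda>x. s * v2 x + q x * v1 x)"
    using sys by (auto simp: diag_system_def)
  show "((\<lambda>t. p t * v2 t) has_integral v1 x - v1 0) {0..x}"
    by (rule ac_deriv_has_integral[OF v(1) order_refl x])
  have "ac_deriv (\<lambda>t. exp (- s * of_real t + s * of_real x) * v2 t) (\<lambda>t. q t * (exp (- s * of_real t + s * of_real x) * v1 t))"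
    by (rule ac_deriv_cong[OF ac_deriv_mult[OF ac_deriv_exp[of "- s" "s * of_real x"] v(2)]]) (auto simp: algebra_simps)
  from ac_deriv_has_integral[OF this order_refl x]
  show "((\<lambda>t. q t * (exp (- s * of_real t + s * of_real x) * v1 t)) has_integral v2 x - exp (s * of_real x) * v2 0) {0..x}"
    by simp
qed

text \<open>For Re s \<le> 0 the kernel exp (s (x - t)) has modulus at most 1 for t \<le> x, so
  Gronwall's inequality gives a constant independent of s.\<close>

lemma diag_system_bounded:
  assumes p: "p absolutely_integrable_on {0..1}" and q: "q absolutely_integrable_on {0..1}"
  shows "\<exists>C>0. \<forall>s v1 v2. Re s \<le> 0 \<longrightarrow> diag_system s p q v1 v2 \<longrightarrow>
    (\<forall>x\<in>{0..1}. norm (v1 x) + norm (v2 x) \<le> C * (norm (v1 0) + norm (v2 0)))"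
proof -
  define k where "k = (\<lambda>t. norm (p t) + norm (q t))"
  have k: "k absolutely_integrable_on {0..1}" unfolding k_def
    using absolutely_integrable_norm[OF p] absolutely_integrable_norm[OF q] by (intro set_integral_add(1)) (simp_all add: o_def)
  obtain C where C: "C > 0" "\<And>w M. continuous_on {0..1} w \<Longrightarrow> (\<forall>x\<in>{0..1}. 0 \<le> w x) \<Longrightarrow>
    (\<forall>x\<in>{0..1}. w x \<le> M + integral {0..x} (\<lambda>t. k t * w t)) \<Longrightarrow> (\<forall>x\<in>{0..1}. w x \<le> C * M)"
    using gronwall_L1[OF k] by (auto simp: k_def)
  have "\<forall>x\<in>{0..1}. norm (v1 x) + norm (v2 x) \<le> C * (norm (v1 0) + norm (v2 0))"
    if s: "Re s \<le> 0" and sys: "diag_system s p q v1 v2" for s v1 v2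
  proof (rule C(2))
    have cv: "continuous_on {0..1} v1" "continuous_on {0..1} v2"
      using sys ac_deriv_continuous by (auto simp: diag_system_def)
    show cw: "continuous_on {0..1} (\<lambda>x. norm (v1 x) + norm (v2 x))" using cv by (intro continuous_intros)
    show "\<forall>x\<in>{0..1}. norm (v1 x) + norm (v2 x)
      \<le> norm (v1 0) + norm (v2 0) + integral {0..x} (\<lambda>t. k t * (norm (v1 t) + norm (v2 t)))"
    proof
      fix x :: real assume x01: "x \<in> {0..1}"
      then have x: "0 \<le> x" "x \<le> 1" by auto
      note D = diag_system_duhamel[OF sys x]
      have E: "norm (exp (- s * of_real t + s * of_real x)) \<le> 1" if "t \<le> x" for t
      proof -
        have "Re (- s * of_real t + s * of_real x) = Re s * (x - t)" by (simp add: algebra_simps)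
        also have "\<dots> \<le> 0" using s that by (simp add: mult_nonpos_nonneg)
        finally show ?thesis by (simp add: norm_exp_eq_Re)
      qed
      have ip: "(\<lambda>t. p t * v2 t) absolutely_integrable_on {0..x}"
        using absolutely_integrable_initial[OF absolutely_integrable_continuous_mult[OF cv(2) p] x] .
      have iq: "(\<lambda>t. q t * v1 t) absolutely_integrable_on {0..x}"
        using absolutely_integrable_initial[OF absolutely_integrable_continuous_mult[OF cv(1) q] x] .
      have i: "(\<lambda>t. norm (p t * v2 t)) integrable_on {0..x}" "(\<lambda>t. norm (q t * v1 t)) integrable_on {0..x}"
        using ip iq by (auto simp: absolutely_integrable_on_def)
      have 1: "norm (v1 x - v1 0) \<le> integral {0..x} (\<lambda>t. norm (p t * v2 t))"
        using integral_norm_bound_integral[OF has_integral_integrable[OF D(1)] i(1)] integral_unique[OF D(1)] by auto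
      have 2: "norm (v2 x - exp (s * of_real x) * v2 0) \<le> integral {0..x} (\<lambda>t. norm (q t * v1 t))"
      proof -
        have "norm (integral {0..x} (\<lambda>t. q t * (exp (- s * of_real t + s * of_real x) * v1 t)))
           \<le> integral {0..x} (\<lambda>t. norm (q t * v1 t))"
        proof (rule integral_norm_bound_integral[OF has_integral_integrable[OF D(2)] i(2)])
          fix t assume t: "t \<in> {0..x}"
          have "norm (q t * (exp (- s * of_real t + s * of_real x) * v1 t))
            = norm (exp (- s * of_real t + s * of_real x)) * norm (q t * v1 t)" by (simp add: norm_mult)
          also have "\<dots> \<le> 1 * norm (q t * v1 t)" using E[of t] t by (intro mult_right_mono) auto
          finally show "norm (q t * (exp (- s * of_real t + s * of_real x) * v1 t)) \<le> norm (q t * v1 t)" by simp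
        qed
        then show ?thesis using integral_unique[OF D(2)] by simp
      qed
      have e0: "norm (exp (s * of_real x) * v2 0) \<le> norm (v2 0)"
        using E[of 0] x mult_right_mono[of "norm (exp (s * of_real x))" 1 "norm (v2 0)"] by (simp add: norm_mult)
      have "norm (v1 x) + norm (v2 x) \<le> norm (v1 0) + norm (v2 0)
        + (integral {0..x} (\<lambda>t. norm (p t * v2 t)) + integral {0..x} (\<lambda>t. norm (q t * v1 t)))"
        using 1 2 e0 norm_triangle_sub[of "v1 x" "v1 0"] norm_triangle_sub[of "v2 x" "exp (s * of_real x) * v2 0"] by linarith
      also have "integral {0..x} (\<lambda>t. norm (p t * v2 t)) + integral {0..x} (\<lambda>t. norm (q t * v1 t))
        = integral {0..x} (\<lambda>t. norm (p t * v2 t) + norm (q t * v1 t))" using i by (simp add: integral_add)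
      also have "\<dots> \<le> integral {0..x} (\<lambda>t. k t * (norm (v1 t) + norm (v2 t)))"
      proof (rule integral_le)
        show "(\<lambda>t. norm (p t * v2 t) + norm (q t * v1 t)) integrable_on {0..x}" using i by (rule integrable_add)
        show "(\<lambda>t. k t * (norm (v1 t) + norm (v2 t))) integrable_on {0..x}"
          using absolutely_integrable_initial[OF absolutely_integrable_continuous_mult_real[OF cw k] x]
            set_lebesgue_integral_eq_integral(1) by blast
        fix t
        show "norm (p t * v2 t) + norm (q t * v1 t) \<le> k t * (norm (v1 t) + norm (v2 t))"
          by (simp add: k_def norm_mult algebra_simps)
      qed
      finally show "norm (v1 x) + norm (v2 x)
        \<le> norm (v1 0) + norm (v2 0) + integral {0..x} (\<lambda>t. k t * (norm (v1 t) + norm (v2 t)))" by simp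
    qed
  qed auto
  then show ?thesis using C(1) by blast
qed

text \<open>The second component has to come before the first: the Riemann-Lebesgue estimate applies
  to its Duhamel integral, since v1 has the derivative p v2 of bounded L1 norm. Then v1 - v1(0) is
  the integral of p v2, where v2 may be replaced by exp (s t) v2(0) up to a small error, and the
  estimate applies again with a constant v.\<close>

lemma diag_system_asymptotic:
  assumes p: "p absolutely_integrable_on {0..1}" and q: "q absolutely_integrable_on {0..1}" and \<epsilon>: "\<epsilon> > 0"
  shows "\<exists>R>0. \<forall>s v1 v2. Re s \<le> 0 \<longrightarrow> R \<le> norm s \<longrightarrow> diag_system s p q v1 v2 \<longrightarrow>
    (\<forall>x\<in>{0..1}. norm (v1 x - v1 0) \<le> \<epsilon> * (norm (v1 0) + norm (v2 0)) \<and>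
      norm (v2 x - exp (s * of_real x) * v2 0) \<le> \<epsilon> * (norm (v1 0) + norm (v2 0)))"
proof -
  define P where "P = integral {0..1} (\<lambda>t. norm (p t))"
  have P: "P \<ge> 0" unfolding P_def by (rule integral_nonneg) (use p in \<open>auto simp: absolutely_integrable_on_def\<close>)
  obtain C where C: "C > 0" "\<And>s v1 v2 x. Re s \<le> 0 \<Longrightarrow> diag_system s p q v1 v2 \<Longrightarrow> x \<in> {0..1} \<Longrightarrow>
    norm (v1 x) + norm (v2 x) \<le> C * (norm (v1 0) + norm (v2 0))"
    using diag_system_bounded[OF p q] by meson
  \<comment> \<open>The error of v2 is multiplied by the L1 norm P of p when it enters v1; the + 1
    covers P = 0.\<close>
  define e1 where "e1 = \<epsilon> / (2 * (P + 1))"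
  have e1: "e1 > 0" "e1 \<le> \<epsilon>" "e1 * P \<le> \<epsilon> / 2"
    using \<epsilon> P by (auto simp: e1_def field_simps)
  have "e1 / (2 * C) > 0" using e1 C by simp
  then obtain K1 where K1: "K1 \<ge> 0"
    "\<And>\<sigma> \<tau> x v v' L L'. 0 \<le> x \<Longrightarrow> x \<le> 1 \<Longrightarrow> \<sigma> \<noteq> 0 \<Longrightarrow>
      (\<And>t. t \<in> {0..x} \<Longrightarrow> Re (\<sigma> * of_real t + \<tau>) \<le> 0) \<Longrightarrow>
      ac_deriv v v' \<Longrightarrow> v' absolutely_integrable_on {0..1} \<Longrightarrow> integral {0..1} (\<lambda>t. norm (v' t)) \<le> L' \<Longrightarrow>
      (\<And>t. t \<in> {0..1} \<Longrightarrow> norm (v t) \<le> L) \<Longrightarrow>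
      norm (integral {0..x} (\<lambda>t. q t * (exp (\<sigma> * of_real t + \<tau>) * v t))) \<le> e1 / (2 * C) * L + K1 * (L + L') / norm \<sigma>"
  proof (rule riemann_lebesgue[OF q], goal_cases)
    case (1 K)
    show ?case using 1(2,3) by (rule 1(1))
  qed
  have "\<epsilon> / 4 > 0" using \<epsilon> by simp
  then obtain K2 where K2: "K2 \<ge> 0"
    "\<And>\<sigma> \<tau> x v v' L L'. 0 \<le> x \<Longrightarrow> x \<le> 1 \<Longrightarrow> \<sigma> \<noteq> 0 \<Longrightarrow>
      (\<And>t. t \<in> {0..x} \<Longrightarrow> Re (\<sigma> * of_real t + \<tau>) \<le> 0) \<Longrightarrow>
      ac_deriv v v' \<Longrightarrow> v' absolutely_integrable_on {0..1} \<Longrightarrow> integral {0..1} (\<lambda>t. norm (v' t)) \<le> L' \<Longrightarrow>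
      (\<And>t. t \<in> {0..1} \<Longrightarrow> norm (v t) \<le> L) \<Longrightarrow>
      norm (integral {0..x} (\<lambda>t. p t * (exp (\<sigma> * of_real t + \<tau>) * v t))) \<le> \<epsilon> / 4 * L + K2 * (L + L') / norm \<sigma>"
  proof (rule riemann_lebesgue[OF p], goal_cases)
    case (1 K)
    show ?case using 1(2,3) by (rule 1(1))
  qed
  \<comment> \<open>The two quotients make the \<open>K1\<close> term at most e1/2 and the
    \<open>K2\<close> term at most \<epsilon>/4, both relative to m; the 1 makes R positive and s
    nonzero.\<close>
  define R where "R = max (2 * K1 * (C + C * P) / e1) (4 * K2 / \<epsilon>) + 1"
  have R: "R > 0" "2 * K1 * (C + C * P) / e1 \<le> R" "4 * K2 / \<epsilon> \<le> R"
  proof -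
    have "4 * K2 / \<epsilon> \<ge> 0" using K2 \<epsilon> by simp
    then show "R > 0" "2 * K1 * (C + C * P) / e1 \<le> R" "4 * K2 / \<epsilon> \<le> R" by (auto simp: R_def)
  qed
  have "norm (v1 x - v1 0) \<le> \<epsilon> * (norm (v1 0) + norm (v2 0)) \<and>
      norm (v2 x - exp (s * of_real x) * v2 0) \<le> \<epsilon> * (norm (v1 0) + norm (v2 0))"
    if s: "Re s \<le> 0" and sR: "R \<le> norm s" and sys: "diag_system s p q v1 v2" and x01: "x \<in> {0..1}" for s v1 v2 x
  proof -
    define m where "m = norm (v1 0) + norm (v2 0)"
    have m: "m \<ge> 0" "norm (v2 0) \<le> m" by (auto simp: m_def)
    have x: "0 \<le> x" "x \<le> 1" using x01 by auto
    have s0: "norm s > 0" "s \<noteq> 0" using sR R(1) by auto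
    have v: "ac_deriv v1 (\<lambda>x. p x * v2 x)" "ac_deriv v2 (\<lambda>x. s * v2 x + q x * v1 x)"
      using sys by (auto simp: diag_system_def)
    have cv: "continuous_on {0..1} v1" "continuous_on {0..1} v2"
      using v ac_deriv_continuous by auto
    have bd: "norm (v1 t) \<le> C * m" "norm (v2 t) \<le> C * m" if "t \<in> {0..1}" for t
      using C(2)[OF s sys that] norm_ge_zero[of "v1 t"] norm_ge_zero[of "v2 t"] unfolding m_def by linarith+
    have ipv: "(\<lambda>t. p t * v2 t) absolutely_integrable_on {0..1}"
      by (rule absolutely_integrable_continuous_mult[OF cv(2) p])
    have inp: "(\<lambda>t. norm (p t)) integrable_on {0..1}" using p by (simp add: absolutely_integrable_on_def)
    have Lp: "integral {0..1} (\<lambda>t. norm (p t * v2 t)) \<le> C * P * m"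
    proof -
      have "integral {0..1} (\<lambda>t. norm (p t * v2 t)) \<le> integral {0..1} (\<lambda>t. norm (p t) * (C * m))"
        using ipv inp bd(2) by (intro integral_le integrable_on_mult_left)
          (auto simp: absolutely_integrable_on_def norm_mult intro!: mult_left_mono)
      then show ?thesis by (simp add: P_def mult_ac)
    qed
    have V2: "norm (v2 y - exp (s * of_real y) * v2 0) \<le> e1 * m" if y: "y \<in> {0..1}" for y
    proof -
      have y': "0 \<le> y" "y \<le> 1" using y by auto
      have "norm (integral {0..y} (\<lambda>t. q t * (exp (- s * of_real t + s * of_real y) * v1 t)))
        \<le> e1 / (2 * C) * (C * m) + K1 * (C * m + C * P * m) / norm (- s)"
      proof (rule K1(2)[OF y' _ _ v(1) ipv Lp])
        show "- s \<noteq> 0" using s0 by simp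
        show "Re (- s * of_real t + s * of_real y) \<le> 0" if "t \<in> {0..y}" for t
        proof -
          have "Re s * (y - t) \<le> 0" using s that by (simp add: mult_nonpos_nonneg)
          then show ?thesis by (simp add: algebra_simps)
        qed
      qed (rule bd(1))
      also have "e1 / (2 * C) * (C * m) = e1 / 2 * m" using C by simp
      also have "K1 * (C * m + C * P * m) / norm (- s) \<le> e1 / 2 * m"
      proof -
        have "2 * K1 * (C + C * P) / e1 \<le> norm s" using R(2) sR by linarith
        then have "2 * K1 * (C + C * P) \<le> e1 * norm s" using e1 by (simp add: field_simps)
        then have "2 * K1 * (C + C * P) * m \<le> e1 * norm s * m" using m by (intro mult_right_mono) auto
        then show ?thesis using s0 by (simp add: field_simps)
      qed
      finally show ?thesis using integral_unique[OF diag_system_duhamel(2)[OF sys y']] by simp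
    qed
    have A: "norm (v2 x - exp (s * of_real x) * v2 0) \<le> \<epsilon> * m"
      using V2[OF x01] mult_right_mono[OF e1(2) m(1)] by linarith
    define g where "g = (\<lambda>t::real. v2 t - exp (s * of_real t + 0) * v2 0)"
    have aig: "(\<lambda>t. p t * g t) absolutely_integrable_on {0..1}" unfolding g_def
      using cv p by (intro absolutely_integrable_continuous_mult continuous_intros)
    have aie: "(\<lambda>t. p t * (exp (s * of_real t + 0) * v2 0)) absolutely_integrable_on {0..1}"
      using p by (intro absolutely_integrable_continuous_mult continuous_intros)
    have ii: "(\<lambda>t. p t * g t) integrable_on {0..x}" "(\<lambda>t. p t * (exp (s * of_real t + 0) * v2 0)) integrable_on {0..x}"
      using absolutely_integrable_initial[OF aig x] absolutely_integrable_initial[OF aie x]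
        set_lebesgue_integral_eq_integral(1) by blast+
    have "norm (integral {0..x} (\<lambda>t. p t * g t)) \<le> integral {0..1} (\<lambda>t. norm (p t) * (e1 * m))"
    proof (rule norm_integral_le[OF ii(1) _ x])
      show "(\<lambda>t. norm (p t) * (e1 * m)) absolutely_integrable_on {0..1}"
        using absolutely_integrable_norm[OF p] by (intro set_integrable_mult_left) (simp add: o_def)
      fix t :: real assume t: "t \<in> {0..1}"
      show "0 \<le> norm (p t) * (e1 * m)" using e1 m by simp
      show "norm (p t * g t) \<le> norm (p t) * (e1 * m)" 
        unfolding norm_mult using V2[OF t] by (intro mult_left_mono) (auto simp: g_def)
    qed
    also have "\<dots> = e1 * P * m" by (simp add: P_def mult_ac)
    also have "\<dots> \<le> \<epsilon> / 2 * m" using e1(3) m(1) by (rule mult_right_mono)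
    finally have B1: "norm (integral {0..x} (\<lambda>t. p t * g t)) \<le> \<epsilon> / 2 * m" .
    have "norm (integral {0..x} (\<lambda>t. p t * (exp (s * of_real t + 0) * v2 0))) \<le> \<epsilon> / 4 * m + K2 * (m + 0) / norm s"
    proof (rule K2(2)[OF x s0(2) _ ac_deriv_const])
      show "Re (s * of_real t + 0) \<le> 0" if "t \<in> {0..x}" for t
        using s that by (simp add: mult_nonpos_nonneg)
    qed (use m in auto)
    also have "K2 * (m + 0) / norm s \<le> \<epsilon> / 4 * m"
    proof -
      have "4 * K2 / \<epsilon> \<le> norm s" using R(3) sR by linarith
      then have "4 * K2 \<le> \<epsilon> * norm s" using \<epsilon> by (simp add: field_simps)
      then have "4 * K2 * m \<le> \<epsilon> * norm s * m" using m by (intro mult_right_mono) auto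
      then show ?thesis using s0 by (simp add: field_simps)
    qed
    finally have B2: "norm (integral {0..x} (\<lambda>t. p t * (exp (s * of_real t + 0) * v2 0))) \<le> \<epsilon> / 4 * m + \<epsilon> / 4 * m" by simp
    have "(\<lambda>t. p t * v2 t) = (\<lambda>t. p t * g t + p t * (exp (s * of_real t + 0) * v2 0))"
      by (auto simp: g_def algebra_simps)
    then have "v1 x - v1 0 = integral {0..x} (\<lambda>t. p t * g t) + integral {0..x} (\<lambda>t. p t * (exp (s * of_real t + 0) * v2 0))"
      using integral_unique[OF diag_system_duhamel(1)[OF sys x]] integral_add[OF ii] by simp
    then have "norm (v1 x - v1 0) \<le> \<epsilon> / 2 * m + (\<epsilon> / 4 * m + \<epsilon> / 4 * m)"
      using norm_triangle_mono[OF B1 B2] by (simp only:)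
    then show ?thesis using A by (simp add: m_def)
  qed
  then show ?thesis using R(1) by blast
qed

section \<open>The Dirac system for large spectral parameter\<close>

definition dirac_system :: "real \<Rightarrow> real \<Rightarrow> (real \<Rightarrow> complex) \<Rightarrow> (real \<Rightarrow> complex) \<Rightarrow> complex \<Rightarrow>
    (real \<Rightarrow> complex) \<Rightarrow> (real \<Rightarrow> complex) \<Rightarrow> bool" where
  "dirac_system b1 b2 q1 q2 \<mu> y1 y2 \<longleftrightarrow>
    ac_deriv y1 (\<lambda>x. \<i> * of_real b1 * (\<mu> * y1 x - q1 x * y2 x)) \<and>
    ac_deriv y2 (\<lambda>x. \<i> * of_real b2 * (\<mu> * y2 x - q2 x * y1 x))"

text \<open>Exchanging the components also exchanges b1 and b2, which reverses the sign of (b2 - b1)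
  Im \<mu> and reduces one half-plane to the other.\<close>

lemma dirac_system_swap:
  "dirac_system b1 b2 q1 q2 \<mu> y1 y2 \<Longrightarrow> dirac_system b2 b1 q2 q1 \<mu> y2 y1"
  by (simp add: dirac_system_def)

lemma dirac_system_imp_diag_system:
  assumes "dirac_system b1 b2 q1 q2 \<mu> y1 y2"
  shows "diag_system (\<i> * of_real (b2 - b1) * \<mu>) (\<lambda>x. - \<i> * of_real b1 * q1 x) (\<lambda>x. - \<i> * of_real b2 * q2 x)
    (\<lambda>x. exp (- \<i> * of_real b1 * \<mu> * of_real x + 0) * y1 x) (\<lambda>x. exp (- \<i> * of_real b1 * \<mu> * of_real x + 0) * y2 x)"
proof -
  have y: "ac_deriv y1 (\<lambda>x. \<i> * of_real b1 * (\<mu> * y1 x - q1 x * y2 x))"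
    "ac_deriv y2 (\<lambda>x. \<i> * of_real b2 * (\<mu> * y2 x - q2 x * y1 x))"
    using assms by (auto simp: dirac_system_def)
  show ?thesis unfolding diag_system_def
    by (intro conjI ac_deriv_cong[OF ac_deriv_mult[OF ac_deriv_exp[of "- \<i> * of_real b1 * \<mu>" 0] y(1)]]
        ac_deriv_cong[OF ac_deriv_mult[OF ac_deriv_exp[of "- \<i> * of_real b1 * \<mu>" 0] y(2)]])
      (simp_all add: algebra_simps)
qed

text \<open>In this half-plane Re s = - (b2 - b1) Im \<mu> \<le> 0, and undoing the normalization
  multiplies the errors by |exp (i b1 \<mu>)|. Assuming b1 \<noteq> b2 rather than an order lets the
  estimate apply to the exchanged system.\<close>

lemma dirac_system_asymptotic_half_plane:
  assumes q: "q1 absolutely_integrable_on {0..1}" "q2 absolutely_integrable_on {0..1}" and \<epsilon>: "\<epsilon> > 0" and b: "b1 \<noteq> b2"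
  obtains R where "R > 0"
    "\<And>\<mu> y1 y2. 0 \<le> (b2 - b1) * Im \<mu> \<Longrightarrow> R \<le> norm \<mu> \<Longrightarrow> dirac_system b1 b2 q1 q2 \<mu> y1 y2 \<Longrightarrow>
      norm (y1 1 - exp (\<i> * of_real b1 * \<mu>) * y1 0) \<le> \<epsilon> * exp (- b1 * Im \<mu>) * (norm (y1 0) + norm (y2 0)) \<and>
      norm (y2 1 - exp (\<i> * of_real b2 * \<mu>) * y2 0) \<le> \<epsilon> * exp (- b1 * Im \<mu>) * (norm (y1 0) + norm (y2 0))"
proof -
  have pq: "(\<lambda>x. - \<i> * of_real b1 * q1 x) absolutely_integrable_on {0..1}"
    "(\<lambda>x. - \<i> * of_real b2 * q2 x) absolutely_integrable_on {0..1}"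
    using q by (intro set_integrable_mult_right; simp)+
  obtain R where R: "R > 0" "\<And>s v1 v2 x. Re s \<le> 0 \<Longrightarrow> R \<le> norm s \<Longrightarrow>
      diag_system s (\<lambda>x. - \<i> * of_real b1 * q1 x) (\<lambda>x. - \<i> * of_real b2 * q2 x) v1 v2 \<Longrightarrow> x \<in> {0..1} \<Longrightarrow>
      norm (v1 x - v1 0) \<le> \<epsilon> * (norm (v1 0) + norm (v2 0)) \<and>
      norm (v2 x - exp (s * of_real x) * v2 0) \<le> \<epsilon> * (norm (v1 0) + norm (v2 0))"
    using diag_system_asymptotic[OF pq \<epsilon>] by meson
  show ?thesis
  \<comment> \<open>The threshold for s becomes one for \<mu> through |s| = |b2 - b1|
    |\<mu>|.\<close>
  proof (rule that[of "R / \<bar>b2 - b1\<bar>"])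
    show "R / \<bar>b2 - b1\<bar> > 0" using R(1) b by simp
    fix \<mu> y1 y2
    assume im: "0 \<le> (b2 - b1) * Im \<mu>" and \<mu>: "R / \<bar>b2 - b1\<bar> \<le> norm \<mu>" and sys: "dirac_system b1 b2 q1 q2 \<mu> y1 y2"
    define s where "s = \<i> * of_real (b2 - b1) * \<mu>"
    define E where "E = exp (\<i> * of_real b1 * \<mu>)"
    have s1: "Re s \<le> 0" using im by (simp add: s_def algebra_simps)
    have "norm s = \<bar>b2 - b1\<bar> * norm \<mu>" unfolding s_def norm_mult norm_of_real by simp
    then have s2: "R \<le> norm s" using \<mu> b by (simp add: field_simps)
    have e: "exp (- \<i> * of_real b1 * \<mu>) = 1 / E" by (simp add: E_def exp_minus inverse_eq_divide)
    have E0: "E \<noteq> 0" by (simp add: E_def)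
    have es: "exp s = exp (\<i> * of_real b2 * \<mu>) / E" 
      by (simp add: s_def E_def exp_diff[symmetric] algebra_simps)
    have "norm (y1 1 / E - y1 0) \<le> \<epsilon> * (norm (y1 0) + norm (y2 0)) \<and>
      norm (y2 1 / E - exp s * y2 0) \<le> \<epsilon> * (norm (y1 0) + norm (y2 0))"
      using R(2)[OF s1 s2 dirac_system_imp_diag_system[OF sys, folded s_def], of 1] e by simp
    then have "norm E * norm (y1 1 / E - y1 0) \<le> norm E * (\<epsilon> * (norm (y1 0) + norm (y2 0)))"
      "norm E * norm (y2 1 / E - exp s * y2 0) \<le> norm E * (\<epsilon> * (norm (y1 0) + norm (y2 0)))"
      by (auto intro: mult_left_mono)
    moreover have "norm E * norm (y1 1 / E - y1 0) = norm (y1 1 - E * y1 0)"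
      using E0 by (simp add: norm_mult[symmetric] algebra_simps)
    moreover have "norm E * norm (y2 1 / E - exp s * y2 0) = norm (y2 1 - exp (\<i> * of_real b2 * \<mu>) * y2 0)"
      unfolding es using E0 by (simp add: norm_mult[symmetric] algebra_simps)
    moreover have "norm E * (\<epsilon> * (norm (y1 0) + norm (y2 0))) = \<epsilon> * exp (- b1 * Im \<mu>) * (norm (y1 0) + norm (y2 0))"
      unfolding E_def norm_exp_ib by (simp only: mult_ac)
    ultimately show "norm (y1 1 - exp (\<i> * of_real b1 * \<mu>) * y1 0) \<le> \<epsilon> * exp (- b1 * Im \<mu>) * (norm (y1 0) + norm (y2 0)) \<and>
      norm (y2 1 - exp (\<i> * of_real b2 * \<mu>) * y2 0) \<le> \<epsilon> * exp (- b1 * Im \<mu>) * (norm (y1 0) + norm (y2 0))"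
      unfolding E_def[symmetric] by (simp only:)
  qed
qed

text \<open>Each half-plane is normalized by its own larger exponential, that of b1 above and that
  of b2 below; either is at most the weight.\<close>

lemma dirac_system_asymptotic:
  assumes q: "q1 absolutely_integrable_on {0..1}" "q2 absolutely_integrable_on {0..1}" and \<epsilon>: "\<epsilon> > 0" and b: "b1 < b2"
  obtains R where "R > 0"
    "\<And>\<mu> y1 y2. R \<le> norm \<mu> \<Longrightarrow> dirac_system b1 b2 q1 q2 \<mu> y1 y2 \<Longrightarrow> norm (y1 0) + norm (y2 0) = 1 \<Longrightarrow>
      norm (y1 1 - exp (\<i> * of_real b1 * \<mu>) * y1 0) \<le> \<epsilon> * exp_weight b1 b2 \<mu> \<and>
      norm (y2 1 - exp (\<i> * of_real b2 * \<mu>) * y2 0) \<le> \<epsilon> * exp_weight b1 b2 \<mu>"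
proof -
  have ne: "b1 \<noteq> b2" "b2 \<noteq> b1" using b by auto
  obtain R1 where R1: "R1 > 0" 
    "\<And>\<mu> y1 y2. 0 \<le> (b2 - b1) * Im \<mu> \<Longrightarrow> R1 \<le> norm \<mu> \<Longrightarrow> dirac_system b1 b2 q1 q2 \<mu> y1 y2 \<Longrightarrow>
      norm (y1 1 - exp (\<i> * of_real b1 * \<mu>) * y1 0) \<le> \<epsilon> * exp (- b1 * Im \<mu>) * (norm (y1 0) + norm (y2 0)) \<and>
      norm (y2 1 - exp (\<i> * of_real b2 * \<mu>) * y2 0) \<le> \<epsilon> * exp (- b1 * Im \<mu>) * (norm (y1 0) + norm (y2 0))"
    using dirac_system_asymptotic_half_plane[OF q \<epsilon> ne(1)] by metis
  obtain R2 where R2: "R2 > 0" 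
    "\<And>\<mu> y1 y2. 0 \<le> (b1 - b2) * Im \<mu> \<Longrightarrow> R2 \<le> norm \<mu> \<Longrightarrow> dirac_system b2 b1 q2 q1 \<mu> y1 y2 \<Longrightarrow>
      norm (y1 1 - exp (\<i> * of_real b2 * \<mu>) * y1 0) \<le> \<epsilon> * exp (- b2 * Im \<mu>) * (norm (y1 0) + norm (y2 0)) \<and>
      norm (y2 1 - exp (\<i> * of_real b1 * \<mu>) * y2 0) \<le> \<epsilon> * exp (- b2 * Im \<mu>) * (norm (y1 0) + norm (y2 0))"
    using dirac_system_asymptotic_half_plane[OF q(2,1) \<epsilon> ne(2)] by metis
  show ?thesis
  proof (rule that[of "max R1 R2"])
    show "max R1 R2 > 0" using R1(1) by simp
    fix \<mu> y1 y2
    assume \<mu>: "max R1 R2 \<le> norm \<mu>" and sys: "dirac_system b1 b2 q1 q2 \<mu> y1 y2" and m: "norm (y1 0) + norm (y2 0) = 1"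
    have m': "norm (y2 0) + norm (y1 0) = 1" using m by simp
    have w: "\<epsilon> * exp (- b1 * Im \<mu>) \<le> \<epsilon> * exp_weight b1 b2 \<mu>" "\<epsilon> * exp (- b2 * Im \<mu>) \<le> \<epsilon> * exp_weight b1 b2 \<mu>"
      using \<epsilon> by (auto simp: exp_weight_def)
    show "norm (y1 1 - exp (\<i> * of_real b1 * \<mu>) * y1 0) \<le> \<epsilon> * exp_weight b1 b2 \<mu> \<and>
      norm (y2 1 - exp (\<i> * of_real b2 * \<mu>) * y2 0) \<le> \<epsilon> * exp_weight b1 b2 \<mu>"
    proof (cases "Im \<mu> \<ge> 0")
      case True
      then have "0 \<le> (b2 - b1) * Im \<mu>" using b by simp
      from R1(2)[OF this _ sys] \<mu> show ?thesis using w(1) unfolding m by auto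
    next
      case False
      then have "0 \<le> (b1 - b2) * Im \<mu>" using b by (simp add: mult_nonpos_nonpos)
      from R2(2)[OF this _ dirac_system_swap[OF sys]] \<mu> show ?thesis using w(2) unfolding m' by auto
    qed
  qed
qed

section \<open>Dependence of solutions on the spectral parameter\<close>

text \<open>Each component grows by at most the integral of the full right-hand side, so adding both
  doubles the kernel and gives 2 A. The constant A is the inhomogeneity that arises for differences
  of solutions.\<close>

lemma ac_deriv_gronwall:
  fixes k :: "real \<Rightarrow> real"
  assumes k: "k absolutely_integrable_on {0..1}" and k0: "\<And>t. 0 \<le> k t"
  obtains C where "C > 0" "\<And>f1 f1' f2 f2' A x. 0 \<le> A \<Longrightarrow> ac_deriv f1 f1' \<Longrightarrow> ac_deriv f2 f2' \<Longrightarrow>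
    (\<And>t. t \<in> {0..1} \<Longrightarrow> norm (f1' t) + norm (f2' t) \<le> k t * (norm (f1 t) + norm (f2 t)) + A) \<Longrightarrow>
    x \<in> {0..1} \<Longrightarrow> norm (f1 x) + norm (f2 x) \<le> C * (norm (f1 0) + norm (f2 0) + 2 * A)"
proof -
  have k2: "(\<lambda>t. 2 * k t) absolutely_integrable_on {0..1}" using k by (intro set_integrable_mult_right) simp
  obtain C where C: "C > 0" "\<And>w M. continuous_on {0..1} w \<Longrightarrow> (\<forall>x\<in>{0..1}. 0 \<le> w x) \<Longrightarrow>
    (\<forall>x\<in>{0..1}. w x \<le> M + integral {0..x} (\<lambda>t. 2 * k t * w t)) \<Longrightarrow> (\<forall>x\<in>{0..1}. w x \<le> C * M)"
    using gronwall_L1[OF k2] k0 by auto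
  show ?thesis
  proof (rule that[OF C(1)])
    fix f1 f1' f2 f2' :: "real \<Rightarrow> complex" and A x :: real
    assume A: "0 \<le> A" and f: "ac_deriv f1 f1'" "ac_deriv f2 f2'"
      and le: "\<And>t. t \<in> {0..1} \<Longrightarrow> norm (f1' t) + norm (f2' t) \<le> k t * (norm (f1 t) + norm (f2 t)) + A"
      and x: "x \<in> {0..1}"
    define w where "w = (\<lambda>t. norm (f1 t) + norm (f2 t))"
    have cw: "continuous_on {0..1} w" unfolding w_def
      using f[THEN ac_deriv_continuous] by (intro continuous_intros)
    have kw: "(\<lambda>t. k t * w t) absolutely_integrable_on {0..1}"
      by (rule absolutely_integrable_continuous_mult_real[OF cw k])
    have "\<forall>x\<in>{0..1}. w x \<le> C * (w 0 + 2 * A)"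
    proof (rule C(2)[OF cw])
      show "\<forall>x\<in>{0..1}. 0 \<le> w x" by (simp add: w_def)
      show "\<forall>x\<in>{0..1}. w x \<le> w 0 + 2 * A + integral {0..x} (\<lambda>t. 2 * k t * w t)"
      proof
        fix x :: real assume x01: "x \<in> {0..1}"
        then have x: "0 \<le> x" "x \<le> 1" by auto
        have ikw: "(\<lambda>t. k t * w t) integrable_on {0..x}"
          using absolutely_integrable_initial[OF kw x] set_lebesgue_integral_eq_integral(1) by blast
        have ikA: "(\<lambda>t. k t * w t + A) integrable_on {0..x}"
          by (intro integrable_add ikw integrable_const_ivl)
        have I: "integral {0..x} (\<lambda>t. k t * w t + A) \<le> integral {0..x} (\<lambda>t. k t * w t) + A"
        proof -
          have "integral {0..x} (\<lambda>t. k t * w t + A) = integral {0..x} (\<lambda>t. k t * w t) + integral {0..x} (\<lambda>t. A)"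
            by (rule integral_add[OF ikw]) (intro integrable_continuous_real continuous_intros)
          also have "integral {0..x} (\<lambda>t. A) = x * A" using x by simp
          also have "x * A \<le> A" using x A mult_right_mono[of x 1 A] by simp
          finally show ?thesis by simp
        qed
        have "norm (f x - f 0) \<le> integral {0..x} (\<lambda>t. k t * w t + A)"
          if "ac_deriv f f'" "\<And>t. t \<in> {0..1} \<Longrightarrow> norm (f' t) \<le> k t * w t + A" for f f'
        proof -
          note h = ac_deriv_has_integral[OF that(1) order_refl x]
          have "norm (integral {0..x} f') \<le> integral {0..x} (\<lambda>t. k t * w t + A)"
            by (rule integral_norm_bound_integral[OF has_integral_integrable[OF h] ikA]) (use that(2) x in auto)
          then show ?thesis using integral_unique[OF h] by simp
        qed
        note inc = this
        have "norm (f1' t) \<le> k t * w t + A" "norm (f2' t) \<le> k t * w t + A" if "t \<in> {0..1}" for t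
          using le[OF that] norm_ge_zero[of "f1' t"] norm_ge_zero[of "f2' t"] unfolding w_def by linarith+
        then have "norm (f1 x - f1 0) \<le> integral {0..x} (\<lambda>t. k t * w t) + A"
          "norm (f2 x - f2 0) \<le> integral {0..x} (\<lambda>t. k t * w t) + A"
          using inc[OF f(1)] inc[OF f(2)] I by force+
        moreover have "integral {0..x} (\<lambda>t. 2 * k t * w t) = 2 * integral {0..x} (\<lambda>t. k t * w t)"
          by (simp add: mult.assoc)
        ultimately show "w x \<le> w 0 + 2 * A + integral {0..x} (\<lambda>t. 2 * k t * w t)"
          using norm_triangle_sub[of "f1 x" "f1 0"] norm_triangle_sub[of "f2 x" "f2 0"] unfolding w_def by linarith
      qed
    qed
    then show "norm (f1 x) + norm (f2 x) \<le> C * (norm (f1 0) + norm (f2 0) + 2 * A)"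
      using x by (simp add: w_def)
  qed
qed

text \<open>The difference of the solutions solves the system for \<mu>0 with an inhomogeneity
  proportional to (\<mu> - \<mu>0) times the solution for \<mu>. Gronwall's inequality is used
  twice: with A = 0 to bound that solution, then for the difference.\<close>

lemma dirac_system_lipschitz:
  assumes q: "q1 absolutely_integrable_on {0..1}" "q2 absolutely_integrable_on {0..1}"
  obtains L where "L > 0"
    "\<And>\<mu> y1 y2 z1 z2 x. norm (\<mu> - \<mu>0) \<le> 1 \<Longrightarrow> dirac_system b1 b2 q1 q2 \<mu> y1 y2 \<Longrightarrow> dirac_system b1 b2 q1 q2 \<mu>0 z1 z2 \<Longrightarrow>
      y1 0 = z1 0 \<Longrightarrow> y2 0 = z2 0 \<Longrightarrow> x \<in> {0..1} \<Longrightarrow>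
      norm (y1 x - z1 x) + norm (y2 x - z2 x) \<le> L * (norm (z1 0) + norm (z2 0)) * norm (\<mu> - \<mu>0)"
proof -
  define \<beta> where "\<beta> = \<bar>b1\<bar> + \<bar>b2\<bar> + 1"
  have \<beta>: "\<beta> > 0" "\<bar>b1\<bar> \<le> \<beta>" "\<bar>b2\<bar> \<le> \<beta>" by (auto simp: \<beta>_def)
  define k where "k = (\<lambda>t. \<beta> * (norm \<mu>0 + 1 + norm (q1 t) + norm (q2 t)))"
  have k: "k absolutely_integrable_on {0..1}" unfolding k_def
  proof (intro set_integrable_mult_right set_integral_add(1))
    show "(\<lambda>t::real. norm \<mu>0) absolutely_integrable_on {0..1}" "(\<lambda>t::real. 1::real) absolutely_integrable_on {0..1}"
      by (intro absolutely_integrable_continuous_real continuous_intros)+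
    show "(\<lambda>t. norm (q1 t)) absolutely_integrable_on {0..1}" "(\<lambda>t. norm (q2 t)) absolutely_integrable_on {0..1}"
      using q[THEN absolutely_integrable_norm] by (simp_all add: o_def)
  qed
  have k0: "0 \<le> k t" for t using \<beta> by (simp add: k_def)
  obtain C where C: "C > 0" "\<And>f1 f1' f2 f2' A x. 0 \<le> A \<Longrightarrow> ac_deriv f1 f1' \<Longrightarrow> ac_deriv f2 f2' \<Longrightarrow>
    (\<And>t. t \<in> {0..1} \<Longrightarrow> norm (f1' t) + norm (f2' t) \<le> k t * (norm (f1 t) + norm (f2 t)) + A) \<Longrightarrow>
    x \<in> {0..1} \<Longrightarrow> norm (f1 x) + norm (f2 x) \<le> C * (norm (f1 0) + norm (f2 0) + 2 * A)"
    by (rule ac_deriv_gronwall[OF k k0]) blast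
  \<comment> \<open>The forcing terms e1 and e2 are 0 for a single solution and (\<mu> - \<mu>0) y
    for a difference; both parameters have modulus at most |\<mu>0| + 1.\<close>
  have key: "norm (\<i> * of_real b1 * (m * u - q1 t * v + e1)) + norm (\<i> * of_real b2 * (m * v - q2 t * u + e2))
      \<le> k t * (norm u + norm v) + \<beta> * (norm e1 + norm e2)" if m: "norm m \<le> norm \<mu>0 + 1" for m u v e1 e2 t
  proof -
    have "norm (m * u - q1 t * v + e1) \<le> norm m * norm u + norm (q1 t) * norm v + norm e1"
      using norm_triangle_ineq[of "m * u - q1 t * v" e1] norm_triangle_ineq4[of "m * u" "q1 t * v"] by (simp add: norm_mult)
    also have "\<dots> \<le> (norm \<mu>0 + 1) * norm u + norm (q1 t) * norm v + norm e1"
      using mult_right_mono[OF m norm_ge_zero[of u]] by simp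
    finally have "\<bar>b1\<bar> * norm (m * u - q1 t * v + e1) \<le> \<beta> * ((norm \<mu>0 + 1) * norm u + norm (q1 t) * norm v + norm e1)"
      by (intro mult_mono \<beta>(2)) (use \<beta> in auto)
    then have 1: "norm (\<i> * of_real b1 * (m * u - q1 t * v + e1)) \<le> \<beta> * ((norm \<mu>0 + 1) * norm u + norm (q1 t) * norm v + norm e1)"
      by (simp add: norm_mult)
    have "norm (m * v - q2 t * u + e2) \<le> norm m * norm v + norm (q2 t) * norm u + norm e2"
      using norm_triangle_ineq[of "m * v - q2 t * u" e2] norm_triangle_ineq4[of "m * v" "q2 t * u"] by (simp add: norm_mult)
    also have "\<dots> \<le> (norm \<mu>0 + 1) * norm v + norm (q2 t) * norm u + norm e2"
      using mult_right_mono[OF m norm_ge_zero[of v]] by simp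
    finally have "\<bar>b2\<bar> * norm (m * v - q2 t * u + e2) \<le> \<beta> * ((norm \<mu>0 + 1) * norm v + norm (q2 t) * norm u + norm e2)"
      by (intro mult_mono \<beta>(3)) (use \<beta> in auto)
    then have 2: "norm (\<i> * of_real b2 * (m * v - q2 t * u + e2)) \<le> \<beta> * ((norm \<mu>0 + 1) * norm v + norm (q2 t) * norm u + norm e2)"
      by (simp add: norm_mult)
    have "\<beta> * ((norm \<mu>0 + 1) * norm u + norm (q1 t) * norm v + norm e1) + \<beta> * ((norm \<mu>0 + 1) * norm v + norm (q2 t) * norm u + norm e2)
      = k t * (norm u + norm v) + \<beta> * (norm e1 + norm e2) - \<beta> * (norm (q1 t) * norm u + norm (q2 t) * norm v)"
      by (simp add: k_def algebra_simps)
    moreover have "\<beta> * (norm (q1 t) * norm u + norm (q2 t) * norm v) \<ge> 0" using \<beta> by simp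
    ultimately show ?thesis using 1 2 by linarith
  qed
  show ?thesis
  \<comment> \<open>The outer C belongs to the difference; 2 \<beta> C comes from its inhomogeneity,
    where C enters again as a bound for solutions.\<close>
  proof (rule that[of "C * (2 * (\<beta> * C))"])
    show "C * (2 * (\<beta> * C)) > 0" using C \<beta> by simp
    fix \<mu> and y1 y2 z1 z2 :: "real \<Rightarrow> complex" and x :: real
    assume \<mu>: "norm (\<mu> - \<mu>0) \<le> 1" and y: "dirac_system b1 b2 q1 q2 \<mu> y1 y2" and z: "dirac_system b1 b2 q1 q2 \<mu>0 z1 z2"
      and init: "y1 0 = z1 0" "y2 0 = z2 0" and x: "x \<in> {0..1}"
    define m where "m = norm (z1 0) + norm (z2 0)"
    have \<mu>1: "norm \<mu> \<le> norm \<mu>0 + 1" using \<mu> norm_triangle_sub[of \<mu> \<mu>0] by simp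
    have bd: "norm (y1 t) + norm (y2 t) \<le> C * m" if "t \<in> {0..1}" for t
    proof -
      have "norm (y1 t) + norm (y2 t) \<le> C * (norm (y1 0) + norm (y2 0) + 2 * 0)"
        by (rule C(2)[OF _ conjunct1[OF y[unfolded dirac_system_def]] conjunct2[OF y[unfolded dirac_system_def]] _ that])
          (use key[OF \<mu>1, of _ _ _ 0 0] in simp_all)
      then show ?thesis using init by (simp add: m_def)
    qed
    have "norm (y1 x - z1 x) + norm (y2 x - z2 x) \<le> C * (norm (y1 0 - z1 0) + norm (y2 0 - z2 0) + 2 * (\<beta> * (C * m * norm (\<mu> - \<mu>0))))"
    proof (rule C(2)[OF _ ac_deriv_diff[OF conjunct1[OF y[unfolded dirac_system_def]] conjunct1[OF z[unfolded dirac_system_def]]]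
          ac_deriv_diff[OF conjunct2[OF y[unfolded dirac_system_def]] conjunct2[OF z[unfolded dirac_system_def]]] _ x])
      show "0 \<le> \<beta> * (C * m * norm (\<mu> - \<mu>0))" using \<beta> C by (simp add: m_def)
      fix t :: real assume t: "t \<in> {0..1}"
      have eq: "\<i> * of_real b * (\<mu> * u - r * v) - \<i> * of_real b * (\<mu>0 * u' - r * v')
        = \<i> * of_real b * (\<mu>0 * (u - u') - r * (v - v') + (\<mu> - \<mu>0) * u)" for b u u' v v' r by (simp add: algebra_simps)
      have "norm \<mu>0 \<le> norm \<mu>0 + 1" by simp
      from key[OF this, of "y1 t - z1 t" t "y2 t - z2 t" "(\<mu> - \<mu>0) * y1 t" "(\<mu> - \<mu>0) * y2 t"]
      have "norm (\<i> * of_real b1 * (\<mu> * y1 t - q1 t * y2 t) - \<i> * of_real b1 * (\<mu>0 * z1 t - q1 t * z2 t)) +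
         norm (\<i> * of_real b2 * (\<mu> * y2 t - q2 t * y1 t) - \<i> * of_real b2 * (\<mu>0 * z2 t - q2 t * z1 t))
         \<le> k t * (norm (y1 t - z1 t) + norm (y2 t - z2 t)) + \<beta> * (norm ((\<mu> - \<mu>0) * y1 t) + norm ((\<mu> - \<mu>0) * y2 t))"
        unfolding eq .
      also have "norm ((\<mu> - \<mu>0) * y1 t) + norm ((\<mu> - \<mu>0) * y2 t) = (norm (y1 t) + norm (y2 t)) * norm (\<mu> - \<mu>0)"
        by (simp only: norm_mult distrib_left mult.commute)
      also have "\<dots> \<le> C * m * norm (\<mu> - \<mu>0)" using bd[OF t] by (rule mult_right_mono) simp
      finally show "norm (\<i> * of_real b1 * (\<mu> * y1 t - q1 t * y2 t) - \<i> * of_real b1 * (\<mu>0 * z1 t - q1 t * z2 t)) +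
         norm (\<i> * of_real b2 * (\<mu> * y2 t - q2 t * y1 t) - \<i> * of_real b2 * (\<mu>0 * z2 t - q2 t * z1 t))
         \<le> k t * (norm (y1 t - z1 t) + norm (y2 t - z2 t)) + \<beta> * (C * m * norm (\<mu> - \<mu>0))"
        using \<beta> by simp
    qed
    then show "norm (y1 x - z1 x) + norm (y2 x - z2 x) \<le> C * (2 * (\<beta> * C)) * (norm (z1 0) + norm (z2 0)) * norm (\<mu> - \<mu>0)"
      using init by (simp add: m_def algebra_simps)
  qed
qed

text \<open>The potential cancels in this identity, since it is off-diagonal.\<close>

lemma dirac_system_wronskian:
  assumes y: "dirac_system b1 b2 q1 q2 \<mu> y1 y2" and z: "dirac_system b1 b2 q1 q2 \<mu>0 z1 z2"
  shows "ac_deriv (\<lambda>x. exp (- \<i> * of_real (b1 + b2) * \<mu>0 * of_real x + 0) * (y1 x * z2 x - y2 x * z1 x))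
    (\<lambda>x. (\<mu> - \<mu>0) * (exp (- \<i> * of_real (b1 + b2) * \<mu>0 * of_real x + 0) *
      (\<i> * (of_real b1 * y1 x * z2 x - of_real b2 * y2 x * z1 x))))"
proof -
  note y' = conjunct1[OF y[unfolded dirac_system_def]] conjunct2[OF y[unfolded dirac_system_def]]
  note z' = conjunct1[OF z[unfolded dirac_system_def]] conjunct2[OF z[unfolded dirac_system_def]]
  show ?thesis
    by (rule ac_deriv_cong[OF ac_deriv_mult[OF ac_deriv_exp[of "- \<i> * of_real (b1 + b2) * \<mu>0" 0]
          ac_deriv_diff[OF ac_deriv_mult[OF y'(1) z'(2)] ac_deriv_mult[OF y'(2) z'(1)]]]])
      (simp_all add: algebra_simps)
qed

text \<open>For equal parameters the derivative in the Wronskian identity vanishes.\<close>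

lemma dirac_system_liouville:
  assumes y: "dirac_system b1 b2 q1 q2 \<mu> y1 y2" and z: "dirac_system b1 b2 q1 q2 \<mu> z1 z2"
  shows "y1 1 * z2 1 - y2 1 * z1 1 = exp (\<i> * of_real (b1 + b2) * \<mu>) * (y1 0 * z2 0 - y2 0 * z1 0)"
proof -
  have "((\<lambda>x::real. 0 :: complex) has_integral exp (- \<i> * of_real (b1 + b2) * \<mu>) * (y1 1 * z2 1 - y2 1 * z1 1)
      - (y1 0 * z2 0 - y2 0 * z1 0)) {0..1}"
    using ac_deriv_has_integral[OF dirac_system_wronskian[OF y z], of 0 1] by simp
  then have "exp (- \<i> * of_real (b1 + b2) * \<mu>) * (y1 1 * z2 1 - y2 1 * z1 1) = y1 0 * z2 0 - y2 0 * z1 0"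
    using has_integral_unique[OF _ has_integral_0] by fastforce
  then have "exp (\<i> * of_real (b1 + b2) * \<mu>) * (exp (- \<i> * of_real (b1 + b2) * \<mu>) * (y1 1 * z2 1 - y2 1 * z1 1))
    = exp (\<i> * of_real (b1 + b2) * \<mu>) * (y1 0 * z2 0 - y2 0 * z1 0)" by simp
  then show ?thesis by (simp add: mult.assoc[symmetric] exp_add[symmetric])
qed

text \<open>Integrating the Wronskian identity yields an increment (\<mu> - \<mu>0) G(\<mu>), so
  differentiability at \<mu>0 needs no more than continuity of G there. Lipschitz dependence on
  \<mu> supplies it; no solution is differentiated in \<mu>.\<close>

lemma dirac_system_wronskian_differentiable:
  assumes q: "q1 absolutely_integrable_on {0..1}" "q2 absolutely_integrable_on {0..1}"
    and Y: "\<And>\<mu>. dirac_system b1 b2 q1 q2 \<mu> (Y1 \<mu>) (Y2 \<mu>)" and init: "\<And>\<mu>. Y1 \<mu> 0 = c1" "\<And>\<mu>. Y2 \<mu> 0 = c2"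
    and z: "dirac_system b1 b2 q1 q2 \<mu>0 z1 z2"
  shows "(\<lambda>\<mu>. Y1 \<mu> 1 * z2 1 - Y2 \<mu> 1 * z1 1) field_differentiable (at \<mu>0)"
proof -
  define E where "E = (\<lambda>x::real. exp (- \<i> * of_real (b1 + b2) * \<mu>0 * of_real x + 0))"
  define g where "g = (\<lambda>\<mu> x. E x * (\<i> * (of_real b1 * Y1 \<mu> x * z2 x - of_real b2 * Y2 \<mu> x * z1 x)))"
  define G where "G = (\<lambda>\<mu>. integral {0..1} (g \<mu>))"
  have cE: "continuous_on {0..1} E" unfolding E_def by (intro continuous_intros)
  have cz: "continuous_on {0..1} z1" "continuous_on {0..1} z2"
    using z ac_deriv_continuous by (auto simp: dirac_system_def)
  have cY: "continuous_on {0..1} (Y1 \<mu>)" "continuous_on {0..1} (Y2 \<mu>)" for \<mu>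
    using Y[of \<mu>] ac_deriv_continuous by (auto simp: dirac_system_def)
  have cg: "continuous_on {0..1} (g \<mu>)" for \<mu> unfolding g_def using cE cz cY[of \<mu>] by (intro continuous_intros)
  have E0: "E 1 \<noteq> 0" by (simp add: E_def)
  \<comment> \<open>The initial values do not depend on \<mu>, so the contribution at 0 is the same
    for all parameters.\<close>
  have W: "E 1 * (Y1 \<mu> 1 * z2 1 - Y2 \<mu> 1 * z1 1) = (c1 * z2 0 - c2 * z1 0) + (\<mu> - \<mu>0) * G \<mu>" for \<mu>
  proof -
    have "((\<lambda>x. (\<mu> - \<mu>0) * g \<mu> x) has_integral E 1 * (Y1 \<mu> 1 * z2 1 - Y2 \<mu> 1 * z1 1) - (c1 * z2 0 - c2 * z1 0)) {0..1}"
      using ac_deriv_has_integral[OF dirac_system_wronskian[OF Y z], of 0 1 \<mu>] init by (simp add: E_def g_def)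
    moreover have "((\<lambda>x. (\<mu> - \<mu>0) * g \<mu> x) has_integral (\<mu> - \<mu>0) * G \<mu>) {0..1}"
      unfolding G_def using cg by (intro has_integral_mult_right integrable_integral integrable_continuous_real)
    ultimately show ?thesis using has_integral_unique by (metis diff_add_cancel add.commute)
  qed
  obtain Em where Em: "Em > 0" "\<And>x. x \<in> {0..1} \<Longrightarrow> norm (E x) \<le> Em" using continuous_on_bounded_01[OF cE] by blast
  obtain Z1 where Z1: "Z1 > 0" "\<And>x. x \<in> {0..1} \<Longrightarrow> norm (z1 x) \<le> Z1" using continuous_on_bounded_01[OF cz(1)] by blast
  obtain Z2 where Z2: "Z2 > 0" "\<And>x. x \<in> {0..1} \<Longrightarrow> norm (z2 x) \<le> Z2" using continuous_on_bounded_01[OF cz(2)] by blast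
  obtain L where L: "L > 0"
    "\<And>\<mu> y1 y2 z1 z2 x. norm (\<mu> - \<mu>0) \<le> 1 \<Longrightarrow> dirac_system b1 b2 q1 q2 \<mu> y1 y2 \<Longrightarrow> dirac_system b1 b2 q1 q2 \<mu>0 z1 z2 \<Longrightarrow>
      y1 0 = z1 0 \<Longrightarrow> y2 0 = z2 0 \<Longrightarrow> x \<in> {0..1} \<Longrightarrow>
      norm (y1 x - z1 x) + norm (y2 x - z2 x) \<le> L * (norm (z1 0) + norm (z2 0)) * norm (\<mu> - \<mu>0)"
    by (rule dirac_system_lipschitz[OF q]) blast
  define K where "K = Em * ((\<bar>b1\<bar> * Z2 + \<bar>b2\<bar> * Z1) * (L * (norm c1 + norm c2)))"
  have lip: "norm (G \<mu> - G \<mu>0) \<le> K * norm (\<mu> - \<mu>0)" if \<mu>: "norm (\<mu> - \<mu>0) \<le> 1" for \<mu>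
  proof -
    have "G \<mu> - G \<mu>0 = integral {0..1} (\<lambda>x. g \<mu> x - g \<mu>0 x)"
      unfolding G_def by (rule integral_diff[symmetric]) (intro integrable_continuous_real cg)+
    also have "norm \<dots> \<le> K * norm (\<mu> - \<mu>0) * (1 - 0)"
    proof (rule integral_bound)
      show "continuous_on {0..1} (\<lambda>x. g \<mu> x - g \<mu>0 x)" by (intro continuous_intros cg)
      fix x :: real assume x: "x \<in> {0..1}"
      define D where "D = L * (norm c1 + norm c2) * norm (\<mu> - \<mu>0)"
      have "norm (Y1 \<mu> x - Y1 \<mu>0 x) + norm (Y2 \<mu> x - Y2 \<mu>0 x) \<le> D"
        using L(2)[OF \<mu> Y Y _ _ x] by (simp add: init D_def)
      then have D: "norm (Y1 \<mu> x - Y1 \<mu>0 x) \<le> D" "norm (Y2 \<mu> x - Y2 \<mu>0 x) \<le> D"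
        using norm_ge_zero[of "Y1 \<mu> x - Y1 \<mu>0 x"] norm_ge_zero[of "Y2 \<mu> x - Y2 \<mu>0 x"] by linarith+
      have D0: "D \<ge> 0" using D(1) by (rule order_trans[OF norm_ge_zero])
      have "g \<mu> x - g \<mu>0 x = E x * (\<i> * (of_real b1 * (Y1 \<mu> x - Y1 \<mu>0 x) * z2 x - of_real b2 * (Y2 \<mu> x - Y2 \<mu>0 x) * z1 x))"
        by (simp add: g_def algebra_simps)
      then have "norm (g \<mu> x - g \<mu>0 x) = norm (E x) * norm (of_real b1 * (Y1 \<mu> x - Y1 \<mu>0 x) * z2 x - of_real b2 * (Y2 \<mu> x - Y2 \<mu>0 x) * z1 x)"
        by (simp add: norm_mult)
      also have "\<dots> \<le> Em * (\<bar>b1\<bar> * D * Z2 + \<bar>b2\<bar> * D * Z1)"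
      proof (intro mult_mono Em(2)[OF x])
        have "norm (of_real b1 * (Y1 \<mu> x - Y1 \<mu>0 x) * z2 x) \<le> \<bar>b1\<bar> * D * Z2"
          unfolding norm_mult norm_of_real using D Z2(2)[OF x] D0 by (intro mult_mono) auto
        moreover have "norm (of_real b2 * (Y2 \<mu> x - Y2 \<mu>0 x) * z1 x) \<le> \<bar>b2\<bar> * D * Z1"
          unfolding norm_mult norm_of_real using D Z1(2)[OF x] D0 by (intro mult_mono) auto
        ultimately show "norm (of_real b1 * (Y1 \<mu> x - Y1 \<mu>0 x) * z2 x - of_real b2 * (Y2 \<mu> x - Y2 \<mu>0 x) * z1 x)
            \<le> \<bar>b1\<bar> * D * Z2 + \<bar>b2\<bar> * D * Z1"
          by (intro order_trans[OF norm_triangle_ineq4] add_mono)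
      qed (use Em in auto)
      also have "\<dots> = K * norm (\<mu> - \<mu>0)" by (simp add: K_def D_def algebra_simps)
      finally show "norm (g \<mu> x - g \<mu>0 x) \<le> K * norm (\<mu> - \<mu>0)" .
    qed simp
    finally show ?thesis by simp
  qed
  have "((\<lambda>\<mu>. G \<mu> - G \<mu>0) \<longlongrightarrow> 0) (at \<mu>0)"
  proof (rule Lim_null_comparison)
    show "\<forall>\<^sub>F \<mu> in at \<mu>0. norm (G \<mu> - G \<mu>0) \<le> K * norm (\<mu> - \<mu>0)"
      unfolding eventually_at by (intro exI[of _ 1]) (use lip in \<open>auto simp: dist_norm\<close>)
    have "((\<lambda>\<mu>. K * norm (\<mu> - \<mu>0)) \<longlongrightarrow> K * norm (\<mu>0 - \<mu>0)) (at \<mu>0)"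
      by (intro tendsto_mult tendsto_norm tendsto_diff tendsto_const tendsto_ident_at)
    then show "((\<lambda>\<mu>. K * norm (\<mu> - \<mu>0)) \<longlongrightarrow> 0) (at \<mu>0)" by simp
  qed
  then have "(G \<longlongrightarrow> G \<mu>0) (at \<mu>0)" by (simp add: LIM_zero_iff)
  then have "isCont (\<lambda>\<mu>. G \<mu> / E 1) \<mu>0" unfolding isCont_def using E0 by (intro tendsto_divide tendsto_const)
  moreover have "(Y1 \<mu> 1 * z2 1 - Y2 \<mu> 1 * z1 1) - (Y1 \<mu>0 1 * z2 1 - Y2 \<mu>0 1 * z1 1) = G \<mu> / E 1 * (\<mu> - \<mu>0)" for \<mu>
  proof -
    have "E 1 * ((Y1 \<mu> 1 * z2 1 - Y2 \<mu> 1 * z1 1) - (Y1 \<mu>0 1 * z2 1 - Y2 \<mu>0 1 * z1 1))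
      = E 1 * (Y1 \<mu> 1 * z2 1 - Y2 \<mu> 1 * z1 1) - E 1 * (Y1 \<mu>0 1 * z2 1 - Y2 \<mu>0 1 * z1 1)"
      by (rule right_diff_distrib)
    also have "\<dots> = (\<mu> - \<mu>0) * G \<mu>" unfolding W by simp
    finally show ?thesis using E0 by (simp add: eq_divide_eq mult.commute)
  qed
  \<comment> \<open>Caratheodory's criterion: the difference quotient is given by G / E(1), which is
    continuous at \<mu>0.\<close>
  ultimately have "((\<lambda>\<mu>. Y1 \<mu> 1 * z2 1 - Y2 \<mu> 1 * z1 1) has_field_derivative G \<mu>0 / E 1) (at \<mu>0)"
    unfolding CARAT_DERIV by (intro exI[of _ "\<lambda>\<mu>. G \<mu> / E 1"]) simp
  then show ?thesis by (auto simp: field_differentiable_def)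
qed

text \<open>The vector Y(1) solves a 2 by 2 linear system whose right-hand sides are its Wronskians
  with P and S frozen at \<mu>0, both differentiable there. Cramer's rule applies, as the
  determinant is an exponential by Liouville's formula.\<close>

lemma dirac_system_holomorphic:
  assumes q: "q1 absolutely_integrable_on {0..1}" "q2 absolutely_integrable_on {0..1}"
    and P: "\<And>\<mu>. dirac_system b1 b2 q1 q2 \<mu> (P1 \<mu>) (P2 \<mu>)" "\<And>\<mu>. P1 \<mu> 0 = 1" "\<And>\<mu>. P2 \<mu> 0 = 0"
    and S: "\<And>\<mu>. dirac_system b1 b2 q1 q2 \<mu> (S1 \<mu>) (S2 \<mu>)" "\<And>\<mu>. S1 \<mu> 0 = 0" "\<And>\<mu>. S2 \<mu> 0 = 1"
    and Y: "\<And>\<mu>. dirac_system b1 b2 q1 q2 \<mu> (Y1 \<mu>) (Y2 \<mu>)" "\<And>\<mu>. Y1 \<mu> 0 = c1" "\<And>\<mu>. Y2 \<mu> 0 = c2"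
  shows "(\<lambda>\<mu>. Y1 \<mu> 1) holomorphic_on UNIV" "(\<lambda>\<mu>. Y2 \<mu> 1) holomorphic_on UNIV"
proof -
  have "(\<lambda>\<mu>. Y1 \<mu> 1) field_differentiable (at \<mu>0) \<and> (\<lambda>\<mu>. Y2 \<mu> 1) field_differentiable (at \<mu>0)" for \<mu>0
  proof -
    define d where "d = exp (\<i> * of_real (b1 + b2) * \<mu>0)"
    have d0: "d \<noteq> 0" by (simp add: d_def)
    have det: "P1 \<mu>0 1 * S2 \<mu>0 1 - P2 \<mu>0 1 * S1 \<mu>0 1 = d"
      using dirac_system_liouville[OF P(1) S(1)] by (simp add: P S d_def)
    define WP where "WP = (\<lambda>\<mu>. Y1 \<mu> 1 * P2 \<mu>0 1 - Y2 \<mu> 1 * P1 \<mu>0 1)"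
    define WS where "WS = (\<lambda>\<mu>. Y1 \<mu> 1 * S2 \<mu>0 1 - Y2 \<mu> 1 * S1 \<mu>0 1)"
    have W: "WP field_differentiable (at \<mu>0)" "WS field_differentiable (at \<mu>0)"
      unfolding WP_def WS_def
      by (rule dirac_system_wronskian_differentiable[OF q Y P(1)], rule dirac_system_wronskian_differentiable[OF q Y S(1)])
    have 1: "Y1 \<mu> 1 = (P1 \<mu>0 1 * WS \<mu> - S1 \<mu>0 1 * WP \<mu>) * (1 / d)" for \<mu>
    proof -
      have "P1 \<mu>0 1 * WS \<mu> - S1 \<mu>0 1 * WP \<mu> = Y1 \<mu> 1 * (P1 \<mu>0 1 * S2 \<mu>0 1 - P2 \<mu>0 1 * S1 \<mu>0 1)"
        by (simp add: WS_def WP_def algebra_simps)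
      then show ?thesis using d0 unfolding det by simp
    qed
    have 2: "Y2 \<mu> 1 = (P2 \<mu>0 1 * WS \<mu> - S2 \<mu>0 1 * WP \<mu>) * (1 / d)" for \<mu>
    proof -
      have "P2 \<mu>0 1 * WS \<mu> - S2 \<mu>0 1 * WP \<mu> = Y2 \<mu> 1 * (P1 \<mu>0 1 * S2 \<mu>0 1 - P2 \<mu>0 1 * S1 \<mu>0 1)"
        by (simp add: WS_def WP_def algebra_simps)
      then show ?thesis using d0 unfolding det by simp
    qed
    show ?thesis unfolding 1 2
      by (intro conjI field_differentiable_mult field_differentiable_diff W field_differentiable_const)
  qed
  then show "(\<lambda>\<mu>. Y1 \<mu> 1) holomorphic_on UNIV" "(\<lambda>\<mu>. Y2 \<mu> 1) holomorphic_on UNIV"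
    by (auto simp: holomorphic_on_def)
qed

subsection \<open>The characteristic determinant\<close>

lemma diag2_mult_vec: "(diag2 p q *v u) $ 1 = p * u $ 1" "(diag2 p q *v u) $ 2 = q * u $ 2"
  by (simp_all add: diag2_def matrix_vector_mult_def sum_2)

lemma offdiag2_mult_vec: "(offdiag2 p q *v u) $ 1 = p * u $ 2" "(offdiag2 p q *v u) $ 2 = q * u $ 1"
  by (simp_all add: offdiag2_def matrix_vector_mult_def sum_2)

lemma offdiag2_0: "offdiag2 0 0 = 0"
  by (simp add: offdiag2_def vec_eq_iff forall_2)

lemma invertible_diag2:
  assumes "p \<noteq> 0" "q \<noteq> 0"
  shows "invertible (diag2 p q)"
  using assms by (simp add: invertible_det_nz det_2 diag2_def)

lemma abs_continuous_on_component:
  fixes y :: "real \<Rightarrow> complex^'n"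
  assumes "abs_continuous_on S y"
  shows "abs_continuous_on S (\<lambda>x. y x $ i)"
  unfolding abs_continuous_on_def
proof (intro allI impI)
  fix \<epsilon> :: real assume "\<epsilon> > 0"
  then obtain \<delta> where \<delta>: "\<delta> > 0" "\<And>D. D division_of \<Union>D \<Longrightarrow> \<Union>D \<subseteq> S \<Longrightarrow> (\<Sum>K\<in>D. Sup K - Inf K) < \<delta>
      \<Longrightarrow> (\<Sum>K\<in>D. norm (y (Sup K) - y (Inf K))) < \<epsilon>"
    by (rule abs_continuous_onE[OF assms]) blast
  show "\<exists>\<delta>>0. \<forall>D. D division_of \<Union>D \<and> \<Union>D \<subseteq> S \<and> (\<Sum>K\<in>D. Sup K - Inf K) < \<delta> \<longrightarrow>
    (\<Sum>K\<in>D. norm (y (Sup K) $ i - y (Inf K) $ i)) < \<epsilon>"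
  proof (intro exI[of _ \<delta>] conjI allI impI)
    fix D :: "real set set" assume D: "D division_of \<Union>D \<and> \<Union>D \<subseteq> S \<and> (\<Sum>K\<in>D. Sup K - Inf K) < \<delta>"
    have "(\<Sum>K\<in>D. norm (y (Sup K) $ i - y (Inf K) $ i)) \<le> (\<Sum>K\<in>D. norm (y (Sup K) - y (Inf K)))"
    proof (rule sum_mono)
      fix K
      show "norm (y (Sup K) $ i - y (Inf K) $ i) \<le> norm (y (Sup K) - y (Inf K))"
        using Finite_Cartesian_Product.norm_nth_le[of "y (Sup K) - y (Inf K)" i] by simp
    qed
    also have "\<dots> < \<epsilon>" using D by (intro \<delta>(2)) auto
    finally show "(\<Sum>K\<in>D. norm (y (Sup K) $ i - y (Inf K) $ i)) < \<epsilon>" .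
  qed (rule \<delta>(1))
qed

text \<open>Multiplying the equation by i B solves it for y' and separates the components.\<close>

lemma dirac_solution_imp_dirac_system:
  assumes b: "b1 \<noteq> 0" "b2 \<noteq> 0"
    and y: "dirac_solution (diag2 (of_real b1) (of_real b2)) (\<lambda>x. offdiag2 (q1 x) (q2 x)) \<mu> y"
  shows "dirac_system b1 b2 q1 q2 \<mu> (\<lambda>x. y x $ 1) (\<lambda>x. y x $ 2)"
proof -
  define B where "B = diag2 (of_real b1) (of_real b2)"
  \<comment> \<open>\<open>matrix_inv\<close> is defined by choice, so its inverse property has to
    come from invertibility.\<close>
  have "invertible B" unfolding B_def using b by (intro invertible_diag2) auto
  then have inv: "B ** matrix_inv B = mat 1"
    unfolding invertible_def matrix_inv_def by (rule someI2_ex) blast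
  have ode: "y' $ 1 = \<i> * of_real b1 * (\<mu> * y x $ 1 - q1 x * y x $ 2) \<and>
      y' $ 2 = \<i> * of_real b2 * (\<mu> * y x $ 2 - q2 x * y x $ 1)"
    if "(- \<i>) *s (matrix_inv B *v y') + offdiag2 (q1 x) (q2 x) *v y x = \<mu> *s y x" for y' x
  proof -
    define u where "u = matrix_inv B *v y'"
    have "B *v u = y'" unfolding u_def by (simp add: matrix_vector_mul_assoc inv)
    then have y': "y' $ 1 = of_real b1 * u $ 1" "y' $ 2 = of_real b2 * u $ 2"
      unfolding B_def using diag2_mult_vec by metis+
    have u: "- \<i> * u $ 1 + q1 x * y x $ 2 = \<mu> * y x $ 1" "- \<i> * u $ 2 + q2 x * y x $ 1 = \<mu> * y x $ 2"
      using arg_cong[OF that, of "\<lambda>v. v $ 1"] arg_cong[OF that, of "\<lambda>v. v $ 2"]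
      by (simp_all add: u_def[symmetric] offdiag2_mult_vec)
    have "u $ 1 = \<i> * (- \<i> * u $ 1)" "u $ 2 = \<i> * (- \<i> * u $ 2)" by simp_all
    then have "u $ 1 = \<i> * (\<mu> * y x $ 1 - q1 x * y x $ 2)" "u $ 2 = \<i> * (\<mu> * y x $ 2 - q2 x * y x $ 1)"
      using u by (metis add_diff_cancel_right')+
    then show ?thesis unfolding y' by (simp only: mult_ac simp_thms)
  qed
  have AE: "AE x in lebesgue. x \<in> {0..1} \<longrightarrow> (\<exists>y'. (y has_vector_derivative y') (at x within {0..1}) \<and>
        (- \<i>) *s (matrix_inv B *v y') + offdiag2 (q1 x) (q2 x) *v y x = \<mu> *s y x)"
    using y by (simp add: dirac_solution_def B_def)
  have comp: "((\<lambda>x. y x $ i) has_vector_derivative y' $ i) F" if "(y has_vector_derivative y') F" for i y' F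
    using bounded_linear.has_vector_derivative[OF bounded_linear_vec_nth that] .
  show ?thesis unfolding dirac_system_def ac_deriv_def
  proof (intro conjI)
    show "abs_continuous_on {0..1} (\<lambda>x. y x $ 1)" "abs_continuous_on {0..1} (\<lambda>x. y x $ 2)"
      using y by (auto simp: dirac_solution_def intro: abs_continuous_on_component)
    show "AE x in lebesgue. x \<in> {0..1} \<longrightarrow> ((\<lambda>x. y x $ 1) has_vector_derivative
      \<i> * of_real b1 * (\<mu> * y x $ 1 - q1 x * y x $ 2)) (at x within {0..1})"
      by (rule eventually_mono[OF AE]) (metis comp ode)
    show "AE x in lebesgue. x \<in> {0..1} \<longrightarrow> ((\<lambda>x. y x $ 2) has_vector_derivative
      \<i> * of_real b2 * (\<mu> * y x $ 2 - q2 x * y x $ 1)) (at x within {0..1})"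
      by (rule eventually_mono[OF AE]) (metis comp ode)
  qed
qed

text \<open>With zero potential, exp (- i b1 \<mu> x) y1 has derivative 0. The second component
  follows by exchanging the two.\<close>

lemma dirac_system_free:
  assumes "dirac_system b1 b2 (\<lambda>x. 0) (\<lambda>x. 0) \<mu> y1 y2"
  shows "y1 1 = exp (\<i> * of_real b1 * \<mu>) * y1 0"
proof -
  have "((\<lambda>t::real. 0 :: complex) has_integral exp (- \<i> * of_real b1 * \<mu>) * y1 1 - y1 0) {0..1}"
    using diag_system_duhamel(1)[OF dirac_system_imp_diag_system[OF assms], of 1] by simp
  then have "exp (- \<i> * of_real b1 * \<mu>) * y1 1 - y1 0 = 0"
    using has_integral_unique[OF _ has_integral_0] by blast
  then have "exp (\<i> * of_real b1 * \<mu>) * (exp (- \<i> * of_real b1 * \<mu>) * y1 1) = exp (\<i> * of_real b1 * \<mu>) * y1 0" by simp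
  then show ?thesis by (simp add: mult.assoc[symmetric] exp_add[symmetric])
qed

section \<open>Expansion and perturbation of the characteristic determinant\<close>

lemma bc_minor_expand: "bc_minor a j k = a $ 1 $ j * a $ 2 $ k - a $ 1 $ k * a $ 2 $ j"
  by (simp add: bc_minor_def det_2)

text \<open>With a1, ..., a4 the columns of \<open>a\<close>, the determinant has the columns a1 +
  \<Phi>11 a3 + \<Phi>21 a4 and a2 + \<Phi>12 a3 + \<Phi>22 a4, entries taken at x = 1; bilinearity
  produces the minors.\<close>

lemma char_det_expand:
  assumes "\<Phi> 0 \<mu> = mat 1"
  shows "char_det a \<Phi> \<mu> = bc_minor a 1 2 + bc_minor a 3 4 * (\<Phi> 1 \<mu> $ 1 $ 1 * \<Phi> 1 \<mu> $ 2 $ 2 - \<Phi> 1 \<mu> $ 2 $ 1 * \<Phi> 1 \<mu> $ 1 $ 2)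
    + bc_minor a 3 2 * \<Phi> 1 \<mu> $ 1 $ 1 + bc_minor a 1 4 * \<Phi> 1 \<mu> $ 2 $ 2
    + bc_minor a 1 3 * \<Phi> 1 \<mu> $ 1 $ 2 + bc_minor a 4 2 * \<Phi> 1 \<mu> $ 2 $ 1"
  by (simp add: char_det_def det_2 boundary_form_def column_def assms mat_def bc_minor_expand algebra_simps)

lemma fundamental_matrix_systems:
  assumes b: "b1 \<noteq> 0" "b2 \<noteq> 0"
    and \<Phi>: "fundamental_matrix (diag2 (of_real b1) (of_real b2)) (\<lambda>x. offdiag2 (q1 x) (q2 x)) \<Phi>"
  shows "dirac_system b1 b2 q1 q2 \<mu> (\<lambda>x. \<Phi> x \<mu> $ 1 $ k) (\<lambda>x. \<Phi> x \<mu> $ 2 $ k)"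
  using dirac_solution_imp_dirac_system[OF b, of q1 q2 \<mu> "\<lambda>x. column k (\<Phi> x \<mu>)"] \<Phi>
  by (simp add: fundamental_matrix_def column_def)

text \<open>The factor of J34 is the Wronskian of the two columns at 1, which by Liouville's formula
  is an exponential free of the potential.\<close>

lemma char_det_fundamental_matrix:
  assumes b: "b1 \<noteq> 0" "b2 \<noteq> 0"
    and \<Phi>: "fundamental_matrix (diag2 (of_real b1) (of_real b2)) (\<lambda>x. offdiag2 (q1 x) (q2 x)) \<Phi>"
  shows "char_det a \<Phi> \<mu> = bc_minor a 1 2 + bc_minor a 3 4 * exp (\<i> * of_real (b1 + b2) * \<mu>)
    + bc_minor a 3 2 * \<Phi> 1 \<mu> $ 1 $ 1 + bc_minor a 1 4 * \<Phi> 1 \<mu> $ 2 $ 2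
    + bc_minor a 1 3 * \<Phi> 1 \<mu> $ 1 $ 2 + bc_minor a 4 2 * \<Phi> 1 \<mu> $ 2 $ 1"
proof -
  have init: "\<Phi> 0 \<mu> = mat 1" using \<Phi> by (simp add: fundamental_matrix_def)
  have "\<Phi> 1 \<mu> $ 1 $ 1 * \<Phi> 1 \<mu> $ 2 $ 2 - \<Phi> 1 \<mu> $ 2 $ 1 * \<Phi> 1 \<mu> $ 1 $ 2 = exp (\<i> * of_real (b1 + b2) * \<mu>)"
    using dirac_system_liouville[OF fundamental_matrix_systems[OF b \<Phi>, of \<mu> 1] fundamental_matrix_systems[OF b \<Phi>, of \<mu> 2]]
    by (simp add: init mat_def)
  then show ?thesis unfolding char_det_expand[of \<Phi> \<mu> a, OF init] by simp
qed

lemma char_det_free: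
  assumes b: "b1 \<noteq> 0" "b2 \<noteq> 0"
    and \<Phi>: "fundamental_matrix (diag2 (of_real b1) (of_real b2)) (\<lambda>x. 0) \<Phi>"
  shows "char_det a \<Phi> = quad_exp (bc_minor a 1 2) (bc_minor a 3 4) (bc_minor a 3 2) (bc_minor a 1 4) b1 b2 1 1"
proof
  fix \<mu>
  \<comment> \<open>Written as \<open>offdiag2 0 0\<close>, the zero potential falls under the
    results for general potentials.\<close>
  have \<Phi>': "fundamental_matrix (diag2 (of_real b1) (of_real b2)) (\<lambda>x. offdiag2 0 0) \<Phi>"
    using \<Phi> by (simp add: offdiag2_0)
  have init: "\<Phi> 0 \<mu> = mat 1" using \<Phi> by (simp add: fundamental_matrix_def)
  note sys = fundamental_matrix_systems[OF b \<Phi>', of \<mu>]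
  have "\<Phi> 1 \<mu> $ 1 $ k = exp (\<i> * of_real b1 * \<mu>) * \<Phi> 0 \<mu> $ 1 $ k" "\<Phi> 1 \<mu> $ 2 $ k = exp (\<i> * of_real b2 * \<mu>) * \<Phi> 0 \<mu> $ 2 $ k" for k
    using dirac_system_free[OF sys] dirac_system_free[OF dirac_system_swap[OF sys]] by auto
  then show "char_det a \<Phi> \<mu> = quad_exp (bc_minor a 1 2) (bc_minor a 3 4) (bc_minor a 3 2) (bc_minor a 1 4) b1 b2 1 1 \<mu>"
    unfolding char_det_fundamental_matrix[OF b \<Phi>'] by (simp add: quad_exp_def init mat_def)
qed

lemma char_det_holomorphic:
  assumes b: "b1 \<noteq> 0" "b2 \<noteq> 0"
    and q: "q1 absolutely_integrable_on {0..1}" "q2 absolutely_integrable_on {0..1}"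
    and \<Phi>: "fundamental_matrix (diag2 (of_real b1) (of_real b2)) (\<lambda>x. offdiag2 (q1 x) (q2 x)) \<Phi>"
  shows "char_det a \<Phi> holomorphic_on UNIV"
proof -
  have init: "\<Phi> 0 \<mu> $ j $ k = (if j = k then 1 else 0)" for \<mu> j k using \<Phi> by (simp add: fundamental_matrix_def mat_def)
  note sys = fundamental_matrix_systems[OF b \<Phi>]
  have hol: "(\<lambda>\<mu>. \<Phi> 1 \<mu> $ 1 $ k) holomorphic_on UNIV" "(\<lambda>\<mu>. \<Phi> 1 \<mu> $ 2 $ k) holomorphic_on UNIV" for k
    by (rule dirac_system_holomorphic[OF q sys[of _ 1] _ _ sys[of _ 2] _ _ sys[of _ k]]; simp add: init)+
  have "char_det a \<Phi> = (\<lambda>\<mu>. bc_minor a 1 2 + bc_minor a 3 4 * exp (\<i> * of_real (b1 + b2) * \<mu>)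
    + bc_minor a 3 2 * \<Phi> 1 \<mu> $ 1 $ 1 + bc_minor a 1 4 * \<Phi> 1 \<mu> $ 2 $ 2
    + bc_minor a 1 3 * \<Phi> 1 \<mu> $ 1 $ 2 + bc_minor a 4 2 * \<Phi> 1 \<mu> $ 2 $ 1)"
    using char_det_fundamental_matrix[OF b \<Phi>] by blast
  then show ?thesis using hol by (auto intro!: holomorphic_intros)
qed

text \<open>The J12 and J34 terms agree for both potentials and cancel. Each remaining term contains
  one entry of \<Phi>(1): diagonal entries are compared with the free exponentials, off-diagonal
  ones with 0.\<close>

lemma char_det_asymptotic:
  assumes b: "b1 < 0" "0 < b2"
    and q: "q1 absolutely_integrable_on {0..1}" "q2 absolutely_integrable_on {0..1}"
    and \<Phi>: "fundamental_matrix (diag2 (of_real b1) (of_real b2)) (\<lambda>x. offdiag2 (q1 x) (q2 x)) \<Phi>"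
    and \<Phi>0: "fundamental_matrix (diag2 (of_real b1) (of_real b2)) (\<lambda>x. 0) \<Phi>0" and \<epsilon>: "\<epsilon> > 0"
  shows "\<exists>R. \<forall>\<mu>. R \<le> norm \<mu> \<longrightarrow> norm (char_det a \<Phi> \<mu> - char_det a \<Phi>0 \<mu>) \<le> \<epsilon> * exp_weight b1 b2 \<mu>"
proof -
  have b': "b1 \<noteq> 0" "b2 \<noteq> 0" "b1 < b2" using b by auto
  have init: "\<Phi> 0 \<mu> $ j $ k = (if j = k then 1 else 0)" for \<mu> j k using \<Phi> by (simp add: fundamental_matrix_def mat_def)
  define S where "S = norm (bc_minor a 3 2) + norm (bc_minor a 1 4) + norm (bc_minor a 1 3) + norm (bc_minor a 4 2)"
  have S: "S \<ge> 0" by (simp add: S_def)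
  \<comment> \<open>S sums the moduli of the four remaining minors; the + 1 keeps the quotient
    meaningful even if all of them vanish.\<close>
  define e where "e = \<epsilon> / (S + 1)"
  have e: "e > 0" "S * e \<le> \<epsilon>" using \<epsilon> S by (auto simp: e_def field_simps)
  obtain R where R: "\<And>\<mu> y1 y2. R \<le> norm \<mu> \<Longrightarrow> dirac_system b1 b2 q1 q2 \<mu> y1 y2 \<Longrightarrow> norm (y1 0) + norm (y2 0) = 1 \<Longrightarrow>
      norm (y1 1 - exp (\<i> * of_real b1 * \<mu>) * y1 0) \<le> e * exp_weight b1 b2 \<mu> \<and>
      norm (y2 1 - exp (\<i> * of_real b2 * \<mu>) * y2 0) \<le> e * exp_weight b1 b2 \<mu>"
    by (rule dirac_system_asymptotic[OF q e(1) b'(3)]) blast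
  have "norm (char_det a \<Phi> \<mu> - char_det a \<Phi>0 \<mu>) \<le> \<epsilon> * exp_weight b1 b2 \<mu>" if \<mu>: "R \<le> norm \<mu>" for \<mu>
  proof -
    note sys = fundamental_matrix_systems[OF b'(1,2) \<Phi>, of \<mu>]
    define w where "w = exp_weight b1 b2 \<mu>"
    have w: "w \<ge> 0" by (simp add: w_def exp_weight_def)
    have 1: "norm (\<Phi> 1 \<mu> $ 1 $ 1 - exp (\<i> * of_real b1 * \<mu>)) \<le> e * w" "norm (\<Phi> 1 \<mu> $ 2 $ 1) \<le> e * w"
      using R[OF \<mu> sys[of 1]] by (simp_all add: init w_def)
    have 2: "norm (\<Phi> 1 \<mu> $ 1 $ 2) \<le> e * w" "norm (\<Phi> 1 \<mu> $ 2 $ 2 - exp (\<i> * of_real b2 * \<mu>)) \<le> e * w"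
      using R[OF \<mu> sys[of 2]] by (simp_all add: init w_def)
    have "char_det a \<Phi> \<mu> - char_det a \<Phi>0 \<mu> = bc_minor a 3 2 * (\<Phi> 1 \<mu> $ 1 $ 1 - exp (\<i> * of_real b1 * \<mu>))
      + bc_minor a 1 4 * (\<Phi> 1 \<mu> $ 2 $ 2 - exp (\<i> * of_real b2 * \<mu>))
      + bc_minor a 1 3 * \<Phi> 1 \<mu> $ 1 $ 2 + bc_minor a 4 2 * \<Phi> 1 \<mu> $ 2 $ 1"
      unfolding char_det_fundamental_matrix[OF b'(1,2) \<Phi>] char_det_free[OF b'(1,2) \<Phi>0]
      by (simp add: quad_exp_def algebra_simps)
    also have "norm \<dots> \<le> norm (bc_minor a 3 2) * (e * w) + norm (bc_minor a 1 4) * (e * w)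
      + norm (bc_minor a 1 3) * (e * w) + norm (bc_minor a 4 2) * (e * w)"
      by (intro order_trans[OF norm_triangle_ineq] add_mono; simp only: norm_mult; intro mult_left_mono 1 2 norm_ge_zero)
    also have "\<dots> = (S * e) * w" by (simp add: S_def algebra_simps)
    also have "\<dots> \<le> \<epsilon> * w" using e(2) w by (rule mult_right_mono)
    finally show ?thesis by (simp add: w_def)
  qed
  then show ?thesis by blast
qed

theorem proposition4p7:
  fixes b1 b2 :: real
    and Q12 Q21 :: "real \<Rightarrow> complex"
    and a :: "complex^4^2"
    and \<Phi> \<Phi>0 :: "real \<Rightarrow> complex \<Rightarrow> complex^2^2"
    and \<zeta>0 :: "int \<Rightarrow> complex"
  defines "B \<equiv> diag2 (of_real b1) (of_real b2)"
    and "Q \<equiv> (\<lambda>x. offdiag2 (Q12 x) (Q21 x))"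
  assumes "b1 < 0" and "0 < b2"
    and "Q12 absolutely_integrable_on {0..1}"
    and "Q21 absolutely_integrable_on {0..1}"
    and "regular_bc a"
    and "fundamental_matrix B Q \<Phi>"
    and "fundamental_matrix B (\<lambda>x. 0) \<Phi>0"
    and "zero_sequence (char_det a \<Phi>0) \<zeta>0"
    and "\<And>n. Re (\<zeta>0 n) \<le> Re (\<zeta>0 (n + 1))"
  shows "\<exists>\<zeta> :: int \<Rightarrow> complex. zero_sequence (char_det a \<Phi>) \<zeta> \<and>
           ((\<lambda>n. \<zeta> n - \<zeta>0 n) \<longlongrightarrow> 0) at_top \<and> ((\<lambda>n. \<zeta> n - \<zeta>0 n) \<longlongrightarrow> 0) at_bot"
proof -
  note \<Phi> = \<open>fundamental_matrix B Q \<Phi>\<close>[unfolded B_def Q_def]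
  note \<Phi>0 = \<open>fundamental_matrix B (\<lambda>x. 0) \<Phi>0\<close>[unfolded B_def]
  have b: "b1 \<noteq> 0" "b2 \<noteq> 0" using assms(3,4) by auto
  \<comment> \<open>These are the coefficients r and s of the two dominant exponentials.\<close>
  have J: "bc_minor a 3 2 \<noteq> 0" "bc_minor a 1 4 \<noteq> 0" using \<open>regular_bc a\<close> by (auto simp: regular_bc_def)
  note free = char_det_free[OF b \<Phi>0, of a]
  have hol0: "char_det a \<Phi>0 holomorphic_on UNIV" unfolding free by (rule quad_exp_holomorphic)
  have hol: "(\<lambda>z. char_det a \<Phi> z - char_det a \<Phi>0 z) holomorphic_on UNIV"
    by (intro holomorphic_on_diff hol0 char_det_holomorphic[OF b assms(5,6) \<Phi>])
  \<comment> \<open>The perturbation is a difference, so that the free determinant plus it is again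
    the determinant of \<Phi>.\<close>
  have "\<exists>t. zero_sequence (\<lambda>z. char_det a \<Phi>0 z + (char_det a \<Phi> z - char_det a \<Phi>0 z)) t \<and>
    ((\<lambda>n. t n - \<zeta>0 n) \<longlongrightarrow> 0) at_top \<and> ((\<lambda>n. t n - \<zeta>0 n) \<longlongrightarrow> 0) at_bot"
  proof (rule zeros_asymptotic[OF hol0 hol, where W = "exp_weight b1 b2"])
    show "continuous_on UNIV (exp_weight b1 b2)"
      unfolding exp_weight_def[abs_def] by (intro continuous_intros)
    show "exp_weight b1 b2 z > 0" for z by (simp add: exp_weight_def add_pos_pos)
    show "zero_sequence (char_det a \<Phi>0) \<zeta>0" by fact
  qed (use char_det_asymptotic[OF assms(3-6) \<Phi> \<Phi>0, of _ a]
      quad_exp_lower[OF assms(3,4) J, of _ "bc_minor a 1 2" "bc_minor a 3 4", folded free] in blast)+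
  then show ?thesis by simp
qed

end
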